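(* Let $G$ be a finite abelian group. Every tame split decomposition configuration $(G,\mathcal T,\mathcal Z)$ is realizable over $\mathbb{Q}$. In particular, every tame ramification configuration $(G,\mathcal T)$ is realizable over $\mathbb{Q}$.
   Context: For a finite group $G$, $\operatorname{rank}(G)=s$ is the minimal number of elements which with their conjugates generate $G$. A (minimal) tame ramification configuration is a pair $(G,\mathcal T)$, $\mathcal T=\{T_1,\dots,T_s\}$ cyclic subgroups which with their conjugates generate $G$. A (minimal) tame decomposition configuration is $(G,\mathcal T,\mathcal Z)$ with $\mathcal Z=\{Z_1,\dots,Z_s\}$ subgroups, $T_i\trianglelefteq Z_i$, $Z_i/T_i$ cyclic; it is a tame split decomposition configuration if $Z_i=T_i$ for all $i$. Realizable over $\mathbb{Q}$: there exist a tamely ramified finite Galois extension $K/\mathbb{Q}$ and an isomorphism $\varphi:\operatorname{Gal}(K/\mathbb{Q})\to G$ such that, with $p_1,\dots,p_s$ all the finite primes ramified in $K$ (suitably ordered), for each $i$ some prime $\wp_i$ of $K$ over $p_i$ has inertia group $T(\wp_i/(p_i))$ with $\varphi(T(\wp_i/(p_i)))=T_i$ (and, for decomposition configurations, decomposition group with $\varphi(Z(\wp_i/(p_i)))=Z_i$). *)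

theory Defs
  imports Complex_Main "HOL-Computational_Algebra.Primes" "HOL-Algebra.Ideal" "HOL-Algebra.Generated_Groups"
begin

definition conj_closure :: "('a, 'b) monoid_scheme \<Rightarrow> 'a set \<Rightarrow> 'a set" where
  "conj_closure G S = {x \<otimes>\<^bsub>G\<^esub> s \<otimes>\<^bsub>G\<^esub> inv\<^bsub>G\<^esub> x | x s. x \<in> carrier G \<and> s \<in> S}"

definition grp_rank :: "('a, 'b) monoid_scheme \<Rightarrow> nat" where
  "grp_rank G = (LEAST s. \<exists>g :: nat \<Rightarrow> 'a. (\<forall>i<s. g i \<in> carrier G) \<and>
       generate G (conj_closure G (g ` {..<s})) = carrier G)"

definition cyclic_subgroup :: "('a, 'b) monoid_scheme \<Rightarrow> 'a set \<Rightarrow> bool" where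
  "cyclic_subgroup G H \<longleftrightarrow> (\<exists>g \<in> carrier G. H = generate G {g})"

definition tame_ram_config :: "('a, 'b) monoid_scheme \<Rightarrow> nat \<Rightarrow> (nat \<Rightarrow> 'a set) \<Rightarrow> bool" where
  "tame_ram_config G s T \<longleftrightarrow> s = grp_rank G \<and>
     (\<forall>i<s. cyclic_subgroup G (T i)) \<and>
     generate G (conj_closure G (\<Union>i<s. T i)) = carrier G"

definition tame_split_decomp_config ::
  "('a, 'b) monoid_scheme \<Rightarrow> nat \<Rightarrow> (nat \<Rightarrow> 'a set) \<Rightarrow> (nat \<Rightarrow> 'a set) \<Rightarrow> bool" where
  "tame_split_decomp_config G s T Z \<longleftrightarrow> tame_ram_config G s T \<and> (\<forall>i<s. Z i = T i)"

definition is_subfield :: "complex set \<Rightarrow> bool" where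
  "is_subfield K \<longleftrightarrow> 0 \<in> K \<and> 1 \<in> K \<and>
     (\<forall>x\<in>K. \<forall>y\<in>K. x + y \<in> K \<and> x - y \<in> K \<and> x * y \<in> K) \<and>
     (\<forall>x\<in>K. x \<noteq> 0 \<longrightarrow> inverse x \<in> K)"

definition number_field :: "complex set \<Rightarrow> bool" where
  "number_field K \<longleftrightarrow> is_subfield K \<and>
     (\<exists>B. finite B \<and> B \<subseteq> K \<and> (\<forall>x\<in>K. \<exists>c. x = (\<Sum>b\<in>B. of_rat (c b) * b)))"

text \<open>Field embeddings of K into the complex numbers (automatically Q-linear).\<close>
definition embeddings :: "complex set \<Rightarrow> (complex \<Rightarrow> complex) set" where
  "embeddings K = {\<tau>. inj_on \<tau> K \<and> \<tau> 1 = 1 \<and>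
     (\<forall>x\<in>K. \<forall>y\<in>K. \<tau> (x + y) = \<tau> x + \<tau> y \<and> \<tau> (x * y) = \<tau> x * \<tau> y)}"

text \<open>K/Q is Galois (normal; separability is automatic in characteristic 0).\<close>
definition galois_over_Q :: "complex set \<Rightarrow> bool" where
  "galois_over_Q K \<longleftrightarrow> number_field K \<and> (\<forall>\<tau>\<in>embeddings K. \<tau> ` K \<subseteq> K)"

definition auts :: "complex set \<Rightarrow> (complex \<Rightarrow> complex) set" where
  "auts K = {\<sigma>. \<sigma> \<in> embeddings K \<and> bij_betw \<sigma> K K \<and> (\<forall>x. x \<notin> K \<longrightarrow> \<sigma> x = x)}"

definition galois_group :: "complex set \<Rightarrow> (complex \<Rightarrow> complex) monoid" where
  "galois_group K = \<lparr>carrier = auts K, monoid.mult = (\<lambda>\<sigma> \<tau>. \<sigma> \<circ> \<tau>), one = id\<rparr>"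

definition algebraic_integer :: "complex \<Rightarrow> bool" where
  "algebraic_integer x \<longleftrightarrow> (\<exists>n (c :: nat \<Rightarrow> int). x ^ n + (\<Sum>i<n. of_int (c i) * x ^ i) = 0 \<and> n > 0)"

definition ring_of_integers :: "complex set \<Rightarrow> complex set" where
  "ring_of_integers K = {x \<in> K. algebraic_integer x}"

definition OK_ring :: "complex set \<Rightarrow> complex ring" where
  "OK_ring K = \<lparr>carrier = ring_of_integers K, monoid.mult = (*), one = 1,
                ring.zero = 0, add = (+)\<rparr>"

definition primes_over :: "complex set \<Rightarrow> nat \<Rightarrow> complex set set" where
  "primes_over K p = {P. primeideal P (OK_ring K) \<and> of_nat p \<in> P}"

definition add_span :: "complex set \<Rightarrow> complex set" where
  "add_span S = {(\<Sum>i<m. f i) | (m :: nat) f. \<forall>i<m. f i \<in> S}"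

fun ideal_pow :: "complex set \<Rightarrow> complex set \<Rightarrow> nat \<Rightarrow> complex set" where
  "ideal_pow K P 0 = ring_of_integers K"
| "ideal_pow K P (Suc n) = add_span {a * b | a b. a \<in> P \<and> b \<in> ideal_pow K P n}"

text \<open>e(P/p) = n, i.e. P^n exactly divides pO_K.\<close>
definition ram_index_is :: "complex set \<Rightarrow> complex set \<Rightarrow> nat \<Rightarrow> nat \<Rightarrow> bool" where
  "ram_index_is K P p n \<longleftrightarrow> of_nat p \<in> ideal_pow K P n \<and> of_nat p \<notin> ideal_pow K P (Suc n)"

definition ramified_in :: "complex set \<Rightarrow> nat \<Rightarrow> bool" where
  "ramified_in K p \<longleftrightarrow> (\<exists>P \<in> primes_over K p. of_nat p \<in> ideal_pow K P 2)"

definition tamely_ramified :: "complex set \<Rightarrow> bool" where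
  "tamely_ramified K \<longleftrightarrow> (\<forall>p P n. prime p \<and> P \<in> primes_over K p \<and> ram_index_is K P p n
       \<longrightarrow> \<not> p dvd n)"

definition decomposition_group :: "complex set \<Rightarrow> complex set \<Rightarrow> (complex \<Rightarrow> complex) set" where
  "decomposition_group K P = {\<sigma> \<in> auts K. \<sigma> ` P = P}"

definition inertia_group :: "complex set \<Rightarrow> complex set \<Rightarrow> (complex \<Rightarrow> complex) set" where
  "inertia_group K P = {\<sigma> \<in> auts K. \<sigma> ` P = P \<and> (\<forall>x \<in> ring_of_integers K. \<sigma> x - x \<in> P)}"

definition realizable_decomp ::
  "('a, 'b) monoid_scheme \<Rightarrow> nat \<Rightarrow> (nat \<Rightarrow> 'a set) \<Rightarrow> (nat \<Rightarrow> 'a set) \<Rightarrow> bool" where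
  "realizable_decomp G s T Z \<longleftrightarrow>
     (\<exists>K \<phi> (p :: nat \<Rightarrow> nat) Pr. galois_over_Q K \<and> tamely_ramified K \<and>
        \<phi> \<in> iso (galois_group K) G \<and>
        inj_on p {..<s} \<and> {q. prime q \<and> ramified_in K q} = p ` {..<s} \<and>
        (\<forall>i<s. Pr i \<in> primes_over K (p i) \<and>
               \<phi> ` inertia_group K (Pr i) = T i \<and>
               \<phi> ` decomposition_group K (Pr i) = Z i))"

definition realizable_ram ::
  "('a, 'b) monoid_scheme \<Rightarrow> nat \<Rightarrow> (nat \<Rightarrow> 'a set) \<Rightarrow> bool" where
  "realizable_ram G s T \<longleftrightarrow>
     (\<exists>K \<phi> (p :: nat \<Rightarrow> nat) Pr. galois_over_Q K \<and> tamely_ramified K \<and>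
        \<phi> \<in> iso (galois_group K) G \<and>
        inj_on p {..<s} \<and> {q. prime q \<and> ramified_in K q} = p ` {..<s} \<and>
        (\<forall>i<s. Pr i \<in> primes_over K (p i) \<and> \<phi> ` inertia_group K (Pr i) = T i))"

end

theory Submission
  imports Defs "HOL-Number_Theory.Number_Theory" "Jordan_Normal_Form.Char_Poly"
begin

text \<open>Choose primes \<open>p\<^sub>i \<equiv> 1\<close> modulo the order \<open>N\<close> of \<open>G\<close> such that each \<open>p\<^sub>i\<close> is an \<open>N\<close>-th power modulo every
  other \<open>p\<^sub>j\<close>, and let \<open>\<chi> : (\<int>/m)\<^sup>* \<rightarrow> G\<close> with \<open>m = \<Prod>p\<^sub>i\<close> send a primitive root modulo \<open>p\<^sub>i\<close> to a generator of
  \<open>T\<^sub>i\<close>. The field is the fixed field \<open>K\<close> of \<open>ker \<chi>\<close> in \<open>\<rat>(\<zeta>\<^sub>m)\<close>: the inertia group at \<open>p\<^sub>i\<close> is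
  \<open>\<chi>((\<int>/p\<^sub>i)\<^sup>*) = T\<^sub>i\<close>, and the power residue conditions say that the Frobenius at \<open>p\<^sub>i\<close> of the rest of the
  conductor is trivial.

  Prime ideals of \<open>K\<close> are cut out by a prime \<open>M\<close> of the ring of all algebraic integers. Instead of
  Dedekind theory, most local statements are read off from the sums \<open>Tr(x \<zeta>\<^sup>k)\<close> by Fourier inversion
  over \<open>k\<close>, which isolates the contribution of the inertia group.

  For the choice of primes, a generic integer combination \<open>\<theta>\<close> of \<open>\<zeta>\<^sub>m\<close> and the \<open>N\<close>-th roots of the previous primes
  is congruent to an integer modulo primes over infinitely many \<open>p\<close>; for large \<open>p\<close> this forces all the
  summands to be congruent to integers, so that \<open>p\<close> splits in the Kummer extension they generate.\<close>

section \<open>Algebraic integers\<close>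

text \<open>Two consequences of the hypotheses make the construction possible. As \<open>N\<close>
  divides \<open>p i - 1\<close>, a primitive root modulo \<open>p i\<close> can be sent to any
  element of \<open>G\<close>. As the number of subgroups is the rank, none of them is trivial, so
  each \<open>p i\<close> really ramifies. The power residue conditions are arranged one prime at a
  time: a new prime that is 1 modulo the earlier ones is an \<open>N\<close>-th power there at no
  cost, and only the converse condition needs splitting in a Kummer extension. Ramification is
  defined by powers of prime ideals of \<open>K\<close>. To bound an exponent from above, an element
  of \<open>P ^ k\<close> is multiplied by some \<open>c\<close> congruent to 1 modulo
  \<open>P\<close>, after which ordinary divisibility by the \<open>k\<close>-th power of a fixed
  number can be tested. To bound it from below, two elements of the prime are exhibited whose
  product is \<open>p\<close> up to a unit there. Both arguments rest on a congruence between
  \<open>x ^ Q\<close> and \<open>x\<close> for a fixed power \<open>Q\<close> of the prime.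
  Tameness enters because inertia groups at \<open>p\<close> have fewer than \<open>p\<close>
  elements, so that their orders can be cancelled.\<close>

lemma algebraic_integer_iff: "algebraic_integer x \<longleftrightarrow> algebraic_int x"
proof
  assume "algebraic_integer x"
  then obtain n c where n: "x ^ n + (\<Sum>i<n. of_int (c i) * x ^ i) = 0" "n > 0"
    unfolding algebraic_integer_def by blast
  define p where "p = monom 1 n + (\<Sum>i<n. monom (of_int (c i) :: complex) i)"
  have cf: "coeff p i = (if i = n then 1 else if i < n then of_int (c i) else 0)" for i
    by (auto simp: p_def coeff_sum)
  have deg: "degree p = n"
    by (intro antisym degree_le le_degree) (simp_all add: cf)
  show "algebraic_int x"
  proof (rule algebraic_int.intros[of p])
    show "poly p x = 0" using n(1) by (simp add: p_def poly_sum poly_monom)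
  qed (auto simp: deg cf)
next
  assume "algebraic_int x"
  then obtain p where p: "lead_coeff p = 1" "\<forall>i. coeff p i \<in> \<int>" "poly p x = 0"
    by (auto elim: algebraic_int.cases)
  have "\<forall>i. \<exists>k. coeff p i = of_int k"
    using p(2) by (auto elim: Ints_cases)
  then obtain c where c: "\<And>i. coeff p i = of_int (c i)" by metis
  have "degree p > 0"
    using p by (intro Nat.gr0I) (auto elim!: degree_eq_zeroE)
  moreover have "x ^ degree p + (\<Sum>i<degree p. of_int (c i) * x ^ i) = poly p x"
    using p(1) unfolding poly_altdef lessThan_Suc_atMost[symmetric] sum.lessThan_Suc
    by (simp only: c[symmetric] mult_1_left add.commute)
  then have "x ^ degree p + (\<Sum>i<degree p. of_int (c i) * x ^ i) = 0"
    using p(3) by simp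
  ultimately show "algebraic_integer x" unfolding algebraic_integer_def by blast
qed

text \<open>\<open>v\<close> is an eigenvector of the integer matrix \<open>A\<close> for the
  eigenvalue \<open>x\<close>, and the characteristic polynomial of \<open>A\<close> is monic with
  integer coefficients.\<close>

lemma algebraic_int_if_stable_lattice:
  fixes x :: complex and v :: "nat \<Rightarrow> complex"
  assumes "k < n" "v k \<noteq> 0"
    and eq: "\<And>i. i < n \<Longrightarrow> x * v i = (\<Sum>j<n. of_int (A i j) * v j)"
  shows "algebraic_int x"
proof -
  define B where "B = Matrix.mat n n (\<lambda>(i,j). A i j)"
  have B: "B \<in> carrier_mat n n" by (simp add: B_def)
  let ?C = "map_mat of_int B :: complex mat"
  have C: "?C \<in> carrier_mat n n" using B by simp
  let ?v = "Matrix.vec n v"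
  have "eigenvector ?C ?v x"
    unfolding eigenvector_def
  proof (intro conjI)
    show "?v \<in> carrier_vec (dim_row ?C)" using B by auto
    show "?v \<noteq> 0\<^sub>v (dim_row ?C)"
      using assms(1,2) B by (auto simp: vec_eq_iff)
    show "?C *\<^sub>v ?v = x \<cdot>\<^sub>v ?v"
      by (rule eq_vecI) (auto simp: B_def scalar_prod_def eq atLeast0LessThan)
  qed
  then have "eigenvalue ?C x" unfolding eigenvalue_def by blast
  then have "poly (char_poly ?C) x = 0"
    using eigenvalue_root_char_poly[OF C] by blast
  moreover have "char_poly ?C = map_poly of_int (char_poly B)"
    by (rule of_int_hom.char_poly_hom[OF B])
  moreover have "lead_coeff (char_poly B) = 1"
    using degree_monic_char_poly[OF B] by auto
  ultimately show ?thesis unfolding algebraic_int_altdef_ipoly by auto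
qed

lemma algebraic_int_power_reduce:
  fixes x :: complex
  assumes "algebraic_int x"
  obtains d and c :: "nat \<Rightarrow> int" where "d > 0" "x ^ d = (\<Sum>i<d. of_int (c i) * x ^ i)"
proof -
  from assms obtain n c where n: "x ^ n + (\<Sum>i<n. of_int (c i) * x ^ i) = 0" "n > 0"
    unfolding algebraic_integer_iff[symmetric] algebraic_integer_def by blast
  have "x ^ n = - (\<Sum>i<n. of_int (c i) * x ^ i)"
    using n(1) by (metis eq_neg_iff_add_eq_0)
  then show thesis
    using that[of n "\<lambda>i. - c i"] n(2) by (simp add: sum_negf)
qed

text \<open>The monomials \<open>x ^ i * y ^ j\<close> with \<open>i < d\<close> and
  \<open>j < e\<close> span a lattice stable under \<open>x\<close> and \<open>y\<close>, hence
  under \<open>x + y\<close> and \<open>x * y\<close>, and the previous lemma applies to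
  both.\<close>

lemma
  fixes x y :: complex
  assumes "algebraic_int x" "algebraic_int y"
  shows algebraic_int_add: "algebraic_int (x + y)"
    and algebraic_int_mult: "algebraic_int (x * y)"
proof -
  obtain d c where d: "d > 0" and x: "x ^ d = (\<Sum>i<d. of_int (c i) * x ^ i)"
    using algebraic_int_power_reduce[OF assms(1)] by blast
  obtain e b where e: "e > 0" and y: "y ^ e = (\<Sum>i<e. of_int (b i) * y ^ i)"
    using algebraic_int_power_reduce[OF assms(2)] by blast
  \<comment> \<open>Residue and quotient by \<open>d\<close> encode the pair of exponents in one
    index below \<open>d * e\<close>; \<open>v 0 = 1\<close> is the nonzero entry needed at the
    end.\<close>
  define v where "v k = x ^ (k mod d) * y ^ (k div d)" for k
  define S where "S = {z. \<exists>a :: nat \<Rightarrow> int. z = (\<Sum>j<d*e. of_int (a j) * v j)}"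
  have S_add: "z + w \<in> S" if "z \<in> S" "w \<in> S" for z w
  proof -
    from that obtain a a' where "z = (\<Sum>j<d*e. of_int (a j) * v j)"
      "w = (\<Sum>j<d*e. of_int (a' j) * v j)" unfolding S_def by blast
    then have "z + w = (\<Sum>j<d*e. of_int (a j + a' j) * v j)"
      by (simp add: algebra_simps sum.distrib)
    then show ?thesis unfolding S_def by (intro CollectI exI[of _ "\<lambda>j. a j + a' j"])
  qed
  have S_scale: "of_int k * z \<in> S" if "z \<in> S" for z k
  proof -
    from that obtain a where "z = (\<Sum>j<d*e. of_int (a j) * v j)" unfolding S_def by blast
    then have "of_int k * z = (\<Sum>j<d*e. of_int (k * a j) * v j)"
      by (simp add: algebra_simps sum_distrib_left)
    then show ?thesis unfolding S_def by (intro CollectI exI[of _ "\<lambda>j. k * a j"])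
  qed
  have S0: "0 \<in> S" unfolding S_def by (intro CollectI exI[of _ "\<lambda>j. 0"]) simp
  have S_sum: "(\<Sum>i\<in>A. of_int (k i) * f i) \<in> S" if "\<And>i. i \<in> A \<Longrightarrow> f i \<in> S" "finite A"
    for A :: "nat set" and k f
    using that(2,1) by (induction A rule: finite_induct) (auto intro: S0 S_add S_scale)
  have mon: "x ^ i * y ^ j \<in> S" if "i < d" "j < e" for i j
  proof -
    have lt: "i + d * j < d * e"
    proof -
      have "i + d * j < d * Suc j" using that by simp
      also have "\<dots> \<le> d * e" using that by (intro mult_le_mono2) simp
      finally show ?thesis .
    qed
    have "(\<Sum>k<d*e. of_int (if k = i + d * j then 1 else 0) * v k) = (\<Sum>k\<in>{i + d * j}. v k)"
      by (rule sum.mono_neutral_cong_right) (use lt in auto)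
    also have "\<dots> = x ^ i * y ^ j" using that by (simp add: v_def)
    finally show ?thesis unfolding S_def
      by (intro CollectI exI[of _ "\<lambda>k. if k = i + d * j then 1 else 0"]) simp
  qed
  have xv: "x * v k \<in> S" if k: "k < d * e" for k
  proof -
    have kd: "k mod d < d" "k div d < e" using k d by (auto simp: less_mult_imp_div_less mult.commute)
    have eq: "x * v k = x ^ Suc (k mod d) * y ^ (k div d)" by (simp add: v_def)
    show ?thesis
    proof (cases "Suc (k mod d) < d")
      case True
      then show ?thesis unfolding eq by (intro mon kd)
    next
      case False
      then have "Suc (k mod d) = d" using kd by simp
      then have "x * v k = (\<Sum>i<d. of_int (c i) * (x ^ i * y ^ (k div d)))"
        unfolding eq by (simp add: x sum_distrib_right mult.assoc)
      then show ?thesis using S_sum[of "{..<d}" "\<lambda>i. x ^ i * y ^ (k div d)" c] mon kd by simp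
    qed
  qed
  have yv: "y * v k \<in> S" if k: "k < d * e" for k
  proof -
    have kd: "k mod d < d" "k div d < e" using k d by (auto simp: less_mult_imp_div_less mult.commute)
    have eq: "y * v k = x ^ (k mod d) * y ^ Suc (k div d)" by (simp add: v_def)
    show ?thesis
    proof (cases "Suc (k div d) < e")
      case True
      then show ?thesis unfolding eq by (intro mon kd)
    next
      case False
      then have "Suc (k div d) = e" using kd by simp
      then have "y * v k = (\<Sum>i<e. of_int (b i) * (x ^ (k mod d) * y ^ i))"
        unfolding eq by (simp add: y sum_distrib_left mult_ac)
      then show ?thesis using S_sum[of "{..<e}" "\<lambda>i. x ^ (k mod d) * y ^ i" b] mon kd by simp
    qed
  qed
  have xS: "x * z \<in> S" if "z \<in> S" for z
  proof -
    from that obtain a where "z = (\<Sum>j<d*e. of_int (a j) * v j)" unfolding S_def by blast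
    then have "x * z = (\<Sum>j<d*e. of_int (a j) * (x * v j))"
      by (simp add: sum_distrib_left mult_ac)
    then show ?thesis using S_sum[of "{..<d*e}" "\<lambda>j. x * v j" a] xv by simp
  qed
  have main: "algebraic_int z" if "\<And>k. k < d * e \<Longrightarrow> z * v k \<in> S" for z
  proof -
    have "\<forall>k. \<exists>a :: nat \<Rightarrow> int. k < d * e \<longrightarrow> z * v k = (\<Sum>j<d*e. of_int (a j) * v j)"
      using that unfolding S_def by blast
    then obtain A where "\<And>k. k < d * e \<Longrightarrow> z * v k = (\<Sum>j<d*e. of_int (A k j :: int) * v j)"
      by metis
    then show ?thesis
      by (intro algebraic_int_if_stable_lattice[of 0 "d*e" v]) (use d e in \<open>auto simp: v_def\<close>)
  qed
  show "algebraic_int (x + y)" by (rule main) (simp add: ring_distribs S_add xv yv)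
  show "algebraic_int (x * y)"
  proof (rule main)
    fix k assume "k < d * e"
    then have "x * (y * v k) \<in> S" by (intro xS yv)
    then show "x * y * v k \<in> S" by (simp only: mult.assoc)
  qed
qed

lemma algebraic_int_closed:
  fixes x y :: complex
  shows "algebraic_int (of_nat k :: complex)" "algebraic_int (of_int j :: complex)"
    "algebraic_int x \<Longrightarrow> algebraic_int y \<Longrightarrow> algebraic_int (x - y)"
    "algebraic_int x \<Longrightarrow> algebraic_int (x ^ k)"
    "algebraic_int (1 :: complex)"
    "algebraic_int (numeral w :: complex)"
proof -
  show "algebraic_int x \<Longrightarrow> algebraic_int y \<Longrightarrow> algebraic_int (x - y)"
    using algebraic_int_add[of x "-y"] by simp
  show 1: "algebraic_int (1 :: complex)" by (rule int_imp_algebraic_int) simp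
  show "algebraic_int x \<Longrightarrow> algebraic_int (x ^ k)"
    by (induction k) (auto intro: 1 algebraic_int_mult)
qed (simp_all add: int_imp_algebraic_int)

lemma algebraic_int_sum:
  "(\<And>i. i \<in> A \<Longrightarrow> algebraic_int (f i :: complex)) \<Longrightarrow> algebraic_int (sum f A)"
  by (induction A rule: infinite_finite_induct) (auto intro: algebraic_int_add)

lemma algebraic_int_prod:
  "(\<And>i. i \<in> A \<Longrightarrow> algebraic_int (f i :: complex)) \<Longrightarrow> algebraic_int (prod f A)"
  by (induction A rule: infinite_finite_induct) (auto intro: algebraic_int_mult algebraic_int_closed)

lemmas algebraic_int_intros = algebraic_int_closed algebraic_int_add algebraic_int_mult algebraic_int_sum
  algebraic_int_prod algebraic_int_minus

section \<open>Divisibility and congruences between algebraic integers\<close>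

definition zdvd :: "complex \<Rightarrow> complex \<Rightarrow> bool" (infix "zdvd" 50) where
  "a zdvd b \<longleftrightarrow> (\<exists>c. algebraic_int c \<and> b = a * c)"

lemma zdvdI: "algebraic_int c \<Longrightarrow> b = a * c \<Longrightarrow> a zdvd b"
  by (auto simp: zdvd_def)

lemma zdvd_0 [simp]: "a zdvd 0"
  by (auto simp: zdvd_def intro!: exI[of _ 0])

lemma zdvd_refl [simp]: "a zdvd a"
  by (auto simp: zdvd_def intro!: exI[of _ 1] algebraic_int_closed)

lemma zdvd_add: "a zdvd b \<Longrightarrow> a zdvd c \<Longrightarrow> a zdvd b + c"
  unfolding zdvd_def by (metis algebraic_int_add distrib_left)

lemma zdvd_minus: "a zdvd b \<Longrightarrow> a zdvd - b"
  unfolding zdvd_def by (metis algebraic_int_minus mult_minus_right)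

lemma zdvd_diff: "a zdvd b \<Longrightarrow> a zdvd c \<Longrightarrow> a zdvd b - c"
  using zdvd_add[of a b "-c"] zdvd_minus[of a c] by simp

lemma zdvd_diff_commute: "a zdvd b - c \<Longrightarrow> a zdvd c - b"
  using zdvd_minus[of a "b - c"] by simp

lemma zdvd_diff_trans: "a zdvd b - c \<Longrightarrow> a zdvd c - d \<Longrightarrow> a zdvd b - d"
  using zdvd_add[of a "b - c" "c - d"] by simp

lemma zdvd_mult: "a zdvd b \<Longrightarrow> algebraic_int c \<Longrightarrow> a zdvd b * c"
  unfolding zdvd_def by (metis algebraic_int_mult mult.assoc)

lemma zdvd_mult2: "a zdvd b \<Longrightarrow> algebraic_int c \<Longrightarrow> a zdvd c * b"
  using zdvd_mult[of a b c] by (simp add: mult.commute)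

lemma zdvd_trans: "a zdvd b \<Longrightarrow> b zdvd c \<Longrightarrow> a zdvd c"
  unfolding zdvd_def by (metis algebraic_int_mult mult.assoc)

lemma zdvd_mono: "a zdvd b \<Longrightarrow> c zdvd d \<Longrightarrow> a * c zdvd b * d"
  unfolding zdvd_def using algebraic_int_mult by (metis mult.assoc mult.left_commute)

lemma zdvd_power: "a zdvd b \<Longrightarrow> a ^ k zdvd b ^ k"
  by (induction k) (auto intro: zdvd_mono)

lemma zdvd_sum: "(\<And>i. i \<in> A \<Longrightarrow> a zdvd f i) \<Longrightarrow> a zdvd sum f A"
  by (induction A rule: infinite_finite_induct) (auto intro: zdvd_add)

lemma zdvd_algebraic_int: "algebraic_int a \<Longrightarrow> a zdvd b \<Longrightarrow> algebraic_int b"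
  by (auto simp: zdvd_def intro: algebraic_int_mult)

lemma zdvd_mult_diff:
  assumes "a zdvd b - b'" "a zdvd c - c'" "algebraic_int c" "algebraic_int b'"
  shows "a zdvd b * c - b' * c'"
proof -
  have "b * c - b' * c' = (b - b') * c + b' * (c - c')" by (simp add: algebra_simps)
  then show ?thesis using assms by (simp add: zdvd_add zdvd_mult zdvd_mult2)
qed

lemma zdvd_power_diff:
  assumes "a zdvd b - c" "algebraic_int b" "algebraic_int c"
  shows "a zdvd b ^ k - c ^ k"
  using assms by (induction k) (auto intro!: zdvd_mult_diff algebraic_int_closed)

lemma algebraic_int_power_root:
  fixes x :: complex
  assumes "algebraic_int (x ^ k)" "k > 0"
  shows "algebraic_int x"
  using assms by (intro algebraic_int_root[of "x ^ k" "monom 1 k" x])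
    (auto simp: poly_monom degree_monom_eq coeff_monom)

text \<open>A rational algebraic integer is an integer. This is how congruences between algebraic
  integers come back to ordinary ones.\<close>

lemma of_int_zdvd_iff: "of_int a zdvd of_int b \<longleftrightarrow> a dvd b"
proof
  assume "of_int a zdvd of_int b"
  then obtain c where c: "algebraic_int c" "(of_int b :: complex) = of_int a * c"
    by (auto simp: zdvd_def)
  show "a dvd b"
  proof (cases "a = 0")
    case False
    then have "c = of_int b / of_int a" using c by (simp add: field_simps)
    then have "c \<in> \<rat>" by simp
    then have "c \<in> \<int>" using c rational_algebraic_int_is_int by blast
    then obtain k where "c = of_int k" by (auto elim: Ints_cases)
    then have "b = a * k" using c by (metis of_int_eq_iff of_int_mult)
    then show ?thesis by simp
  qed (use c in simp)
next
  assume "a dvd b"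
  then show "of_int a zdvd of_int b"
    unfolding zdvd_def by (metis algebraic_int_closed(2) dvdE of_int_mult)
qed

lemma of_nat_zdvd_iff: "of_nat a zdvd of_nat b \<longleftrightarrow> a dvd b"
  using of_int_zdvd_iff[of "int a" "int b"] by simp

lemma of_nat_zdvd_of_int_iff: "of_nat a zdvd of_int b \<longleftrightarrow> int a dvd b"
  using of_int_zdvd_iff[of "int a" b] by simp

lemma zdvd_cancel_of_nat:
  assumes "coprime n (q :: nat)" "of_nat q zdvd of_nat n * x" "algebraic_int x"
  shows "of_nat q zdvd x"
proof -
  obtain u v where "u * int n + v * int q = 1"
    using assms(1) by (metis bezout_int coprime_int_iff coprime_iff_gcd_eq_1)
  then have "x = of_int (u * int n + v * int q) * x" by simp
  also have "\<dots> = of_int u * (of_nat n * x) + of_nat q * (of_int v * x)"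
    by (simp add: algebra_simps)
  also have "of_nat q zdvd \<dots>"
    by (rule zdvd_add[OF zdvd_mult2[OF assms(2)] zdvd_mult[OF zdvd_refl]])
      (use assms(3) in \<open>auto intro: algebraic_int_intros\<close>)
  finally show ?thesis .
qed

lemma zdvd_frobenius_add:
  assumes "prime q" "algebraic_int x" "algebraic_int y"
  shows "of_nat q zdvd (x + y) ^ q - (x ^ q + y ^ q)"
proof -
  have q: "q \<ge> 2" using assms(1) prime_ge_2_nat by blast
  have "{..q} = insert 0 (insert q {1..<q})" using q by auto
  then have "(x + y) ^ q = y ^ q + (x ^ q + (\<Sum>k\<in>{1..<q}. of_nat (q choose k) * x ^ k * y ^ (q - k)))"
    using q by (simp add: binomial_ring)
  moreover have "of_nat q zdvd (\<Sum>k\<in>{1..<q}. of_nat (q choose k) * x ^ k * y ^ (q - k))"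
  proof (intro zdvd_sum zdvd_mult)
    fix k assume "k \<in> {1..<q}"
    then have "q dvd (q choose k)" using assms(1) q by (intro dvd_choose_prime) auto
    then show "of_nat q zdvd of_nat (q choose k)" by (simp add: of_nat_zdvd_iff)
  qed (use assms in \<open>auto intro: algebraic_int_intros\<close>)
  ultimately show ?thesis by simp
qed

lemma zdvd_frobenius_sum:
  assumes "prime q" "\<And>i. i \<in> A \<Longrightarrow> algebraic_int (f i)"
  shows "of_nat q zdvd (sum f A) ^ q - (\<Sum>i\<in>A. f i ^ q)"
  using assms(2)
proof (induction A rule: infinite_finite_induct)
  case (insert a A)
  have "of_nat q zdvd (f a + sum f A) ^ q - (f a ^ q + sum f A ^ q)"
    using insert by (intro zdvd_frobenius_add assms(1) algebraic_int_sum) auto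
  moreover have "of_nat q zdvd (f a ^ q + sum f A ^ q) - (f a ^ q + (\<Sum>i\<in>A. f i ^ q))"
    using insert by simp
  ultimately show ?case using insert zdvd_diff_trans by simp
qed (use assms(1) prime_gt_0_nat[of q] in \<open>auto simp: zero_power\<close>)

text \<open>A natural number is a sum of ones, on which Frobenius is additive modulo
  \<open>q\<close>; an arbitrary integer is first replaced by its residue.\<close>

lemma zdvd_fermat:
  assumes "prime q"
  shows "of_nat q zdvd of_int c ^ q - of_int c"
proof -
  define n where "n = nat (c mod int q)"
  have "of_nat q zdvd (\<Sum>i<n. 1) ^ q - (\<Sum>i<n. 1 ^ q)"
    by (intro zdvd_frobenius_sum assms algebraic_int_closed)
  then have n: "of_nat q zdvd of_nat n ^ q - of_nat n" by simp
  have "int n = c mod int q" using assms prime_gt_0_nat by (simp add: n_def)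
  then have "int q dvd c - int n" by (simp add: mod_eq_dvd_iff[symmetric])
  then have "of_nat q zdvd of_int (c - int n)" by (simp only: of_nat_zdvd_of_int_iff)
  then have c: "of_nat q zdvd of_int c - of_nat n" by simp
  then have "of_nat q zdvd of_int c ^ q - of_nat n ^ q"
    by (intro zdvd_power_diff algebraic_int_closed)
  from zdvd_diff_trans[OF zdvd_diff_trans[OF this n] zdvd_diff_commute[OF c]] show ?thesis .
qed

section \<open>Ideals and primes of the ring of all algebraic integers\<close>

definition Zideal :: "complex set \<Rightarrow> bool" where
  "Zideal I \<longleftrightarrow> (\<forall>x\<in>I. algebraic_int x) \<and> 0 \<in> I \<and> (\<forall>x\<in>I. \<forall>y\<in>I. x + y \<in> I) \<and>
     (\<forall>x\<in>I. \<forall>c. algebraic_int c \<longrightarrow> c * x \<in> I)"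

definition Zprime :: "complex set \<Rightarrow> bool" where
  "Zprime M \<longleftrightarrow> Zideal M \<and> 1 \<notin> M \<and>
     (\<forall>x y. algebraic_int x \<longrightarrow> algebraic_int y \<longrightarrow> x * y \<in> M \<longrightarrow> x \<in> M \<or> y \<in> M)"

lemma Zideal_add_multiples:
  assumes "Zideal I" "algebraic_int x"
  shows "Zideal {i + c * x | i c. i \<in> I \<and> algebraic_int c}" (is "Zideal ?J")
proof -
  have "i + c * x + (i' + c' * x) \<in> ?J"
    if "i \<in> I" "i' \<in> I" "algebraic_int c" "algebraic_int c'" for i i' c c'
    using that assms
    by (intro CollectI exI[of _ "i + i'"] exI[of _ "c + c'"])
      (auto simp: Zideal_def algebra_simps intro: algebraic_int_add)
  moreover have "d * (i + c * x) \<in> ?J"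
    if "i \<in> I" "algebraic_int c" "algebraic_int d" for i c d
    using that assms
    by (intro CollectI exI[of _ "d * i"] exI[of _ "d * c"])
      (auto simp: Zideal_def algebra_simps intro: algebraic_int_mult)
  moreover have "0 \<in> ?J"
    using assms by (intro CollectI exI[of _ 0]) (auto simp: Zideal_def)
  ultimately show ?thesis unfolding Zideal_def
    using assms by (auto simp: Zideal_def intro!: algebraic_int_add algebraic_int_mult)
qed

text \<open>Zorn's lemma gives an ideal maximal among those that contain \<open>I\<close> and avoid
  1. It is prime because adjoining any algebraic integer outside it produces 1.\<close>

lemma Zprime_exists:
  assumes "Zideal I" "1 \<notin> I"
  obtains M where "Zprime M" "I \<subseteq> M"
proof -
  define F where "F = {J. Zideal J \<and> I \<subseteq> J \<and> 1 \<notin> J}"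
  have "\<exists>M\<in>F. \<forall>X\<in>F. M \<subseteq> X \<longrightarrow> X = M"
  proof (rule subset_Zorn_nonempty)
    show "F \<noteq> {}" using assms by (auto simp: F_def)
  next
    fix C assume C: "C \<noteq> {}" "subset.chain F C"
    have CF: "J \<in> F" if "J \<in> C" for J using C that by (auto simp: subset.chain_def)
    have "x + y \<in> \<Union>C" if x: "x \<in> \<Union>C" and y: "y \<in> \<Union>C" for x y
    proof -
      obtain X Y where XY: "X \<in> C" "x \<in> X" "Y \<in> C" "y \<in> Y" using x y by blast
      then have "X \<subseteq> Y \<or> Y \<subseteq> X" using C by (auto simp: subset.chain_def)
      then obtain Z where "Z \<in> C" "x \<in> Z" "y \<in> Z" using XY by blast
      then show ?thesis using CF[of Z] by (auto simp: F_def Zideal_def)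
    qed
    moreover obtain X where "X \<in> C" using C(1) by blast
    moreover have "c * x \<in> \<Union>C" if x: "x \<in> \<Union>C" "algebraic_int c" for x c
    proof -
      obtain Z where "Z \<in> C" "x \<in> Z" using x by blast
      then show ?thesis using CF[of Z] x(2) by (intro UnionI[of Z]) (simp_all add: F_def Zideal_def)
    qed
    moreover have "algebraic_int x" if "x \<in> \<Union>C" for x
      using that CF by (auto simp: F_def Zideal_def)
    moreover have "0 \<in> X" using CF[OF \<open>X \<in> C\<close>] by (simp add: F_def Zideal_def)
    ultimately have "Zideal (\<Union>C)" unfolding Zideal_def by (meson UnionI)
    moreover have "I \<subseteq> \<Union>C" "1 \<notin> \<Union>C" using CF \<open>X \<in> C\<close> by (auto simp: F_def)
    ultimately show "\<Union>C \<in> F" by (simp add: F_def)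
  qed
  then obtain M where M: "M \<in> F" and max: "\<And>X. X \<in> F \<Longrightarrow> M \<subseteq> X \<Longrightarrow> X = M" by blast
  have idM: "Zideal M" and 1: "1 \<notin> M" and IM: "I \<subseteq> M" using M by (auto simp: F_def)
  have comax: "\<exists>i c. i \<in> M \<and> algebraic_int c \<and> 1 = i + c * x" if x: "algebraic_int x" "x \<notin> M" for x
  proof (rule ccontr)
    assume neg: "\<not> ?thesis"
    let ?J = "{i + c * x | i c. i \<in> M \<and> algebraic_int c}"
    have "M \<subseteq> ?J"
    proof
      fix i assume "i \<in> M"
      then show "i \<in> ?J" by (intro CollectI exI[of _ i] exI[of _ 0]) auto
    qed
    moreover have "?J \<in> F"
      using Zideal_add_multiples[OF idM x(1)] calculation IM neg by (auto simp: F_def)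
    ultimately have "?J = M" using max by blast
    moreover have "x \<in> ?J"
      using idM by (intro CollectI exI[of _ 0] exI[of _ 1]) (auto simp: Zideal_def intro: algebraic_int_closed)
    ultimately show False using x by simp
  qed
  have "x \<in> M \<or> y \<in> M" if xy: "algebraic_int x" "algebraic_int y" "x * y \<in> M" for x y
  proof (rule ccontr)
    assume "\<not> ?thesis"
    then obtain i c j d where ij: "i \<in> M" "algebraic_int c" "1 = i + c * x"
      "j \<in> M" "algebraic_int d" "1 = j + d * y" using comax xy by metis
    have "1 = (i + c * x) * (j + d * y)" using ij(3,6) by (metis mult_1)
    also have "\<dots> = (j + d * y) * i + ((c * x) * j + (c * d) * (x * y))" by (simp add: algebra_simps)
    also have "\<dots> \<in> M"
    proof -
      have add: "u + v \<in> M" if "u \<in> M" "v \<in> M" for u v using idM that by (auto simp: Zideal_def)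
      have mul: "u * v \<in> M" if "algebraic_int u" "v \<in> M" for u v using idM that by (auto simp: Zideal_def)
      have "algebraic_int j" using idM ij(4) by (auto simp: Zideal_def)
      then show ?thesis using ij(1,2,4,5) xy
        by (intro add mul[of "j + d * y" i] mul[of "c * x" j] mul[of "c * d" "x * y"])
          (simp_all add: algebraic_int_add algebraic_int_mult)
    qed
    finally show False using 1 by simp
  qed
  with idM 1 have "Zprime M" unfolding Zprime_def by blast
  then show thesis using that IM by blast
qed

lemma
  assumes "Zprime M"
  shows Zprime_0: "0 \<in> M" and Zprime_1: "1 \<notin> M"
    and Zprime_add: "x \<in> M \<Longrightarrow> y \<in> M \<Longrightarrow> x + y \<in> M"
    and Zprime_mult: "x \<in> M \<Longrightarrow> algebraic_int c \<Longrightarrow> c * x \<in> M"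
    and Zprime_mult2: "x \<in> M \<Longrightarrow> algebraic_int c \<Longrightarrow> x * c \<in> M"
    and Zprime_algebraic_int: "x \<in> M \<Longrightarrow> algebraic_int x"
    and Zprime_mult_iff: "algebraic_int x \<Longrightarrow> algebraic_int y \<Longrightarrow> x * y \<in> M \<longleftrightarrow> x \<in> M \<or> y \<in> M"
  using assms unfolding Zprime_def Zideal_def by (auto simp: mult.commute)

lemma Zprime_minus: "Zprime M \<Longrightarrow> x \<in> M \<Longrightarrow> - x \<in> M"
  using Zprime_mult[of M x "-1"] algebraic_int_closed(5) by (simp add: algebraic_int_minus)

lemma Zprime_diff: "Zprime M \<Longrightarrow> x \<in> M \<Longrightarrow> y \<in> M \<Longrightarrow> x - y \<in> M"
  using Zprime_add[of M x "-y"] Zprime_minus[of M y] by simp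

lemma Zprime_cong_iff: "Zprime M \<Longrightarrow> x - y \<in> M \<Longrightarrow> x \<in> M \<longleftrightarrow> y \<in> M"
  using Zprime_add[of M "x - y" y] Zprime_diff[of M x "x - y"] by auto

lemma Zprime_sum: "Zprime M \<Longrightarrow> (\<And>i. i \<in> A \<Longrightarrow> f i \<in> M) \<Longrightarrow> sum f A \<in> M"
  by (induction A rule: infinite_finite_induct) (auto intro: Zprime_0 Zprime_add)

lemma Zprime_power:
  assumes "Zprime M" "algebraic_int x" "x ^ k \<in> M" shows "x \<in> M"
  using assms(3)
proof (induction k)
  case (Suc k)
  then show ?case using assms Zprime_mult_iff[of M x "x ^ k"] algebraic_int_closed(4) by auto
qed (use assms Zprime_1 in auto)

lemma Zprime_prod_mem:
  assumes "Zprime M" "prod f A \<in> M" "\<And>i. i \<in> A \<Longrightarrow> algebraic_int (f i)"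
  shows "\<exists>i\<in>A. f i \<in> M"
  using assms(2,3)
proof (induction A rule: infinite_finite_induct)
  case (insert a A)
  then have "f a \<in> M \<or> prod f A \<in> M"
    using Zprime_mult_iff[OF assms(1), of "f a" "prod f A"] by (auto intro: algebraic_int_prod)
  then show ?case using insert by auto
qed (use assms(1) Zprime_1 in auto)

lemma Zprime_zdvd: "Zprime M \<Longrightarrow> a \<in> M \<Longrightarrow> a zdvd b \<Longrightarrow> b \<in> M"
  by (auto simp: zdvd_def intro: Zprime_mult2)

lemma Zprime_of_int_iff:
  assumes "Zprime M" "prime p" "of_nat p \<in> M"
  shows "of_int n \<in> M \<longleftrightarrow> int p dvd n"
proof
  assume "int p dvd n"
  then show "of_int n \<in> M"
    using Zprime_zdvd[OF assms(1,3), of "of_int n"] by (simp add: of_nat_zdvd_of_int_iff)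
next
  assume n: "of_int n \<in> M"
  show "int p dvd n"
  proof (rule ccontr)
    assume "\<not> int p dvd n"
    then have "coprime (int p) n" using assms(2) by (simp add: prime_imp_coprime)
    then obtain u v where "u * int p + v * n = 1" by (metis bezout_int coprime_iff_gcd_eq_1)
    then have "of_int (u * int p + v * n) = (1 :: complex)" by simp
    then have "1 = of_int u * of_nat p + of_int v * (of_int n :: complex)" by simp
    then have "1 \<in> M" using assms n
      by (metis Zprime_add Zprime_mult algebraic_int_closed(2))
    then show False using assms Zprime_1 by blast
  qed
qed

lemma Zprime_of_nat_iff:
  assumes "Zprime M" "prime p" "of_nat p \<in> M"
  shows "of_nat n \<in> M \<longleftrightarrow> p dvd n"
  using Zprime_of_int_iff[OF assms, of "int n"] by simp

section \<open>Conjugates of roots of unity\<close>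

definition ev :: "rat poly \<Rightarrow> complex \<Rightarrow> complex" where
  "ev f x = poly (map_poly of_rat f) x"

lemma map_poly_of_rat_add: "map_poly of_rat (f + g) = (map_poly of_rat f + map_poly of_rat g :: complex poly)"
  by (rule poly_eqI) (simp add: coeff_map_poly of_rat_add)

lemma map_poly_of_rat_mult: "map_poly of_rat (f * g) = (map_poly of_rat f * map_poly of_rat g :: complex poly)"
  by (rule poly_eqI) (simp add: coeff_map_poly coeff_mult of_rat_sum of_rat_mult)

lemma ev_add: "ev (f + g) x = ev f x + ev g x"
  by (simp add: ev_def map_poly_of_rat_add)

lemma ev_mult: "ev (f * g) x = ev f x * ev g x"
  by (simp add: ev_def map_poly_of_rat_mult)

lemma ev_0 [simp]: "ev 0 x = 0"
  by (simp add: ev_def)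

lemma ev_pCons [simp]: "ev (pCons a f) x = of_rat a + x * ev f x"
  by (cases "pCons a f = 0") (auto simp: ev_def map_poly_pCons)

lemma ev_minus: "ev (- f) x = - ev f x"
  using ev_add[of f "- f" x] by (simp add: eq_neg_iff_add_eq_0 add.commute)

lemma ev_diff: "ev (f - g) x = ev f x - ev g x"
  using ev_add[of f "- g" x] by (simp add: ev_minus)

lemma ev_sum: "ev (\<Sum>i\<in>A. f i) x = (\<Sum>i\<in>A. ev (f i) x)"
  by (induction A rule: infinite_finite_induct) (auto simp: ev_add)

lemma ev_monom: "ev (monom c k) x = of_rat c * x ^ k"
  by (simp add: ev_def map_poly_monom poly_monom)

lemma ev_altdef: "ev f x = (\<Sum>i\<le>degree f. of_rat (coeff f i) * x ^ i)"
  by (simp add: ev_def poly_altdef coeff_map_poly degree_map_poly)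

lemma ev_pcompose: "ev (pcompose f g) x = ev f (ev g x)"
  by (induction f) (simp_all add: pcompose_pCons ev_add ev_mult)

lemma minimal_poly_exists:
  assumes "ev g x = 0" "g \<noteq> 0"
  obtains \<mu> :: "rat poly" where "lead_coeff \<mu> = 1" "ev \<mu> x = 0" "\<And>f. ev f x = 0 \<Longrightarrow> \<mu> dvd f"
proof -
  define d where "d = (LEAST d. \<exists>f. f \<noteq> 0 \<and> ev f x = 0 \<and> degree f = d)"
  have "\<exists>f. f \<noteq> 0 \<and> ev f x = 0 \<and> degree f = d"
    unfolding d_def by (rule LeastI_ex) (use assms in blast)
  then obtain f where f: "f \<noteq> 0" "ev f x = 0" "degree f = d" by blast
  have least: "d \<le> degree h" if "h \<noteq> 0" "ev h x = 0" for h
    unfolding d_def by (rule Least_le) (use that in blast)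
  define \<mu> where "\<mu> = smult (inverse (lead_coeff f)) f"
  have "coeff f d \<noteq> 0" using f(1,3) by (metis leading_coeff_neq_0)
  then have \<mu>: "lead_coeff \<mu> = 1" "degree \<mu> = d" using f(1) by (simp_all add: \<mu>_def f(3))
  have "\<mu> = [:inverse (lead_coeff f):] * f" by (simp add: \<mu>_def)
  then have ev: "ev \<mu> x = 0" using f(2) by (simp only: ev_mult mult_zero_right)
  have "\<mu> dvd h" if "ev h x = 0" for h
  proof (rule ccontr)
    assume "\<not> \<mu> dvd h"
    then have 1: "h mod \<mu> \<noteq> 0" by (simp add: mod_eq_0_iff_dvd)
    have "ev (h mod \<mu>) x = 0"
      using that ev by (simp add: minus_div_mult_eq_mod[symmetric] ev_diff ev_mult)
    then have "d \<le> degree (h mod \<mu>)" using least 1 by blast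
    moreover have "degree (h mod \<mu>) < degree \<mu>"
      using degree_mod_less'[of \<mu> h] 1 \<mu>(1) by (cases "\<mu> = 0") auto
    ultimately show False using \<mu> by simp
  qed
  then show thesis using that \<mu>(1) ev by blast
qed

lemma algebraic_int_coeff_mult:
  assumes "\<And>i. algebraic_int (coeff f i)" "\<And>i. algebraic_int (coeff g i)"
  shows "algebraic_int (coeff (f * g :: complex poly) i)"
  using assms by (simp add: coeff_mult algebraic_int_sum algebraic_int_mult)

lemma algebraic_int_coeff_prod_mset:
  assumes "\<And>r. r \<in># R \<Longrightarrow> algebraic_int (r :: complex)"
  shows "algebraic_int (coeff (\<Prod>r\<in>#R. [:- r, 1:]) i)"
  using assms
proof (induction R arbitrary: i)
  case empty
  then show ?case by (simp add: coeff_1 algebraic_int_closed)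
next
  case (add r R)
  have "algebraic_int (coeff [:- r, 1:] j)" for j
    using add.prems by (auto simp: coeff_pCons split: nat.splits intro: algebraic_int_intros)
  then have "algebraic_int (coeff ([:- r, 1:] * (\<Prod>r\<in>#R. [:- r, 1:])) i)"
    using add by (intro algebraic_int_coeff_mult) auto
  then show ?case by simp
qed

text \<open>Coefficients are sums of products of roots. This serves in place of Gauss's lemma: a
  monic rational factor of a monic integer polynomial gets integral coefficients.\<close>

lemma algebraic_int_coeff_if_roots:
  fixes f :: "complex poly"
  assumes "lead_coeff f = 1" "\<And>x. poly f x = 0 \<Longrightarrow> algebraic_int x"
  shows "algebraic_int (coeff f i)"
proof -
  have "f \<noteq> 0" using assms(1) by auto
  then have "algebraic_int (coeff (\<Prod>r\<in>#proots f. [:- r, 1:]) i)"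
    using assms(2) by (intro algebraic_int_coeff_prod_mset) auto
  also have "(\<Prod>r\<in>#proots f. [:- r, 1:]) = f"
    using complex_poly_decompose_multiset[of f] assms(1) by simp
  finally show ?thesis .
qed

lemma algebraic_int_poly:
  fixes f :: "complex poly"
  assumes "\<And>i. algebraic_int (coeff f i)" "algebraic_int x"
  shows "algebraic_int (poly f x)"
  using assms by (simp add: poly_altdef algebraic_int_sum algebraic_int_mult algebraic_int_closed)

lemma root_of_unity_algebraic_int:
  fixes x :: complex
  assumes "x ^ m = 1" "m > 0" shows "algebraic_int x"
  by (rule algebraic_int_power_root[of _ m]) (use assms algebraic_int_closed in auto)

lemma algebraic_int_rat_Ints: "algebraic_int (of_rat c :: complex) \<Longrightarrow> \<exists>k. c = of_int k"
proof -
  assume "algebraic_int (of_rat c :: complex)"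
  then have "(of_rat c :: complex) \<in> \<int>" by (rule rational_algebraic_int_is_int) simp
  then obtain k where "(of_rat c :: complex) = of_int k" by (auto elim: Ints_cases)
  then have "c = of_int k" by (metis of_rat_eq_iff of_rat_of_int_eq)
  then show ?thesis by blast
qed

text \<open>If \<open>\<omega>\<^sup>q\<close> were not a root of the minimal polynomial \<open>\<mu>\<close> of \<open>\<omega>\<close>, then the
  nonzero number \<open>\<mu>(\<omega>\<^sup>q)\<close> would divide \<open>m\<close>, while it is congruent to \<open>\<mu>(\<omega>)\<^sup>q = 0\<close> modulo \<open>q\<close>.\<close>

lemma root_of_unity_conjugate_prime:
  assumes \<omega>: "\<omega> ^ m = 1" and m: "m > 0" and q: "prime q" "\<not> q dvd m" and f: "ev f \<omega> = 0"
  shows "ev f (\<omega> ^ q) = 0"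
proof -
  let ?F = "monom 1 m - 1 :: rat poly"
  have evF: "ev ?F x = x ^ m - 1" for x by (simp add: ev_diff ev_monom one_pCons)
  have F0: "?F \<noteq> 0"
  proof
    assume "?F = 0"
    then have "coeff ?F m = 0" by simp
    then show False using m by simp
  qed
  obtain \<mu> where \<mu>: "lead_coeff \<mu> = 1" "ev \<mu> \<omega> = 0" "\<And>f. ev f \<omega> = 0 \<Longrightarrow> \<mu> dvd f"
    using minimal_poly_exists[of ?F \<omega>] evF \<omega> F0 by auto
  have "\<mu> dvd ?F" using \<mu>(3) evF \<omega> by simp
  then obtain h where h: "?F = \<mu> * h" by blast
  have lcF: "lead_coeff ?F = 1"
  proof -
    have "degree ?F = m" using m
      by (intro antisym degree_le le_degree) auto
    then show ?thesis using m by simp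
  qed
  have lch: "lead_coeff h = 1" using lcF \<mu>(1) by (simp add: h lead_coeff_mult)
  let ?M = "map_poly of_rat \<mu> :: complex poly" and ?H = "map_poly of_rat h :: complex poly"
  have root: "algebraic_int x" if "ev \<mu> x = 0 \<or> ev h x = 0" for x
  proof -
    have "ev ?F x = 0" using that unfolding h by (auto simp: ev_mult)
    then show ?thesis using evF m by (intro root_of_unity_algebraic_int[of x m]) auto
  qed
  have Mi: "algebraic_int (coeff ?M i)" for i
    using \<mu>(1) root by (intro algebraic_int_coeff_if_roots) (auto simp: ev_def degree_map_poly coeff_map_poly)
  have Hi: "algebraic_int (coeff ?H i)" for i
    using lch root by (intro algebraic_int_coeff_if_roots) (auto simp: ev_def degree_map_poly coeff_map_poly)
  define y where "y = \<omega> ^ q"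
  have \<omega>i: "algebraic_int \<omega>" using \<omega> m root_of_unity_algebraic_int by blast
  have yi: "algebraic_int y" using \<omega>i by (simp add: y_def algebraic_int_closed)
  have ym: "y ^ m = 1" using \<omega> by (simp add: y_def power_mult[symmetric] mult.commute[of q] power_mult)
  have "ev \<mu> y = 0"
  proof (rule ccontr)
    assume M0: "ev \<mu> y \<noteq> 0"
    have MH: "?M * ?H = monom 1 m - 1"
      unfolding map_poly_of_rat_mult[symmetric] h[symmetric]
      by (rule poly_eqI) (auto simp: coeff_map_poly of_rat_diff)
    have "ev \<mu> y * ev h y = 0" using evF[of y] ym unfolding h by (simp add: ev_mult)
    then have H0: "poly ?H y = 0" using M0 by (simp add: ev_def)
    \<comment> \<open>Differentiating \<open>x ^ m - 1\<close>, the product of \<mu> and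
      \<open>h\<close>, at the root \<open>y\<close> of \<open>h\<close> shows that the value of
      \<mu> at \<open>y\<close> divides \<open>m * y ^ (m - 1)\<close>, and \<open>y\<close> is a
      unit.\<close>
    have "poly (pderiv (?M * ?H)) y = poly ?M y * poly (pderiv ?H) y"
      using H0 by (simp add: pderiv_mult)
    also have "pderiv (?M * ?H) = monom (of_nat m) (m - 1)"
      unfolding MH by (simp add: pderiv_diff pderiv_monom)
    finally have "of_nat m * y ^ (m - 1) = ev \<mu> y * poly (pderiv ?H) y"
      by (simp add: poly_monom ev_def)
    moreover have "algebraic_int (poly (pderiv ?H) y)"
    proof (rule algebraic_int_poly[OF _ yi])
      show "algebraic_int (coeff (pderiv ?H) i)" for i
        unfolding coeff_pderiv by (intro algebraic_int_intros Hi)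
    qed
    ultimately have "ev \<mu> y zdvd of_nat m * y ^ (m - 1)" by (auto simp: zdvd_def)
    then have "ev \<mu> y zdvd (of_nat m * y ^ (m - 1)) * y"
      using yi by (rule zdvd_mult)
    moreover have "y ^ (m - 1) * y = 1" using ym m by (metis power_minus_mult)
    ultimately have 1: "ev \<mu> y zdvd of_nat m" by (simp add: mult.assoc)
    have "\<forall>i. \<exists>k. coeff \<mu> i = of_int k"
      using Mi algebraic_int_rat_Ints by (simp add: coeff_map_poly)
    then obtain c where c: "\<And>i. coeff \<mu> i = of_int (c i)" by metis
    have ev\<mu>: "ev \<mu> x = (\<Sum>i\<le>degree \<mu>. of_int (c i) * x ^ i)" for x
      by (simp add: ev_altdef c)
    have "of_nat q zdvd (\<Sum>i\<le>degree \<mu>. of_int (c i) * \<omega> ^ i) ^ q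
        - (\<Sum>i\<le>degree \<mu>. (of_int (c i) * \<omega> ^ i) ^ q)"
      by (intro zdvd_frobenius_sum q algebraic_int_intros \<omega>i)
    then have "of_nat q zdvd ev \<mu> \<omega> ^ q - (\<Sum>i\<le>degree \<mu>. (of_int (c i) * \<omega> ^ i) ^ q)"
      by (simp only: ev\<mu>)
    then have 2: "of_nat q zdvd 0 - (\<Sum>i\<le>degree \<mu>. (of_int (c i) * \<omega> ^ i) ^ q)"
      using \<mu>(2) prime_gt_0_nat[OF q(1)] by (simp add: zero_power)
    have "of_nat q zdvd (\<Sum>i\<le>degree \<mu>. (of_int (c i) ^ q - of_int (c i)) * y ^ i)"
      by (intro zdvd_sum zdvd_mult zdvd_fermat q algebraic_int_intros yi)
    also have "\<dots> = (\<Sum>i\<le>degree \<mu>. (of_int (c i) * \<omega> ^ i) ^ q) - ev \<mu> y"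
      unfolding ev\<mu> sum_subtractf[symmetric]
      by (intro sum.cong refl)
        (simp add: y_def algebra_simps power_mult_distrib power_mult[symmetric])
    finally have "of_nat q zdvd 0 - ev \<mu> y" using zdvd_diff_trans[OF 2] by blast
    then have "of_nat q zdvd ev \<mu> y" using zdvd_minus by force
    then have "of_nat q zdvd of_nat m" using 1 zdvd_trans by blast
    then show False using q by (simp add: of_nat_zdvd_iff)
  qed
  then show ?thesis using \<mu>(3)[OF f] by (auto simp: y_def ev_mult elim!: dvdE)
qed

text \<open>Splits off one prime factor of \<open>a\<close> at a time. The prime case holds for
  every root of unity, so it can be applied to \<open>\<omega> ^ b\<close> for the remaining
  cofactor \<open>b\<close>.\<close>

lemma root_of_unity_conjugate:
  assumes "\<omega> ^ m = 1" "m > 0" "coprime a m" "ev f \<omega> = 0"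
  shows "ev f (\<omega> ^ a) = 0"
  using assms(3)
proof (induction a rule: less_induct)
  case (less a)
  consider "a = 0" | "a = 1" | "a > 1" by linarith
  then show ?case
  proof cases
    case 1
    then have "m = 1" using less.prems by simp
    then show ?thesis using assms 1 by simp
  next
    case 2
    then show ?thesis using assms by simp
  next
    case 3
    then obtain q where q: "prime q" "q dvd a" by (metis less_irrefl prime_factor_nat)
    then obtain b where b: "a = q * b" by blast
    have "b < a" using 3 b prime_gt_1_nat[OF q(1)] by (cases "b = 0") auto
    moreover have "coprime b m" using less.prems b by simp
    ultimately have 1: "ev f (\<omega> ^ b) = 0" using less.IH by blast
    have "coprime q m" using less.prems b by simp
    then have "\<not> q dvd m" using q by (meson coprime_absorb_left not_prime_unit)
    moreover have "(\<omega> ^ b) ^ m = 1"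
      using assms(1) by (metis mult.commute power_mult power_one)
    ultimately have "ev f ((\<omega> ^ b) ^ q) = 0"
      using root_of_unity_conjugate_prime 1 q assms(2) by blast
    then show ?thesis by (simp add: b power_mult[symmetric] mult.commute)
  qed
qed

section \<open>Cyclotomic fields\<close>

definition zeta :: "nat \<Rightarrow> complex" where
  "zeta d = cis (2 * pi / real d)"

lemma zeta_power_self: "d > 0 \<Longrightarrow> zeta d ^ d = 1"
  by (simp add: zeta_def DeMoivre)

lemma zeta_nz [simp]: "zeta d \<noteq> 0"
  by (simp add: zeta_def)

lemma zeta_power_mod: "d > 0 \<Longrightarrow> zeta d ^ (k mod d) = zeta d ^ k"
  by (metis mod_mult_div_eq mult.right_neutral power_add power_mult power_one zeta_power_self)

lemma zeta_powers_bij: "d > 0 \<Longrightarrow> bij_betw (\<lambda>k. zeta d ^ k) {..<d} {z. z ^ d = 1}"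
  using bij_betw_roots_unity[of d] by (simp add: zeta_def DeMoivre mult_ac)

lemma zeta_power_eq_iff: "d > 0 \<Longrightarrow> zeta d ^ a = zeta d ^ b \<longleftrightarrow> [a = b] (mod d)"
proof -
  assume d: "d > 0"
  have "zeta d ^ a = zeta d ^ b \<longleftrightarrow> zeta d ^ (a mod d) = zeta d ^ (b mod d)"
    using d by (simp add: zeta_power_mod)
  also have "\<dots> \<longleftrightarrow> a mod d = b mod d"
    using zeta_powers_bij[OF d] d by (intro inj_on_eq_iff) (auto simp: bij_betw_def)
  finally show ?thesis by (simp add: cong_def)
qed

lemma zeta_power_eq_1_iff: "d > 0 \<Longrightarrow> zeta d ^ a = 1 \<longleftrightarrow> d dvd a"
  using zeta_power_eq_iff[of d a 0] by (simp add: cong_0_iff)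

lemma root_of_unity_eq_zeta_power:
  assumes "d > 0" "z ^ d = 1" shows "\<exists>k<d. z = zeta d ^ k"
  using assms zeta_powers_bij[of d] by (auto simp: bij_betw_def)

lemma zeta_dvd: "d > 0 \<Longrightarrow> e > 0 \<Longrightarrow> zeta (d * e) ^ e = zeta d"
  by (simp add: zeta_def DeMoivre)

lemma zeta_algebraic_int: "d > 0 \<Longrightarrow> algebraic_int (zeta d)"
  using root_of_unity_algebraic_int zeta_power_self by blast

lemma inverse_zeta: "d > 0 \<Longrightarrow> inverse (zeta d) = zeta d ^ (d - 1)"
  using zeta_power_self[of d] by (cases d) (auto intro!: inverse_unique)

lemma inverse_zeta_algebraic_int: "d > 0 \<Longrightarrow> algebraic_int (inverse (zeta d))"
  by (simp add: inverse_zeta algebraic_int_closed zeta_algebraic_int)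

text \<open>Orthogonality of characters: for each \<open>h\<close>, the powers of
  \<open>zeta d ^ e h / zeta d\<close> sum to \<open>d\<close> or to 0. It recovers a partial sum
  over a congruence class from sums twisted by roots of unity, which later are traces.\<close>

lemma fourier_extract:
  fixes e :: "'c \<Rightarrow> nat"
  assumes d: "d > 0" and A: "finite A"
  shows "(\<Sum>k<d. inverse (zeta d) ^ k * (\<Sum>h\<in>A. g h * zeta d ^ (e h * k)))
    = of_nat d * (\<Sum>h | h \<in> A \<and> [e h = 1] (mod d). g h :: complex)"
proof -
  have inner: "(\<Sum>k<d. (zeta d ^ h * inverse (zeta d)) ^ k) = (if [h = 1] (mod d) then of_nat d else 0)" for h :: nat
  proof -
    let ?w = "zeta d ^ h * inverse (zeta d)"
    have w: "?w = 1 \<longleftrightarrow> [h = 1] (mod d)"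
      using zeta_power_eq_iff[OF d, of h 1] by (auto simp: field_simps)
    have "?w ^ d = (zeta d ^ d) ^ h * inverse (zeta d ^ d)"
      by (simp add: power_mult_distrib power_inverse power_mult[symmetric] mult.commute)
    then have "?w ^ d = 1" using d by (simp add: zeta_power_self)
    then show ?thesis using w by (cases "?w = 1") (auto simp: geometric_sum)
  qed
  have "(\<Sum>k<d. inverse (zeta d) ^ k * (\<Sum>h\<in>A. g h * zeta d ^ (e h * k)))
    = (\<Sum>k<d. \<Sum>h\<in>A. g h * (zeta d ^ e h * inverse (zeta d)) ^ k)"
    by (simp add: sum_distrib_left power_mult_distrib power_mult[symmetric] mult_ac)
  also have "\<dots> = (\<Sum>h\<in>A. g h * (\<Sum>k<d. (zeta d ^ e h * inverse (zeta d)) ^ k))"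
    by (subst sum.swap) (simp add: sum_distrib_left)
  also have "\<dots> = (\<Sum>h\<in>A. if [e h = 1] (mod d) then of_nat d * g h else 0)"
    unfolding inner by (intro sum.cong) auto
  also have "\<dots> = of_nat d * (\<Sum>h | h \<in> A \<and> [e h = 1] (mod d). g h)"
    using A by (simp add: sum.inter_filter[symmetric] sum_distrib_left)
  finally show ?thesis .
qed

text \<open>Induction on \<open>j\<close>: Frobenius is additive modulo \<open>q\<close> and leaves
  the integer coefficients alone by Fermat's theorem.\<close>

lemma zdvd_frobenius_iterated:
  assumes "prime q" "\<And>i. i \<in> A \<Longrightarrow> algebraic_int (f i)"
  shows "of_nat q zdvd (\<Sum>i\<in>A. of_int (c i) * f i) ^ (q ^ j) - (\<Sum>i\<in>A. of_int (c i) * f i ^ (q ^ j))"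
proof (induction j)
  case (Suc j)
  let ?s = "\<Sum>i\<in>A. of_int (c i) * f i ^ (q ^ j)"
  have s: "algebraic_int ?s" "algebraic_int (\<Sum>i\<in>A. of_int (c i) * f i)"
    using assms(2) by (auto intro!: algebraic_int_intros)
  have "of_nat q zdvd ((\<Sum>i\<in>A. of_int (c i) * f i) ^ (q ^ j)) ^ q - ?s ^ q"
    using Suc s by (intro zdvd_power_diff algebraic_int_closed)
  moreover have "of_nat q zdvd ?s ^ q - (\<Sum>i\<in>A. (of_int (c i) * f i ^ (q ^ j)) ^ q)"
    using assms by (intro zdvd_frobenius_sum) (auto intro!: algebraic_int_intros)
  moreover have "of_nat q zdvd (\<Sum>i\<in>A. (of_int (c i) * f i ^ (q ^ j)) ^ q)
      - (\<Sum>i\<in>A. of_int (c i) * f i ^ (q ^ Suc j))"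
  proof -
    have "of_nat q zdvd (\<Sum>i\<in>A. (of_int (c i) ^ q - of_int (c i)) * f i ^ (q ^ Suc j))"
      using assms by (intro zdvd_sum zdvd_mult zdvd_fermat) (auto intro!: algebraic_int_intros)
    also have "\<dots> = (\<Sum>i\<in>A. (of_int (c i) * f i ^ (q ^ j)) ^ q)
      - (\<Sum>i\<in>A. of_int (c i) * f i ^ (q ^ Suc j))"
      unfolding sum_subtractf[symmetric]
      by (intro sum.cong refl)
        (simp add: algebra_simps power_mult_distrib power_mult[symmetric])
    finally show ?thesis .
  qed
  ultimately show ?case
    by (metis (no_types, lifting) zdvd_diff_trans power_Suc2 power_mult)
qed simp

section \<open>The Galois action on a cyclotomic field\<close>

locale cyclotomic =
  fixes m :: nat
  assumes m_pos: "m > 0"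
begin

definition L :: "complex set" where "L = range (\<lambda>f. ev f (zeta m))"

text \<open>Some polynomial representing \<open>x\<close> is evaluated at \<open>zeta m ^ a\<close>;
  by \<open>root_of_unity_conjugate\<close> the choice does not matter when \<open>a\<close> is
  coprime to \<open>m\<close>.\<close>

definition sig :: "nat \<Rightarrow> complex \<Rightarrow> complex" where
  "sig a x = ev (SOME f. ev f (zeta m) = x) (zeta m ^ a)"

text \<open>For \<open>m = 1\<close> the only member is 0. This is why the identity of the group
  appears as \<open>1 mod m\<close> below.\<close>

definition U :: "nat set" where "U = {a. a < m \<and> coprime a m}"

lemma finite_U [simp]: "finite U"
  by (simp add: U_def)

lemma U_coprime: "a \<in> U \<Longrightarrow> coprime a m"
  by (simp add: U_def)

lemma mod_in_U: "coprime a m \<Longrightarrow> a mod m \<in> U"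
  using m_pos by (simp add: U_def)

lemma sig_ev:
  assumes "coprime a m"
  shows "sig a (ev f (zeta m)) = ev f (zeta m ^ a)"
proof -
  have "ev (SOME g. ev g (zeta m) = ev f (zeta m)) (zeta m) = ev f (zeta m)"
    by (rule someI[of _ f]) simp
  then have "ev ((SOME g. ev g (zeta m) = ev f (zeta m)) - f) (zeta m) = 0"
    by (simp add: ev_diff)
  then have "ev ((SOME g. ev g (zeta m) = ev f (zeta m)) - f) (zeta m ^ a) = 0"
    using root_of_unity_conjugate[OF zeta_power_self[OF m_pos] m_pos assms] by blast
  then show ?thesis by (simp add: sig_def ev_diff)
qed

lemma L_E: assumes "x \<in> L" obtains f where "x = ev f (zeta m)"
  using assms by (auto simp: L_def)

lemma L_I: "x = ev f (zeta m) \<Longrightarrow> x \<in> L"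
  by (auto simp: L_def)

lemma L_add: "x \<in> L \<Longrightarrow> y \<in> L \<Longrightarrow> x + y \<in> L"
  by (metis L_E L_I ev_add)

lemma L_mult: "x \<in> L \<Longrightarrow> y \<in> L \<Longrightarrow> x * y \<in> L"
  by (metis L_E L_I ev_mult)

lemma L_diff: "x \<in> L \<Longrightarrow> y \<in> L \<Longrightarrow> x - y \<in> L"
  by (metis L_E L_I ev_diff)

lemma L_of_rat: "of_rat c \<in> L"
  by (rule L_I[of _ "[:c:]"]) simp

lemma L_of_int: "of_int c \<in> L"
  using L_of_rat[of "of_int c"] by simp

lemma L_of_nat: "of_nat c \<in> L"
  using L_of_int[of "int c"] by simp

lemma L_0: "0 \<in> L" and L_1: "1 \<in> L"
  using L_of_nat[of 0] L_of_nat[of 1] by simp_all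

lemma L_zeta: "zeta m \<in> L"
  by (rule L_I[of _ "[:0,1:]"]) simp

lemma L_power: "x \<in> L \<Longrightarrow> x ^ k \<in> L"
  by (induction k) (auto intro: L_mult L_1)

lemma L_sum: "(\<And>i. i \<in> A \<Longrightarrow> f i \<in> L) \<Longrightarrow> sum f A \<in> L"
  by (induction A rule: infinite_finite_induct) (auto intro: L_add L_0)

lemma L_prod: "(\<And>i. i \<in> A \<Longrightarrow> f i \<in> L) \<Longrightarrow> prod f A \<in> L"
  by (induction A rule: infinite_finite_induct) (auto intro: L_mult L_1)

lemma zeta_of_divisor: "d dvd m \<Longrightarrow> zeta d = zeta m ^ (m div d)"
  using zeta_dvd[of d "m div d"] m_pos by (auto elim!: dvdE)

lemma L_zeta_divisor: "d dvd m \<Longrightarrow> zeta d \<in> L"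
  by (simp add: zeta_of_divisor[of d] L_power L_zeta)

lemmas L_intros = L_add L_mult L_diff L_of_int L_of_nat L_0 L_1 L_zeta L_power L_sum L_prod
  L_zeta_divisor

context
  fixes a assumes a: "coprime a m"
begin

lemma sig_in_L: "x \<in> L \<Longrightarrow> sig a x \<in> L"
proof (elim L_E)
  fix f assume "x = ev f (zeta m)"
  then have "sig a x = ev (pcompose f (monom 1 a)) (zeta m)"
    using a by (simp add: sig_ev ev_pcompose ev_monom)
  then show ?thesis by (rule L_I)
qed

lemma sig_add: "x \<in> L \<Longrightarrow> y \<in> L \<Longrightarrow> sig a (x + y) = sig a x + sig a y"
  using a by (auto elim!: L_E simp: sig_ev ev_add[symmetric])

lemma sig_mult: "x \<in> L \<Longrightarrow> y \<in> L \<Longrightarrow> sig a (x * y) = sig a x * sig a y"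
  using a by (auto elim!: L_E simp: sig_ev ev_mult[symmetric])

lemma sig_diff: "x \<in> L \<Longrightarrow> y \<in> L \<Longrightarrow> sig a (x - y) = sig a x - sig a y"
  using a by (auto elim!: L_E simp: sig_ev ev_diff[symmetric])

lemma sig_of_rat: "sig a (of_rat c) = of_rat c"
  using sig_ev[OF a, of "[:c:]"] by simp

lemma sig_of_int: "sig a (of_int c) = of_int c"
  using sig_of_rat[of "of_int c"] by simp

lemma sig_of_nat: "sig a (of_nat c) = of_nat c"
  using sig_of_int[of "int c"] by simp

lemma sig_0: "sig a 0 = 0" and sig_1: "sig a 1 = 1"
  using sig_of_nat[of 0] sig_of_nat[of 1] by simp_all

lemma sig_power: "x \<in> L \<Longrightarrow> sig a (x ^ k) = sig a x ^ k"
  by (induction k) (auto simp: sig_1 sig_mult L_power)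

lemma sig_zeta: "sig a (zeta m) = zeta m ^ a"
  using sig_ev[OF a, of "[:0,1:]"] by simp

lemma sig_zeta_divisor: "d dvd m \<Longrightarrow> sig a (zeta d) = zeta d ^ a"
  by (simp add: zeta_of_divisor[of d] sig_power L_zeta sig_zeta power_mult[symmetric] mult.commute)

lemma sig_sum: "(\<And>i. i \<in> A \<Longrightarrow> f i \<in> L) \<Longrightarrow> sig a (sum f A) = (\<Sum>i\<in>A. sig a (f i))"
  by (induction A rule: infinite_finite_induct) (auto simp: sig_0 sig_add L_sum)

lemma sig_prod: "(\<And>i. i \<in> A \<Longrightarrow> f i \<in> L) \<Longrightarrow> sig a (prod f A) = (\<Prod>i\<in>A. sig a (f i))"
  by (induction A rule: infinite_finite_induct) (auto simp: sig_1 sig_mult L_prod)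

lemma sig_algebraic_int:
  assumes "x \<in> L" "algebraic_int x"
  shows "algebraic_int (sig a x)"
proof -
  obtain n c where n: "x ^ n + (\<Sum>i<n. of_int (c i) * x ^ i) = 0" "n > 0"
    using assms(2) unfolding algebraic_integer_iff[symmetric] algebraic_integer_def by blast
  have "sig a (x ^ n + (\<Sum>i<n. of_int (c i) * x ^ i)) = sig a x ^ n + (\<Sum>i<n. of_int (c i) * sig a x ^ i)"
    using assms(1) by (simp add: sig_add sig_sum sig_mult sig_power sig_of_int L_intros)
  then have "sig a x ^ n + (\<Sum>i<n. of_int (c i) * sig a x ^ i) = 0" using n(1) sig_0 by simp
  then show ?thesis using n(2) unfolding algebraic_integer_iff[symmetric] algebraic_integer_def by blast
qed

end

lemma sig_sig:
  assumes "coprime a m" "coprime b m" "x \<in> L"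
  shows "sig a (sig b x) = sig (a * b) x"
  using assms(3)
proof (elim L_E)
  fix f assume f: "x = ev f (zeta m)"
  have "sig b x = ev (pcompose f (monom 1 b)) (zeta m)"
    using assms f by (simp add: sig_ev ev_pcompose ev_monom)
  then have "sig a (sig b x) = ev (pcompose f (monom 1 b)) (zeta m ^ a)"
    using assms by (simp add: sig_ev)
  then show ?thesis
    using assms f by (simp add: sig_ev ev_pcompose ev_monom power_mult[symmetric])
qed

lemma sig_cong:
  assumes "[a = b] (mod m)"
  shows "sig a x = sig b x"
proof -
  have "zeta m ^ a = zeta m ^ b" using assms m_pos by (simp add: zeta_power_eq_iff)
  then show ?thesis by (simp add: sig_def)
qed

lemma sig_mod: "sig (a mod m) x = sig a x"
  by (rule sig_cong) (simp add: cong_def)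

lemma sig_1_eq:
  assumes "x \<in> L" shows "sig 1 x = x"
  using assms by (auto elim!: L_E simp: sig_ev simp del: One_nat_def)

lemma inverse_mod:
  assumes "coprime a m"
  obtains b where "coprime b m" "[a * b = 1] (mod m)"
proof -
  obtain b where b: "[a * b = 1] (mod m)" using cong_solve_coprime_nat assms by auto
  then have "coprime b m"
    using coprime_iff_invertible_nat by (metis One_nat_def mult.commute)
  with b show thesis using that by blast
qed

lemma sig_eq_0_iff:
  assumes "coprime a m" "x \<in> L"
  shows "sig a x = 0 \<longleftrightarrow> x = 0"
proof
  assume 0: "sig a x = 0"
  obtain b where b: "coprime b m" "[a * b = 1] (mod m)" using inverse_mod[OF assms(1)] by blast
  then have "sig b (sig a x) = sig 1 x"
    using sig_sig[of b a x] assms sig_cong[OF b(2)] by (simp add: mult.commute)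
  then show "x = 0" using 0 sig_0[OF b(1)] sig_1_eq assms by simp
qed (use assms sig_0 in simp)

lemma bij_betw_mult_mod:
  assumes b: "coprime b m" and S: "S \<subseteq> U"
    and inv: "\<And>a. a \<in> U \<Longrightarrow> a \<in> S \<longleftrightarrow> b * a mod m \<in> S"
  shows "bij_betw (\<lambda>a. b * a mod m) S S"
proof -
  have "inj_on (\<lambda>a. b * a mod m) S"
  proof (rule inj_onI)
    fix x y assume xy: "x \<in> S" "y \<in> S" "b * x mod m = b * y mod m"
    then have "[b * x = b * y] (mod m)" by (simp add: cong_def)
    then have "[x = y] (mod m)" using b by (simp add: cong_mult_lcancel_nat)
    moreover have "x < m" "y < m" using xy S by (auto simp: U_def)
    ultimately show "x = y" by (simp add: cong_def)
  qed
  moreover have "(\<lambda>a. b * a mod m) ` S \<subseteq> S" using inv S by auto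
  moreover have "finite S" using S finite_subset finite_U by blast
  ultimately show ?thesis by (simp add: bij_betw_def endo_inj_surj)
qed

lemma bij_betw_mult_mod_U: "coprime b m \<Longrightarrow> bij_betw (\<lambda>a. b * a mod m) U U"
  by (rule bij_betw_mult_mod) (auto intro!: mod_in_U simp: U_coprime)

text \<open>Multiplication by \<open>b\<close> permutes the summands. With \<open>S\<close> a
  subgroup, this puts the trace over \<open>S\<close> into its fixed field.\<close>

lemma sig_invariant_sum:
  assumes b: "coprime b m" and x: "x \<in> L" and S: "S \<subseteq> U"
    and inv: "\<And>a. a \<in> U \<Longrightarrow> a \<in> S \<longleftrightarrow> b * a mod m \<in> S"
  shows "sig b (\<Sum>a\<in>S. sig a x) = (\<Sum>a\<in>S. sig a x)"
proof -
  have cop: "coprime a m" if "a \<in> S" for a using that S U_coprime by blast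
  have "sig b (\<Sum>a\<in>S. sig a x) = (\<Sum>a\<in>S. sig (b * a mod m) x)"
    using b x cop by (simp add: sig_sum sig_in_L sig_sig sig_mod)
  also have "\<dots> = (\<Sum>a\<in>S. sig a x)"
    by (rule sum.reindex_bij_betw[OF bij_betw_mult_mod[OF b S inv]])
  finally show ?thesis .
qed

text \<open>The roots of the minimal polynomial of \<open>\<zeta>\<close> are the conjugates \<open>\<zeta>\<^sup>a\<close>, and there are as many
  of them as its degree; so a polynomial of smaller degree that is constant on them is constant.\<close>

lemma fixed_imp_rational:
  assumes y: "y \<in> L" and fixed: "\<And>a. a \<in> U \<Longrightarrow> sig a y = y"
  shows "y \<in> \<rat>"
proof -
  let ?z = "zeta m"
  let ?F = "\<lambda>k. monom 1 k - 1 :: rat poly"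
  have evF: "ev (?F k) x = x ^ k - 1" for x k by (simp add: ev_diff ev_monom one_pCons)
  have F0: "?F k \<noteq> 0" if "k > 0" for k
  proof
    assume "?F k = 0"
    then have "coeff (?F k) k = 0" by simp
    then show False using that by simp
  qed
  have degF: "degree (?F m) \<le> m" by (intro degree_le) auto
  obtain \<mu> where \<mu>: "lead_coeff \<mu> = 1" "ev \<mu> ?z = 0" "\<And>f. ev f ?z = 0 \<Longrightarrow> \<mu> dvd f"
    using minimal_poly_exists[of "?F m" ?z] evF F0 m_pos zeta_power_self by auto
  have "\<mu> dvd ?F m" using \<mu>(3) evF m_pos zeta_power_self by simp
  then obtain h where h: "?F m = \<mu> * h" by blast
  have h0: "h \<noteq> 0" "\<mu> \<noteq> 0" using h F0[OF m_pos] by auto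
  define S where "S = {x. ev \<mu> x = 0}"
  have crd: "card {x. ev f x = 0} \<le> degree f" if "f \<noteq> 0" for f
  proof -
    have "map_poly of_rat f \<noteq> (0 :: complex poly)" using that
      by (metis coeff_map_poly leading_coeff_0_iff coeff_0 of_rat_0 of_rat_eq_0_iff)
    then show ?thesis
      using poly_roots_finite[of "map_poly of_rat f :: complex poly"]
        card_poly_roots_bound[of "map_poly of_rat f :: complex poly"]
      by (auto simp: ev_def degree_map_poly)
  qed
  have "x ^ m = 1 \<longleftrightarrow> ev \<mu> x = 0 \<or> ev h x = 0" for x
  proof -
    have "x ^ m - 1 = ev \<mu> x * ev h x" using evF[of m x] unfolding h ev_mult by simp
    then show ?thesis by (metis eq_iff_diff_eq_0 mult_eq_0_iff)
  qed
  \<comment> \<open>All \<open>m\<close> roots of unity are roots of \<mu> or of \<open>h\<close>,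
    and \<open>h\<close> has at most \<open>degree h\<close> roots, so at least
    \<open>degree \<mu>\<close> of them belong to \<mu>.\<close>
  then have "{x. x ^ m = (1::complex)} = S \<union> {x. ev h x = 0}"
    by (simp only: S_def Collect_disj_eq)
  then have "m \<le> card S + card {x. ev h x = 0}"
    using card_roots_unity_eq[OF m_pos] card_Un_le by metis
  moreover have "degree \<mu> + degree h \<le> m"
    using degF h0 unfolding h by (simp add: degree_mult_eq)
  ultimately have cardS: "degree \<mu> \<le> card S" using crd[OF h0(1)] by linarith
  have conj: "\<exists>a\<in>U. x = ?z ^ a" if "x \<in> S" for x
  proof -
    have "ev (?F m) x = 0" using that unfolding h S_def by (simp add: ev_mult)
    then have "x ^ m = 1" by (simp add: evF)
    then obtain k where k: "k < m" "x = ?z ^ k"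
      using root_of_unity_eq_zeta_power m_pos by blast
    define g where "g = gcd k m"
    have g: "g dvd m" "g dvd k" "g > 0" using m_pos by (auto simp: g_def)
    then have mg: "m div g > 0" using m_pos by (auto elim!: dvdE)
    have "m dvd k * (m div g)" using g by (auto elim!: dvdE)
    then have "x ^ (m div g) = 1"
      using m_pos by (simp add: k(2) power_mult[symmetric] zeta_power_eq_1_iff)
    then have Fx: "ev (?F (m div g)) x = 0" by (simp add: evF)
    then obtain \<nu> where \<nu>: "lead_coeff \<nu> = 1" "ev \<nu> x = 0" "\<And>f. ev f x = 0 \<Longrightarrow> \<nu> dvd f"
      using minimal_poly_exists[of "?F (m div g)" x] F0[OF mg] by blast
    have "\<nu> dvd \<mu>" using \<nu>(3) that by (simp add: S_def)
    then obtain w where w: "\<mu> = \<nu> * w" by (rule dvdE)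
    \<comment> \<open>As \<mu> is minimal for \<zeta>, its nonconstant factor \<nu> must vanish at
      \<zeta> as well. Then so does the multiple \<open>x ^ (m div g) - 1\<close> of \<nu>, which
      forces \<open>g = 1\<close>.\<close>
    have "ev \<nu> ?z = 0"
    proof (rule ccontr)
      assume "ev \<nu> ?z \<noteq> 0"
      then have "ev w ?z = 0" using \<mu>(2) w by (simp add: ev_mult)
      then have "\<mu> dvd w" using \<mu>(3) by blast
      then have "degree \<mu> \<le> degree w" using w h0 by (intro dvd_imp_degree_le) auto
      moreover have "degree \<mu> = degree \<nu> + degree w"
        using w h0 by (simp add: degree_mult_eq)
      ultimately have "degree \<nu> = 0" by simp
      then obtain c where "\<nu> = [:c:]" by (auto elim: degree_eq_zeroE)
      then show False using \<nu>(1,2) by simp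
    qed
    moreover have "\<nu> dvd ?F (m div g)" using \<nu>(3) Fx by blast
    ultimately have "ev (?F (m div g)) ?z = 0" by (auto elim!: dvdE simp: ev_mult)
    then have "m dvd m div g" using m_pos by (simp add: evF zeta_power_eq_1_iff)
    then have "m \<le> m div g" using mg by (rule dvd_imp_le)
    then have "\<not> g > 1" using m_pos div_less_dividend[of g m] by linarith
    then have "gcd k m = 1" using g(3) unfolding g_def by linarith
    then have "coprime k m" by (simp only: coprime_iff_gcd_eq_1)
    then show ?thesis using k by (auto simp: U_def)
  qed
  obtain f where f: "y = ev f ?z" using y by (rule L_E)
  define r where "r = f mod \<mu>"
  have rf: "ev r x = ev f x" if "x \<in> S" for x
    using that by (simp add: r_def S_def minus_div_mult_eq_mod[symmetric] ev_diff ev_mult)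
  have rS: "ev r x = y" if xS: "x \<in> S" for x
  proof -
    obtain a where a: "a \<in> U" "x = ?z ^ a" using conj xS by blast
    have "ev r x = sig a y" using rf[OF xS] a f sig_ev[OF U_coprime[OF a(1)]] by simp
    then show ?thesis using fixed a by simp
  qed
  have "degree r = 0"
  proof (rule ccontr)
    assume r0: "degree r \<noteq> 0"
    then have lt: "degree r < degree \<mu>"
      using degree_mod_less'[of \<mu> f] h0(2) by (cases "r = 0") (auto simp: r_def)
    let ?R = "map_poly of_rat r - [:y:]"
    have "coeff [:y:] (degree r) = 0" using r0 by (cases "degree r") auto
    then have "coeff ?R (degree r) \<noteq> 0" using r0 by (auto simp: coeff_map_poly)
    then have R0: "?R \<noteq> 0" by (metis coeff_0)
    have "degree ?R \<le> degree r"
      by (rule degree_diff_le) (auto simp: degree_map_poly)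
    moreover have "S \<subseteq> {x. poly ?R x = 0}" using rS by (auto simp: ev_def)
    then have "card S \<le> degree ?R"
      using poly_roots_finite[OF R0] card_poly_roots_bound[OF R0] card_mono le_trans by blast
    ultimately show False using lt cardS by linarith
  qed
  then obtain c where "r = [:c:]" by (auto elim: degree_eq_zeroE)
  moreover have "?z \<in> S" using \<mu>(2) by (simp add: S_def)
  ultimately show ?thesis using rS[of ?z] by auto
qed

lemma fixed_imp_int:
  assumes "y \<in> L" "algebraic_int y" "\<And>a. a \<in> U \<Longrightarrow> sig a y = y"
  obtains k where "y = of_int k"
  using rational_algebraic_int_is_int[OF assms(2) fixed_imp_rational[OF assms(1,3)]]
  by (auto elim: Ints_cases)

text \<open>With \<open>n\<close> the number of \<open>a\<close> congruent to 1 modulo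
  \<open>d\<close>, Fourier inversion of traces writes \<open>d * n * x\<close> as an integer
  combination of powers of \<open>inverse (zeta d)\<close>, and these are fixed by the
  \<open>q ^ f\<close>-th power. As \<open>d * n\<close> is prime to \<open>q\<close>, it can be
  cancelled afterwards.\<close>

lemma frobenius_power_fixed:
  assumes x: "x \<in> L" "algebraic_int x" and d: "d dvd m" and q: "prime q" "\<not> q dvd d"
    and fixed: "\<And>a. a \<in> U \<Longrightarrow> [a = 1] (mod d) \<Longrightarrow> sig a x = x"
    and card: "\<not> q dvd card {a \<in> U. [a = 1] (mod d)}"
    and f: "[q ^ f = 1] (mod d)"
  shows "of_nat q zdvd x ^ (q ^ f) - x"
proof -
  have d0: "d > 0" using d m_pos by (auto intro: Nat.gr0I)
  define n where "n = card {a \<in> U. [a = 1] (mod d)}"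
  let ?z = "inverse (zeta d)"
  have zi: "algebraic_int ?z" and z1: "algebraic_int (zeta d)" "zeta d \<in> L"
    using d0 d by (auto simp: inverse_zeta intro!: algebraic_int_closed zeta_algebraic_int L_intros)
  define T where "T k = (\<Sum>a\<in>U. sig a (x * zeta d ^ k))" for k
  have "\<exists>c. T k = of_int c" for k
  proof -
    have xk: "x * zeta d ^ k \<in> L" "algebraic_int (x * zeta d ^ k)"
      using x z1 by (auto intro!: L_intros algebraic_int_intros)
    show ?thesis
    proof (rule fixed_imp_int)
      show "T k \<in> L" unfolding T_def using xk by (intro L_sum sig_in_L U_coprime)
      show "algebraic_int (T k)" unfolding T_def
        using xk by (intro algebraic_int_sum sig_algebraic_int U_coprime)
      show "sig b (T k) = T k" if "b \<in> U" for b
        unfolding T_def using that xk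
        by (intro sig_invariant_sum) (auto intro: mod_in_U simp: U_coprime)
    qed blast
  qed
  then obtain c where c: "\<And>k. T k = of_int (c k)" by metis
  have "(\<Sum>k<d. ?z ^ k * (\<Sum>a\<in>U. sig a x * zeta d ^ (a * k)))
      = of_nat d * (\<Sum>a | a \<in> U \<and> [a = 1] (mod d). sig a x)"
    by (rule fourier_extract[OF d0 finite_U])
  moreover have "T k = (\<Sum>a\<in>U. sig a x * zeta d ^ (a * k))" for k
    unfolding T_def using x z1 d
    by (intro sum.cong refl)
      (simp add: U_coprime sig_mult sig_power L_intros sig_zeta_divisor power_mult)
  moreover have "(\<Sum>a | a \<in> U \<and> [a = 1] (mod d). sig a x) = of_nat n * x"
    using fixed by (simp add: n_def)
  ultimately have dnx: "of_nat (d * n) * x = (\<Sum>k<d. of_int (c k) * ?z ^ k)"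
    by (simp add: c mult_ac)
  let ?Q = "q ^ f"
  have zQ: "?z ^ ?Q = ?z"
    using zeta_power_eq_iff[OF d0, of ?Q 1] f by (simp add: power_inverse)
  have 1: "of_nat q zdvd (of_nat (d * n) * x) ^ ?Q - of_nat (d * n) * x"
  proof -
    have "of_nat q zdvd (\<Sum>k<d. of_int (c k) * ?z ^ k) ^ ?Q - (\<Sum>k<d. of_int (c k) * (?z ^ k) ^ ?Q)"
      by (intro zdvd_frobenius_iterated q algebraic_int_closed zi)
    also have "(\<Sum>k<d. of_int (c k) * (?z ^ k) ^ ?Q) = (\<Sum>k<d. of_int (c k) * ?z ^ k)"
      by (metis (no_types, lifting) mult.commute power_mult zQ)
    finally show ?thesis by (simp only: dnx)
  qed
  have 2: "of_nat q zdvd of_nat (d * n) ^ ?Q - (of_nat (d * n) :: complex)"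
    using zdvd_frobenius_iterated[OF q(1), of "{0::nat}" "\<lambda>_. 1" "\<lambda>_. int (d * n)" f]
    by (simp add: algebraic_int_closed)
  have 3: "of_nat q zdvd of_nat (d * n) * (x ^ ?Q - x)"
  proof -
    have "of_nat q zdvd (of_nat (d * n) ^ ?Q - of_nat (d * n)) * x ^ ?Q"
      using 2 x by (intro zdvd_mult algebraic_int_closed)
    from zdvd_diff[OF 1 this] show ?thesis
      by (simp add: algebra_simps power_mult_distrib)
  qed
  have "coprime (d * n) q"
  proof -
    have "coprime q d" "coprime q n" using q card by (simp_all add: n_def prime_imp_coprime)
    then show ?thesis by (simp add: coprime_commute)
  qed
  from this 3 show ?thesis by (rule zdvd_cancel_of_nat) (intro algebraic_int_closed x)
qed

end

section \<open>Integers of a cyclotomic field at a ramified prime\<close>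

lemma power_minus_one_eq_prod:
  assumes d0: "d > 0"
  shows "monom 1 d - 1 = (\<Prod>j<d. [:- (zeta d ^ j), 1:])" (is "_ = ?P")
proof (rule poly_eqI_degree_lead_coeff[where n = d and A = "(\<lambda>k. zeta d ^ k) ` {..<d}"])
  have "degree ?P = (\<Sum>j<d. degree [:- (zeta d ^ j), 1:])"
    by (rule degree_prod_sum_eq) auto
  then have degP: "degree ?P = d" by simp
  have "lead_coeff ?P = (\<Prod>j<d. lead_coeff [:- (zeta d ^ j), 1:])"
    by (rule lead_coeff_prod)
  then have "lead_coeff ?P = 1" by simp
  then show "coeff (monom 1 d - 1) d = coeff ?P d" using degP d0 by (simp add: coeff_1)
  show "degree ?P \<le> d" using degP by simp
  show "degree (monom 1 d - 1 :: complex poly) \<le> d" by (intro degree_le) (auto simp: coeff_1)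
  have "inj_on (\<lambda>k. zeta d ^ k) {..<d}" using zeta_powers_bij[OF d0] by (simp add: bij_betw_def)
  then show "card ((\<lambda>k. zeta d ^ k) ` {..<d}) \<ge> d" by (simp add: card_image)
next
  fix z assume "z \<in> (\<lambda>k. zeta d ^ k) ` {..<d}"
  then obtain k where k: "k < d" "z = zeta d ^ k" by blast
  have "z ^ d = 1" using k(2) zeta_power_self[OF d0] by (metis mult.commute power_mult power_one)
  moreover have "poly ?P z = 0" unfolding poly_prod
    using k by (intro prod_zero) auto
  ultimately show "poly (monom 1 d - 1) z = poly ?P z" by (simp add: poly_monom)
qed

text \<open>Divides \<open>x ^ d - 1\<close> by \<open>x - 1\<close> in two ways and puts
  \<open>x = 1\<close>. For \<open>d = p\<close> it factors \<open>p\<close> below; for general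
  \<open>d\<close> it keeps distinct \<open>d\<close>-th roots of unity distinct modulo primes not
  dividing \<open>d\<close>.\<close>

lemma prod_one_minus_zeta:
  assumes d: "d > 1"
  shows "(\<Prod>j\<in>{1..<d}. 1 - zeta d ^ j) = of_nat d"
proof -
  define P where "P = (\<Prod>j<d. [:- (zeta d ^ j), 1:])"
  have "monom 1 d - 1 = P" unfolding P_def by (rule power_minus_one_eq_prod) (use d in simp)
  also have "P = [:-1, 1:] * (\<Prod>j\<in>{1..<d}. [:- (zeta d ^ j), 1:])"
  proof -
    have "{..<d} = insert 0 {1..<d}" using d by auto
    then show ?thesis unfolding P_def by simp
  qed
  also have "monom 1 d - 1 = [:-1, 1:] * (\<Sum>i<d. monom (1::complex) i)"
  proof (rule poly_ext)
    fix x :: complex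
    show "poly (monom 1 d - 1) x = poly ([:-1, 1:] * (\<Sum>i<d. monom 1 i)) x"
      by (simp add: poly_monom poly_sum power_diff_1_eq del: mult_pCons_left)
  qed
  finally have "(\<Sum>i<d. monom (1::complex) i) = (\<Prod>j\<in>{1..<d}. [:- (zeta d ^ j), 1:])"
    by (subst (asm) mult_cancel_left) auto
  from arg_cong[OF this, of "\<lambda>p. poly p 1"] show ?thesis
    by (simp add: poly_sum poly_prod poly_monom)
qed

section \<open>The prime p in the cyclotomic field\<close>

locale cyclotomic_at = cyclotomic +
  fixes p m' :: nat
  assumes p: "prime p" and m_eq: "m = p * m'" and p_m': "\<not> p dvd m'"
begin

lemma p_gt: "p > 1" "p > 0" and m'_pos: "m' > 0" and coprime_pm': "coprime p m'"
  using p prime_gt_1_nat prime_gt_0_nat m_pos m_eq p_m' by (auto simp: prime_imp_coprime)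

lemma dvd_m: "p dvd m" "m' dvd m"
  by (simp_all add: m_eq)

lemma cong_m_iff: "[a = b] (mod m) \<longleftrightarrow> [a = b] (mod p) \<and> [a = b] (mod m')"
  unfolding m_eq using coprime_pm' by (metis coprime_cong_mult_nat cong_modulus_mult_nat mult.commute)

text \<open>This is the Galois group over the field of \<open>m'\<close>-th roots of unity, hence
  the inertia group at \<open>p\<close> of the whole cyclotomic field.\<close>

definition I :: "nat set" where "I = {a \<in> U. [a = 1] (mod m')}"

abbreviation zp :: complex where "zp \<equiv> zeta p"

definition \<pi> :: complex where "\<pi> = 1 - zp"

lemma I_U: "a \<in> I \<Longrightarrow> a \<in> U" by (simp add: I_def)

lemma I_coprime: "a \<in> I \<Longrightarrow> coprime a m" by (simp add: I_def U_def)

lemma pi_nz: "\<pi> \<noteq> 0"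
  using zeta_power_eq_1_iff[of p 1] p_gt by (auto simp: \<pi>_def)

lemma zp_int: "algebraic_int zp" and pi_int: "algebraic_int \<pi>"
  using zeta_algebraic_int p_gt by (auto simp: \<pi>_def intro!: algebraic_int_closed)

lemma zp_L: "zp \<in> L" and pi_L: "\<pi> \<in> L"
  using dvd_m by (auto simp: \<pi>_def intro!: L_intros)

lemma one_minus_zp_power: "1 - zp ^ j = \<pi> * (\<Sum>i<j. zp ^ i)"
  by (simp add: \<pi>_def one_diff_power_eq)

lemma pi_zdvd: "\<pi> zdvd 1 - zp ^ j"
  by (rule zdvdI[OF _ one_minus_zp_power]) (intro algebraic_int_sum algebraic_int_closed zp_int)

lemma inverse_mod_p:
  assumes "j \<in> {1..<p}"
  obtains i where "zp ^ (j * i) = zp"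
proof -
  have "\<not> p dvd j" using assms by (auto dest: dvd_imp_le)
  then have "coprime j p" using prime_imp_coprime[OF p] coprime_commute by blast
  then obtain i where "[j * i = 1] (mod p)" using cong_solve_coprime_nat by auto
  then have "zp ^ (j * i) = zp ^ 1" using zeta_power_eq_iff p_gt by blast
  then show thesis using that by simp
qed

text \<open>The prime \<open>p\<close> is \<open>\<pi>\<^bsup>p-1\<^esup>\<close> times a unit; the unit is recorded with its expression in \<open>\<pi>\<close>,
  because it is needed inside the subring of polynomials in \<open>\<pi>\<close>.\<close>

definition W :: complex where "W = (\<Prod>j\<in>{1..<p}. \<Sum>i<j. zp ^ i)"

lemma p_eq: "of_nat p = \<pi> ^ (p - 1) * W"
proof -
  have "of_nat p = (\<Prod>j\<in>{1..<p}. \<pi> * (\<Sum>i<j. zp ^ i))"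
    using prod_one_minus_zeta[OF p_gt(1)] by (simp add: one_minus_zp_power)
  then show ?thesis by (simp add: W_def prod.distrib)
qed

text \<open>The inverse of \<open>W\<close>. If \<open>j * i\<close> is 1 modulo \<open>p\<close>,
  then \<open>1 - zp\<close> equals \<open>1 - (zp ^ j) ^ i\<close>, a multiple of
  \<open>1 - zp ^ j\<close>; \<open>V\<close> collects the cofactors.\<close>

definition V :: complex where
  "V = (\<Prod>j\<in>{1..<p}. \<Sum>k<(SOME i. zp ^ (j * i) = zp). zp ^ (j * k))"

lemma pi_power_eq: "\<pi> ^ (p - 1) = of_nat p * V"
proof -
  have "\<pi> = (1 - zp ^ j) * (\<Sum>k<(SOME i. zp ^ (j * i) = zp). zp ^ (j * k))" if j: "j \<in> {1..<p}" for j
  proof -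
    let ?i = "SOME i. zp ^ (j * i) = zp"
    have i: "zp ^ (j * ?i) = zp" 
    proof -
      obtain i where "zp ^ (j * i) = zp" using inverse_mod_p[OF j] by blast
      then show ?thesis by (rule someI)
    qed
    have "1 - (zp ^ j) ^ ?i = (1 - zp ^ j) * (\<Sum>k<?i. (zp ^ j) ^ k)" by (rule one_diff_power_eq)
    then show ?thesis using i by (simp add: power_mult[symmetric] \<pi>_def)
  qed
  then have "(\<Prod>j\<in>{1..<p}. \<pi>) = (\<Prod>j\<in>{1..<p}. (1 - zp ^ j) * (\<Sum>k<(SOME i. zp ^ (j * i) = zp). zp ^ (j * k)))"
    by (intro prod.cong) auto
  then show ?thesis using prod_one_minus_zeta[OF p_gt(1)] by (simp add: V_def prod.distrib)
qed

lemma W_int: "algebraic_int W" and V_int: "algebraic_int V"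
  by (auto simp: W_def V_def intro!: algebraic_int_intros zp_int)

lemma V_W: "V * W = 1"
proof -
  have "of_nat p * (V * W) = of_nat p * (1 :: complex)"
    using p_eq pi_power_eq by (simp add: mult.assoc[symmetric])
  then show ?thesis using p_gt by simp
qed

lemma p_zdvd_pi_power: "k \<ge> p - 1 \<Longrightarrow> of_nat p zdvd \<pi> ^ k"
proof -
  assume "k \<ge> p - 1"
  then have "\<pi> ^ k = \<pi> ^ (p - 1) * \<pi> ^ (k - (p - 1))" by (simp add: power_add[symmetric])
  then have "\<pi> ^ k = of_nat p * (V * \<pi> ^ (k - (p - 1)))" by (simp only: pi_power_eq mult.assoc)
  then show ?thesis by (rule zdvdI[rotated]) (intro algebraic_int_mult algebraic_int_closed V_int pi_int)
qed

lemma p_eq': "of_nat p = \<pi> * (\<pi> ^ (p - 2) * W)"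
proof -
  have "p - 1 = Suc (p - 2)" using p_gt by simp
  then show ?thesis using p_eq by (simp add: mult.assoc)
qed

lemma pi_zdvd_p: "\<pi> zdvd of_nat p"
proof -
  show ?thesis by (rule zdvdI[OF _ p_eq']) (intro algebraic_int_mult algebraic_int_closed W_int pi_int)
qed

lemma finite_I: "finite I" by (simp add: I_def)

lemma one_mod_in_I: "1 mod m \<in> I"
  unfolding I_def using mod_in_U[of 1] dvd_m(2)
  by (simp add: cong_def mod_mod_cancel del: One_nat_def)

lemma coprime_m_iff: "coprime a m \<longleftrightarrow> coprime a p \<and> coprime a m'"
  by (simp add: m_eq)

lemma inj_on_I_mod: "inj_on (\<lambda>a. a mod p) I"
proof (rule inj_onI)
  fix a b assume "a \<in> I" "b \<in> I" "a mod p = b mod p"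
  then have "[a = b] (mod m)" "a < m" "b < m"
    unfolding cong_m_iff by (auto simp: I_def U_def cong_def)
  then show "a = b" by (simp add: cong_def)
qed

text \<open>\<open>S\<close> embeds into the nonzero residues modulo \<open>p\<close> and so has
  fewer than \<open>p\<close> elements. Thus the orders of inertia groups are invertible modulo
  \<open>p\<close>.\<close>

lemma card_subset_I:
  assumes "S \<subseteq> I" "S \<noteq> {}"
  shows "\<not> p dvd card S"
proof -
  have "a mod p \<in> {1..<p}" if "a \<in> S" for a
  proof -
    have "coprime a p" using that assms(1) I_coprime coprime_m_iff by blast
    then have "\<not> p dvd a" using p_gt by (metis coprime_absorb_right coprime_commute less_irrefl nat_dvd_1_iff_1 is_unit_gcd gcd_nat.absorb1 One_nat_def coprime_iff_gcd_eq_1)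
    then show ?thesis using p_gt by (auto simp: dvd_eq_mod_eq_0 Suc_le_eq)
  qed
  then have "(\<lambda>a. a mod p) ` S \<subseteq> {1..<p}" by blast
  moreover have "inj_on (\<lambda>a. a mod p) S" using inj_on_I_mod assms(1) inj_on_subset by blast
  ultimately have "card S \<le> card {1..<p}" by (metis card_inj_on_le finite_atLeastLessThan)
  then have "card S < p" using p_gt by simp
  moreover have "card S > 0" using assms finite_I finite_subset by (metis card_gt_0_iff)
  ultimately show ?thesis using nat_dvd_not_less by blast
qed

lemma card_I: "\<not> p dvd card I"
  using card_subset_I one_mod_in_I by blast

text \<open>\<open>O'\<close> is the ring of integers of the fixed field of the inertia group. Since \<open>p\<close> is unramified there, an
  element of \<open>O'\<close> divisible by \<open>\<pi>\<close> is divisible by \<open>p\<close>; hence \<open>\<pi>\<close> can be cancelled in \<open>R = O'[\<pi>]\<close>, which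
  shows that \<open>R\<close> contains all integers of \<open>L\<close>.\<close>

definition O' :: "complex set" where
  "O' = {b \<in> L. algebraic_int b \<and> (\<forall>a\<in>I. sig a b = b)}"

definition R :: "complex set" where
  "R = {poly f \<pi> | f. \<forall>i. coeff f i \<in> O'}"

lemma O'_add: "x \<in> O' \<Longrightarrow> y \<in> O' \<Longrightarrow> x + y \<in> O'"
  by (auto simp: O'_def sig_add I_coprime L_add algebraic_int_add)

lemma O'_mult: "x \<in> O' \<Longrightarrow> y \<in> O' \<Longrightarrow> x * y \<in> O'"
  by (auto simp: O'_def sig_mult I_coprime L_mult algebraic_int_mult)

lemma O'_of_int: "of_int k \<in> O'"
  by (auto simp: O'_def sig_of_int I_coprime L_of_int algebraic_int_closed)

lemma O'_0: "0 \<in> O'" and O'_1: "1 \<in> O'"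
  using O'_of_int[of 0] O'_of_int[of 1] by simp_all

lemma O'_sum: "(\<And>i. i \<in> A \<Longrightarrow> f i \<in> O') \<Longrightarrow> sum f A \<in> O'"
  by (induction A rule: infinite_finite_induct) (auto intro: O'_add O'_0)

lemma R_add: "x \<in> R \<Longrightarrow> y \<in> R \<Longrightarrow> x + y \<in> R"
proof -
  assume "x \<in> R" "y \<in> R"
  then obtain f g where "x = poly f \<pi>" "y = poly g \<pi>" "\<forall>i. coeff f i \<in> O'" "\<forall>i. coeff g i \<in> O'"
    by (auto simp: R_def)
  then show ?thesis unfolding R_def by (intro CollectI exI[of _ "f + g"]) (auto intro: O'_add)
qed

lemma R_mult: "x \<in> R \<Longrightarrow> y \<in> R \<Longrightarrow> x * y \<in> R"
proof -
  assume "x \<in> R" "y \<in> R"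
  then obtain f g where "x = poly f \<pi>" "y = poly g \<pi>" "\<forall>i. coeff f i \<in> O'" "\<forall>i. coeff g i \<in> O'"
    by (auto simp: R_def)
  then show ?thesis unfolding R_def
    by (intro CollectI exI[of _ "f * g"]) (auto simp: coeff_mult intro!: O'_sum O'_mult)
qed

lemma R_O': "b \<in> O' \<Longrightarrow> b \<in> R"
  unfolding R_def by (intro CollectI exI[of _ "[:b:]"]) (auto simp: coeff_pCons O'_0 split: nat.split)

lemma R_pi: "\<pi> \<in> R"
  unfolding R_def by (intro CollectI exI[of _ "[:0,1:]"]) (auto simp: coeff_pCons O'_0 O'_1 split: nat.split)

lemma R_of_int: "of_int k \<in> R" by (intro R_O' O'_of_int)

lemma R_0: "0 \<in> R" and R_1: "1 \<in> R"
  using R_of_int[of 0] R_of_int[of 1] by simp_all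

lemma R_zp: "zp \<in> R"
  using R_add[OF R_1 R_mult[OF R_of_int[of "-1"] R_pi]] by (simp add: \<pi>_def)

lemma R_power: "x \<in> R \<Longrightarrow> x ^ k \<in> R"
  by (induction k) (auto intro: R_mult R_1)

lemma R_sum: "(\<And>i. i \<in> A \<Longrightarrow> f i \<in> R) \<Longrightarrow> sum f A \<in> R"
  by (induction A rule: infinite_finite_induct) (auto intro: R_add R_0)

lemma R_prod: "(\<And>i. i \<in> A \<Longrightarrow> f i \<in> R) \<Longrightarrow> prod f A \<in> R"
  by (induction A rule: infinite_finite_induct) (auto intro: R_mult R_1)

lemma R_W: "W \<in> R" and R_V: "V \<in> R"
  by (auto simp: W_def V_def intro!: R_prod R_sum R_power R_zp)

lemma R_int: "x \<in> R \<Longrightarrow> algebraic_int x"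
  unfolding R_def by (auto intro!: algebraic_int_poly pi_int simp: O'_def)

text \<open>A power of \<open>p\<close> that is 1 modulo \<open>m'\<close>, so that raising to it
  fixes the \<open>m'\<close>-th roots of unity. Being at least \<open>p\<close>, it also makes
  \<open>\<pi> ^ Q\<close> divisible by \<open>p\<close>.\<close>

definition Q :: nat where "Q = p ^ totient m'"

lemma Q_cong: "[Q = 1] (mod m')"
  unfolding Q_def using euler_theorem[OF coprime_pm'] .

lemma Q_ge: "Q \<ge> p"
proof -
  have "totient m' > 0" using m'_pos by simp
  then show ?thesis unfolding Q_def using p_gt by (simp add: self_le_power)
qed

lemma O'_frobenius: "b \<in> O' \<Longrightarrow> of_nat p zdvd b ^ Q - b"
  unfolding Q_def using card_I Q_cong[unfolded Q_def] p p_m' dvd_m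
  by (intro frobenius_power_fixed) (auto simp: O'_def I_def)

text \<open>Modulo \<open>p\<close>, \<open>b\<close> is congruent to \<open>b ^ Q\<close>, which is
  divisible by \<open>\<pi> ^ Q\<close> and hence by \<open>p\<close>.\<close>

lemma O'_divisible:
  assumes b: "b \<in> O'" and d: "\<pi> zdvd b"
  obtains b' where "b' \<in> O'" "b = of_nat p * b'"
proof -
  have "of_nat p zdvd \<pi> ^ Q" using Q_ge by (intro p_zdvd_pi_power) simp
  also have "\<pi> ^ Q zdvd b ^ Q" using d by (rule zdvd_power)
  finally (zdvd_trans) have "of_nat p zdvd b ^ Q" .
  from zdvd_diff[OF this O'_frobenius[OF b]] have "of_nat p zdvd b" by simp
  then obtain b' where b': "algebraic_int b'" "b = of_nat p * b'" by (auto simp: zdvd_def)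
  then have eq: "b' = b * of_rat (1 / of_nat p)" using p_gt by (simp add: of_rat_divide)
  have bL: "b \<in> L" "\<And>a. a \<in> I \<Longrightarrow> sig a b = b" using b by (auto simp: O'_def)
  have "b' \<in> O'" unfolding O'_def
    using b'(1) bL by (auto simp: eq sig_mult sig_of_rat I_coprime L_of_rat intro!: L_mult)
  then show thesis using that b'(2) by blast
qed

text \<open>In an expansion of \<open>\<pi> * x\<close> the constant coefficient is divisible by
  \<pi>, hence by \<open>p = \<pi> * (\<pi> ^ (p - 2) * W)\<close>, so \<pi> can be taken out of
  every term without leaving \<open>R\<close>.\<close>

lemma R_cancel_pi:
  assumes x: "algebraic_int x" and pix: "\<pi> * x \<in> R"
  shows "x \<in> R"
proof -
  obtain f where f: "\<pi> * x = poly f \<pi>" "\<forall>i. coeff f i \<in> O'" using pix by (auto simp: R_def)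
  obtain b g where fg: "f = pCons b g" by (cases f)
  have b: "b \<in> O'" using f(2) fg by (metis coeff_pCons_0)
  have "coeff g i \<in> O'" for i using f(2) fg by (metis coeff_pCons_Suc)
  then have g: "poly g \<pi> \<in> R" by (auto simp: R_def)
  have "b = \<pi> * (x - poly g \<pi>)" using f(1) fg by (simp add: algebra_simps)
  then have "\<pi> zdvd b"
    using x R_int[OF g] by (intro zdvdI[of "x - poly g \<pi>"]) (auto intro: algebraic_int_closed)
  then obtain b' where b': "b' \<in> O'" "b = of_nat p * b'" using O'_divisible b by blast
  then have "\<pi> * x = \<pi> * (\<pi> ^ (p - 2) * W * b' + poly g \<pi>)"
    using f(1) fg b'(2) p_eq' by (simp add: algebra_simps)
  then have "x = \<pi> ^ (p - 2) * W * b' + poly g \<pi>" using pi_nz by simp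
  then show ?thesis using g b'(1) by (simp add: R_add R_mult R_power R_pi R_W R_O')
qed

lemma R_cancel_pi_power:
  assumes "algebraic_int x" "\<pi> ^ k * x \<in> R" shows "x \<in> R"
  using assms(2)
proof (induction k)
  case (Suc k)
  then have "\<pi> * (\<pi> ^ k * x) \<in> R" by (simp add: mult.assoc)
  then have "\<pi> ^ k * x \<in> R"
    by (rule R_cancel_pi[rotated]) (intro algebraic_int_intros pi_int assms(1))
  then show ?case by (rule Suc.IH)
qed simp

lemma I_mult_invariant:
  assumes b: "b \<in> I" and a: "a \<in> U"
  shows "a \<in> I \<longleftrightarrow> b * a mod m \<in> I"
proof -
  have "[b * a mod m = b * a] (mod m')" using dvd_m by (simp add: cong_def mod_mod_cancel)
  moreover have "[b * a = 1 * a] (mod m')" using b by (intro cong_mult) (auto simp: I_def)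
  ultimately have "[b * a mod m = a] (mod m')" using cong_trans by fastforce
  moreover have "b * a mod m \<in> U" using a b by (intro mod_in_U) (simp add: U_coprime I_coprime)
  ultimately show ?thesis using a unfolding I_def
    by (auto intro: cong_trans cong_sym)
qed

lemma trace_O':
  assumes "x \<in> L" "algebraic_int x"
  shows "(\<Sum>a\<in>I. sig a x) \<in> O'"
proof -
  have "sig b (\<Sum>a\<in>I. sig a x) = (\<Sum>a\<in>I. sig a x)" if "b \<in> I" for b
  proof (rule sig_invariant_sum)
    show "coprime b m" using that by (rule I_coprime)
    show "I \<subseteq> U" using I_U by blast
    show "a \<in> I \<longleftrightarrow> b * a mod m \<in> I" if "a \<in> U" for a
      using I_mult_invariant \<open>b \<in> I\<close> that by blast
  qed (rule assms)
  then show ?thesis unfolding O'_def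
    using assms by (auto intro!: L_sum sig_in_L algebraic_int_sum sig_algebraic_int I_coprime)
qed

text \<open>Only the identity of \<open>I\<close> is 1 modulo \<open>p\<close>, so Fourier inversion
  of the traces of \<open>x * zp ^ k\<close> over \<open>I\<close> puts \<open>p * x\<close> into
  \<open>R\<close>. Up to the unit \<open>V\<close> this is \<open>\<pi> ^ (p - 1) * x\<close>, and
  \<pi> can be cancelled.\<close>

lemma integers_subset_R:
  assumes x: "x \<in> L" "algebraic_int x"
  shows "x \<in> R"
proof -
  have xk: "x * zp ^ k \<in> L" "algebraic_int (x * zp ^ k)" for k
    using x zp_int by (auto intro!: L_mult L_power zp_L algebraic_int_intros)
  have "(\<Sum>k<p. inverse zp ^ k * (\<Sum>a\<in>I. sig a x * zp ^ (a * k)))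
      = of_nat p * (\<Sum>a | a \<in> I \<and> [a = 1] (mod p). sig a x)"
    by (rule fourier_extract[OF p_gt(2) finite_I])
  also have "{a. a \<in> I \<and> [a = 1] (mod p)} = {1 mod m}"
  proof -
    have "a = 1 mod m" if "a \<in> I" "[a = 1] (mod p)" for a
    proof -
      have "[a = 1] (mod m)" "a < m" using that by (auto simp: cong_m_iff I_def U_def)
      then show ?thesis by (simp add: cong_def)
    qed
    moreover have "[1 mod m = 1] (mod p)" using dvd_m(1) by (simp add: cong_def mod_mod_cancel del: One_nat_def)
    ultimately show ?thesis using one_mod_in_I by blast
  qed
  also have "(\<Sum>a\<in>{1 mod m}. sig a x) = x" using x by (simp add: sig_mod sig_1_eq del: One_nat_def)
  finally have eq: "of_nat p * x = (\<Sum>k<p. inverse zp ^ k * (\<Sum>a\<in>I. sig a x * zp ^ (a * k)))" by simp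
  have "(\<Sum>a\<in>I. sig a x * zp ^ (a * k)) = (\<Sum>a\<in>I. sig a (x * zp ^ k))" for k
    using x zp_L dvd_m
    by (intro sum.cong refl)
      (simp add: I_coprime sig_mult sig_power L_power sig_zeta_divisor power_mult)
  then have "of_nat p * x \<in> R"
    unfolding eq inverse_zeta[OF p_gt(2)] by (simp add: R_sum R_mult R_power R_O' trace_O' xk R_zp)
  then have "V * (of_nat p * x) \<in> R" by (rule R_mult[OF R_V])
  then have "\<pi> ^ (p - 1) * x \<in> R" by (simp only: pi_power_eq mult_ac)
  then show ?thesis using R_cancel_pi_power x by blast
qed

text \<open>In the expansion of \<open>x\<close> in powers of \<pi> the coefficients are fixed by
  \<open>a\<close>, and \<pi> goes to \<open>1 - zp ^ a\<close>, another multiple of \<pi>.\<close>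

lemma inertia_acts_trivially:
  assumes a: "a \<in> I" and x: "x \<in> L" "algebraic_int x"
  shows "\<pi> zdvd sig a x - x"
proof -
  obtain f where f: "x = poly f \<pi>" "\<forall>i. coeff f i \<in> O'"
    using integers_subset_R[OF x] by (auto simp: R_def)
  have co: "coeff f i \<in> L" "algebraic_int (coeff f i)" "sig a (coeff f i) = coeff f i" for i
    using f(2) a by (auto simp: O'_def)
  have cop: "coprime a m" using a by (rule I_coprime)
  have pia: "sig a \<pi> = 1 - zp ^ a"
    using cop dvd_m by (simp add: \<pi>_def sig_diff sig_1 sig_zeta_divisor L_1 zp_L)
  have "sig a x = (\<Sum>i\<le>degree f. coeff f i * (1 - zp ^ a) ^ i)"
    using cop co by (simp add: f(1) poly_altdef sig_sum sig_mult sig_power pia L_mult L_power pi_L)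
  then have "sig a x - x = (\<Sum>i\<le>degree f. coeff f i * ((1 - zp ^ a) ^ i - \<pi> ^ i))"
    by (simp add: f(1) poly_altdef sum_subtractf algebra_simps)
  moreover have "\<pi> zdvd (1 - zp ^ a) - \<pi>" by (intro zdvd_diff pi_zdvd zdvd_refl)
  then have "\<pi> zdvd (\<Sum>i\<le>degree f. coeff f i * ((1 - zp ^ a) ^ i - \<pi> ^ i))"
    using co by (intro zdvd_sum zdvd_mult2 zdvd_power_diff) (auto intro!: algebraic_int_intros zp_int pi_int)
  ultimately show ?thesis by simp
qed

text \<open>Modulo \<pi>, \<open>x\<close> is congruent to the constant coefficient of its
  expansion, an element of \<open>O'\<close>, for which the congruence holds even modulo
  \<open>p\<close>.\<close>

lemma frobenius_mod_pi:
  assumes x: "x \<in> L" "algebraic_int x"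
  shows "\<pi> zdvd x ^ Q - x"
proof -
  obtain f where f: "x = poly f \<pi>" "\<forall>i. coeff f i \<in> O'"
    using integers_subset_R[OF x] by (auto simp: R_def)
  obtain b g where fg: "f = pCons b g" by (cases f)
  have b: "b \<in> O'" using f(2) fg by (metis coeff_pCons_0)
  then have bi: "algebraic_int b" by (simp add: O'_def)
  have "coeff g i \<in> O'" for i using f(2) fg by (metis coeff_pCons_Suc)
  then have g: "algebraic_int (poly g \<pi>)" by (intro R_int) (auto simp: R_def)
  have "\<pi> zdvd x - b" using f(1) fg g by (auto simp: zdvd_def)
  then have "\<pi> zdvd x ^ Q - b ^ Q" using x bi by (intro zdvd_power_diff)
  moreover have "\<pi> zdvd b ^ Q - b" using O'_frobenius[OF b] pi_zdvd_p zdvd_trans by blast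
  ultimately show ?thesis using \<open>\<pi> zdvd x - b\<close> zdvd_diff_trans zdvd_diff_commute by blast
qed

end

section \<open>Abelian subfields of cyclotomic fields\<close>

text \<open>The norm of \<open>x\<close> is Galois invariant, hence rational; the product of the
  other conjugates divided by it is the inverse.\<close>

lemma (in cyclotomic) L_inverse: "x \<in> L \<Longrightarrow> inverse x \<in> L"
proof (cases "x = 0")
  case False
  assume x: "x \<in> L"
  have U1: "1 mod m \<in> U" by (rule mod_in_U) simp
  define N where "N = (\<Prod>a\<in>U. sig a x)"
  define N' where "N' = (\<Prod>a\<in>U - {1 mod m}. sig a x)"
  have "N = sig (1 mod m) x * N'" unfolding N_def N'_def by (rule prod.remove[OF finite_U U1])
  then have NN: "N = x * N'" using x by (simp add: sig_mod sig_1_eq del: One_nat_def)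
  have sL: "sig a x \<in> L" if "a \<in> U" for a using that x by (intro sig_in_L U_coprime)
  have NL: "N \<in> L" unfolding N_def by (rule L_prod) (rule sL)
  have N'L: "N' \<in> L" unfolding N'_def by (rule L_prod) (rule sL, blast)
  have "sig b N = N" if b: "b \<in> U" for b
  proof -
    have "sig b N = (\<Prod>a\<in>U. sig (b * a mod m) x)"
      using b x by (simp add: N_def sig_prod sig_in_L sig_sig sig_mod U_coprime)
    also have "\<dots> = N" unfolding N_def
      by (rule prod.reindex_bij_betw[OF bij_betw_mult_mod_U]) (use b U_coprime in blast)
    finally show ?thesis .
  qed
  then have "N \<in> \<rat>" using NL fixed_imp_rational by blast
  then obtain q where q: "N = of_rat q" by (auto elim: Rats_cases)
  have "N \<noteq> 0" using False x by (auto simp: N_def sig_eq_0_iff U_coprime)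
  then have "inverse x = N' * of_rat (inverse q)"
  proof -
    have "x * (N' * inverse N) = N * inverse N" using NN by (simp only: mult.assoc)
    then have "x * (N' * inverse N) = 1" using \<open>N \<noteq> 0\<close> by simp
    then show ?thesis using q by (metis inverse_unique of_rat_inverse)
  qed
  then show ?thesis using N'L by (simp add: L_mult L_of_rat)
qed (simp add: L_0)

text \<open>Induction over the factors: acting on the coefficients amounts to moving the roots. It
  shows later that a product over all conjugates has rational coefficients.\<close>

lemma (in cyclotomic) coeff_prod_linear_L:
  fixes g :: "nat \<Rightarrow> complex"
  assumes "finite A" "\<And>a. a \<in> A \<Longrightarrow> g a \<in> L"
  shows "coeff (\<Prod>a\<in>A. [:- g a, 1:]) i \<in> L \<and>
    (\<forall>b. coprime b m \<longrightarrow> sig b (coeff (\<Prod>a\<in>A. [:- g a, 1:]) i) = coeff (\<Prod>a\<in>A. [:- sig b (g a), 1:]) i)"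
  using assms
proof (induction A arbitrary: i rule: finite_induct)
  case empty
  then show ?case by (auto simp: coeff_1 L_1 L_0 sig_1 sig_0)
next
  case (insert r A)
  have split: "coeff (\<Prod>a\<in>insert r A. [:- h a, 1:]) i
      = (if i = 0 then 0 else coeff (\<Prod>a\<in>A. [:- h a, 1:]) (i - 1)) - h r * coeff (\<Prod>a\<in>A. [:- h a, 1:]) i"
    for h :: "nat \<Rightarrow> complex"
    using insert.hyps by (cases i) (simp_all add: coeff_pCons)
  have IH: "coeff (\<Prod>a\<in>A. [:- g a, 1:]) j \<in> L"
    "coprime b m \<Longrightarrow> sig b (coeff (\<Prod>a\<in>A. [:- g a, 1:]) j) = coeff (\<Prod>a\<in>A. [:- sig b (g a), 1:]) j" for j b
    using insert by auto
  have gr: "g r \<in> L" using insert by simp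
  show ?case unfolding split
    using IH gr by (auto simp: sig_diff sig_mult sig_0 L_mult L_diff L_0)
qed

text \<open>A polynomial with infinitely many zeros vanishes. This supplies generic integer
  combinations, both for the embeddings of \<open>K\<close> and for the radicals.\<close>

lemma Sum_polynomial_eq_0:
  fixes u :: "nat \<Rightarrow> complex"
  assumes "infinite {c :: nat. (\<Sum>k<n. of_nat c ^ k * u k) = 0}" "k < n"
  shows "u k = 0"
proof -
  define D where "D = (\<Sum>k<n. monom (u k) k)"
  have "(of_nat :: nat \<Rightarrow> complex) ` {c. (\<Sum>k<n. of_nat c ^ k * u k) = 0} \<subseteq> {x. poly D x = 0}"
    by (auto simp: D_def poly_sum poly_monom mult.commute)
  moreover have "infinite ((of_nat :: nat \<Rightarrow> complex) ` {c. (\<Sum>k<n. of_nat c ^ k * u k) = 0})"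
    using assms(1) by (subst finite_image_iff) (auto simp: inj_on_def)
  ultimately have "D = 0" using poly_roots_finite finite_subset by blast
  then have "coeff D k = 0" by simp
  then show ?thesis using assms(2) by (simp add: D_def coeff_sum)
qed

section \<open>The field cut out by a character, and its Galois group\<close>

locale abelian_cyclotomic = cyclotomic m + comm_group G
  for m :: nat and G :: "('a, 'b) monoid_scheme" (structure) +
  fixes \<chi> :: "nat \<Rightarrow> 'a"
  assumes chi_closed: "coprime a m \<Longrightarrow> \<chi> a \<in> carrier G"
    and chi_mult: "coprime a m \<Longrightarrow> coprime b m \<Longrightarrow> \<chi> (a * b) = \<chi> a \<otimes> \<chi> b"
    and chi_cong: "[a = b] (mod m) \<Longrightarrow> \<chi> a = \<chi> b"
    and chi_surj: "g \<in> carrier G \<Longrightarrow> \<exists>a. coprime a m \<and> \<chi> a = g"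
begin

lemma chi_mod: "\<chi> (a mod m) = \<chi> a"
  by (rule chi_cong) (simp add: cong_def)

lemma chi_1: "\<chi> 1 = \<one>"
proof -
  have "\<chi> 1 \<otimes> \<chi> 1 = \<chi> 1" using chi_mult[of 1 1] by simp
  then show ?thesis using chi_closed[of 1] by (metis coprime_1_left l_cancel_one')
qed

definition H :: "nat set" where "H = {a \<in> U. \<chi> a = \<one>}"

definition K :: "complex set" where "K = {x \<in> L. \<forall>a\<in>H. sig a x = x}"

lemma H_U: "a \<in> H \<Longrightarrow> a \<in> U" and H_coprime: "a \<in> H \<Longrightarrow> coprime a m" and finite_H: "finite H"
  by (auto simp: H_def U_def)

lemma one_mod_in_H: "1 mod m \<in> H"
  using mod_in_U[of 1] chi_1 by (simp add: H_def chi_mod del: One_nat_def)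

lemma card_H: "card H > 0"
  using one_mod_in_H finite_H card_gt_0_iff by blast

lemma K_L: "x \<in> K \<Longrightarrow> x \<in> L" by (simp add: K_def)

lemma K_sig_H: "x \<in> K \<Longrightarrow> a \<in> H \<Longrightarrow> sig a x = x" by (simp add: K_def)

lemma K_add: "x \<in> K \<Longrightarrow> y \<in> K \<Longrightarrow> x + y \<in> K"
  by (simp add: K_def L_add sig_add H_coprime)

lemma K_diff: "x \<in> K \<Longrightarrow> y \<in> K \<Longrightarrow> x - y \<in> K"
  by (simp add: K_def L_diff sig_diff H_coprime)

lemma K_mult: "x \<in> K \<Longrightarrow> y \<in> K \<Longrightarrow> x * y \<in> K"
  by (simp add: K_def L_mult sig_mult H_coprime)

lemma K_of_rat: "of_rat q \<in> K"
  by (simp add: K_def L_of_rat sig_of_rat H_coprime)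

lemma K_of_int: "of_int q \<in> K"
  using K_of_rat[of "of_int q"] by simp

lemma K_of_nat: "of_nat q \<in> K"
  using K_of_int[of "int q"] by simp

lemma K_0: "0 \<in> K" and K_1: "1 \<in> K"
  using K_of_nat[of 0] K_of_nat[of 1] by simp_all

lemma K_power: "x \<in> K \<Longrightarrow> x ^ k \<in> K"
  by (induction k) (auto intro: K_mult K_1)

lemma K_sum: "(\<And>i. i \<in> A \<Longrightarrow> f i \<in> K) \<Longrightarrow> sum f A \<in> K"
  by (induction A rule: infinite_finite_induct) (auto intro: K_add K_0)

lemma K_inverse: "x \<in> K \<Longrightarrow> inverse x \<in> K"
proof (cases "x = 0")
  case False
  assume x: "x \<in> K"
  have "sig a (inverse x) = inverse x" if a: "a \<in> H" for a
  proof -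
    have "sig a (x * inverse x) = sig a x * sig a (inverse x)"
      using x a by (intro sig_mult H_coprime L_inverse K_L)
    then have "x * sig a (inverse x) = 1" using x a False by (simp add: K_sig_H sig_1 H_coprime)
    then show ?thesis using False by (metis inverse_unique)
  qed
  then show ?thesis using x by (simp add: K_def L_inverse)
qed (simp add: K_0)

lemma K_subfield: "is_subfield K"
  unfolding is_subfield_def by (auto intro: K_0 K_1 K_add K_diff K_mult K_inverse)

lemma sig_K: "coprime a m \<Longrightarrow> x \<in> K \<Longrightarrow> sig a x \<in> K"
proof -
  assume a: "coprime a m" and x: "x \<in> K"
  have "sig b (sig a x) = sig a x" if b: "b \<in> H" for b
  proof -
    have "sig b (sig a x) = sig a (sig b x)"
      using a b x by (simp add: sig_sig H_coprime K_L mult.commute)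
    then show ?thesis using b x by (simp add: K_sig_H)
  qed
  then show ?thesis using a x by (simp add: K_def sig_in_L)
qed

definition Tr :: "complex \<Rightarrow> complex" where "Tr x = (\<Sum>a\<in>H. sig a x)"

lemma H_mult_invariant:
  assumes b: "b \<in> H" and a: "a \<in> U"
  shows "a \<in> H \<longleftrightarrow> b * a mod m \<in> H"
proof -
  have "\<chi> (b * a mod m) = \<chi> a"
    using assms chi_closed[of a] by (simp add: chi_mod chi_mult U_coprime H_coprime) (simp add: H_def)
  moreover have "b * a mod m \<in> U" using a b by (intro mod_in_U) (simp add: U_coprime H_coprime)
  ultimately show ?thesis using a by (simp add: H_def)
qed

lemma Tr_K: "x \<in> L \<Longrightarrow> Tr x \<in> K"
proof -
  assume x: "x \<in> L"
  have "sig b (Tr x) = Tr x" if "b \<in> H" for b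
    unfolding Tr_def
  proof (rule sig_invariant_sum)
    show "coprime b m" using that by (rule H_coprime)
    show "H \<subseteq> U" using H_U by blast
    show "a \<in> H \<longleftrightarrow> b * a mod m \<in> H" if "a \<in> U" for a
      using H_mult_invariant \<open>b \<in> H\<close> that by blast
  qed (rule x)
  then show ?thesis using x by (simp add: K_def Tr_def L_sum sig_in_L H_coprime)
qed

lemma Tr_int: "x \<in> L \<Longrightarrow> algebraic_int x \<Longrightarrow> algebraic_int (Tr x)"
  unfolding Tr_def by (intro algebraic_int_sum sig_algebraic_int H_coprime)

lemma Tr_mult_K: "x \<in> L \<Longrightarrow> y \<in> K \<Longrightarrow> Tr (y * x) = y * Tr x"
  by (simp add: Tr_def sig_mult H_coprime K_L K_sig_H sum_distrib_left)

lemma Tr_zeta_power: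
  assumes "d dvd m" "x \<in> L"
  shows "Tr (x * zeta d ^ k) = (\<Sum>a\<in>H. sig a x * zeta d ^ (a * k))"
  unfolding Tr_def using assms
  by (intro sum.cong refl)
    (simp add: H_coprime sig_mult sig_power L_power L_zeta_divisor sig_zeta_divisor power_mult)

text \<open>These traces span \<open>K\<close> over the rationals, since
  \<open>x = Tr x / card H\<close> for \<open>x\<close> in \<open>K\<close>.\<close>

definition B :: "nat \<Rightarrow> complex" where "B k = Tr (zeta m ^ k)"

lemma B_K: "B k \<in> K" and B_mod: "B (k mod m) = B k"
  by (simp_all add: B_def Tr_K L_power L_zeta zeta_power_mod m_pos)

lemma K_expand:
  assumes "x \<in> K"
  obtains n c where "x = (\<Sum>i\<le>n. of_rat (c i) * B i)"
proof -
  obtain f where f: "x = ev f (zeta m)" using assms K_L L_E by metis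
  define c where "c i = coeff f i / of_nat (card H)" for i
  have "of_nat (card H) * x = Tr (x * 1)" using assms by (simp add: Tr_def K_sig_H)
  also have "\<dots> = (\<Sum>a\<in>H. \<Sum>i\<le>degree f. of_rat (coeff f i) * sig a (zeta m ^ i))"
    unfolding Tr_def f ev_altdef
    by (intro sum.cong refl) (simp add: sig_sum sig_mult sig_of_rat H_coprime L_mult L_of_rat L_power L_zeta)
  also have "\<dots> = (\<Sum>i\<le>degree f. of_rat (coeff f i) * B i)"
    by (subst sum.swap) (simp add: B_def Tr_def sum_distrib_left)
  finally have "x = (\<Sum>i\<le>degree f. of_rat (coeff f i) * B i) / of_nat (card H)"
    using card_H by (simp add: field_simps)
  also have "\<dots> = (\<Sum>i\<le>degree f. of_rat (c i) * B i)"
    by (simp add: c_def of_rat_divide sum_divide_distrib)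
  finally show thesis by (rule that)
qed

lemma K_number_field: "number_field K"
  unfolding number_field_def
proof (intro conjI K_subfield exI[of _ "B ` {..<m}"] ballI)
  show "B ` {..<m} \<subseteq> K" using B_K by blast
  fix x assume "x \<in> K"
  then obtain n c where x: "x = (\<Sum>i\<le>n. of_rat (c i) * B i)" by (rule K_expand)
  \<comment> \<open>Several indices may give the same trace, while \<open>number_field\<close> asks
    for a combination indexed by a set; the coefficients of equal traces are added up.\<close>
  define d where "d b = (\<Sum>i | i \<le> n \<and> B i = b. c i)" for b
  have "(\<Sum>i\<le>n. of_rat (c i) * B i) = (\<Sum>b\<in>B ` {..<m}. \<Sum>i | i \<in> {..n} \<and> B i = b. of_rat (c i) * B i)"
  proof (rule sum.group[symmetric])
    show "B ` {..n} \<subseteq> B ` {..<m}"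
    proof
      fix b assume "b \<in> B ` {..n}"
      then obtain i where "b = B (i mod m)" by (auto simp: B_mod)
      then show "b \<in> B ` {..<m}" using m_pos by simp
    qed
  qed auto
  also have "\<dots> = (\<Sum>b\<in>B ` {..<m}. of_rat (d b) * b)"
    by (intro sum.cong refl) (simp add: d_def of_rat_sum sum_distrib_right)
  finally show "\<exists>c. x = (\<Sum>b\<in>B ` {..<m}. of_rat (c b) * b)" using x by blast
qed simp

text \<open>If \<open>sig a\<close> fixes every \<open>B k\<close>, Fourier inversion shows that
  \<open>H\<close> contains as many \<open>h\<close> with \<open>a * h\<close> congruent to 1 as
  with \<open>h\<close> congruent to 1, so at least one. Then \<open>a\<close> is inverse to a
  member of the kernel.\<close>

lemma sig_fixes_K_iff:
  assumes a: "coprime a m"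
  shows "(\<forall>x\<in>K. sig a x = x) \<longleftrightarrow> \<chi> a = \<one>"
proof
  assume "\<chi> a = \<one>"
  then have "a mod m \<in> H" using a by (simp add: H_def mod_in_U chi_mod)
  then show "\<forall>x\<in>K. sig a x = x" by (metis K_sig_H sig_mod)
next
  assume fx: "\<forall>x\<in>K. sig a x = x"
  have Bk: "B k = (\<Sum>h\<in>H. 1 * zeta m ^ (h * k))" for k
    unfolding B_def using Tr_zeta_power[of m 1 k] by (simp add: L_1 sig_1 H_coprime)
  have "sig a (zeta m ^ (h * k)) = zeta m ^ (a * h * k)" for h k
    using a by (simp add: sig_power L_zeta sig_zeta power_mult[symmetric] mult.assoc)
  then have "sig a (B k) = (\<Sum>h\<in>H. zeta m ^ (a * h * k))" for k
    using a by (simp add: Bk sig_sum L_power L_zeta)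
  then have eq: "(\<Sum>h\<in>H. zeta m ^ (a * h * k)) = (\<Sum>h\<in>H. 1 * zeta m ^ (h * k))" for k
    using fx B_K[of k] Bk[of k] by metis
  have "of_nat m * (\<Sum>h | h \<in> H \<and> [a * h = 1] (mod m). 1 :: complex)
      = (\<Sum>k<m. inverse (zeta m) ^ k * (\<Sum>h\<in>H. 1 * zeta m ^ (a * h * k)))"
    by (rule fourier_extract[symmetric]) (use m_pos finite_H in auto)
  also have "\<dots> = (\<Sum>k<m. inverse (zeta m) ^ k * (\<Sum>h\<in>H. 1 * zeta m ^ (h * k)))"
    by (simp add: eq[simplified])
  also have "\<dots> = of_nat m * (\<Sum>h | h \<in> H \<and> [h = 1] (mod m). 1)"
    by (rule fourier_extract) (use m_pos finite_H in auto)
  finally have "card {h. h \<in> H \<and> [a * h = 1] (mod m)} = card {h. h \<in> H \<and> [h = 1] (mod m)}"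
    using m_pos by simp
  moreover have "1 mod m \<in> {h. h \<in> H \<and> [h = 1] (mod m)}" using one_mod_in_H by (simp add: cong_def)
  then have "card {h. h \<in> H \<and> [h = 1] (mod m)} > 0" using finite_H card_gt_0_iff by fastforce
  ultimately have "{h. h \<in> H \<and> [a * h = 1] (mod m)} \<noteq> {}" by (metis card.empty less_irrefl)
  then obtain h where h: "h \<in> H" "[a * h = 1] (mod m)" by blast
  then have "\<chi> (a * h) = \<one>" using chi_cong chi_1 by metis
  then show "\<chi> a = \<one>" using h(1) a chi_closed[OF a] by (simp add: chi_mult H_coprime) (simp add: H_def)
qed

lemma sig_eq_on_K_iff:
  assumes a: "coprime a m" and b: "coprime b m"
  shows "(\<forall>x\<in>K. sig a x = sig b x) \<longleftrightarrow> \<chi> a = \<chi> b"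
proof -
  obtain c where c: "coprime c m" "[b * c = 1] (mod m)" using inverse_mod[OF b] by blast
  have 1: "sig (c * b) x = x" if "x \<in> K" for x
    using sig_cong[of "c * b" 1 x] c sig_1_eq K_L that by (simp add: mult.commute)
  have 2: "sig (b * c) x = x" if "x \<in> K" for x
    using 1 that by (simp add: mult.commute)
  have "(\<forall>x\<in>K. sig a x = sig b x) \<longleftrightarrow> (\<forall>x\<in>K. sig (c * a) x = x)"
  proof (intro iffI ballI)
    fix x assume "\<forall>x\<in>K. sig a x = sig b x" "x \<in> K"
    then have "sig c (sig a x) = sig c (sig b x)" by simp
    then show "sig (c * a) x = x" using a b c 1 \<open>x \<in> K\<close> K_L by (simp add: sig_sig)
  next
    fix x assume "\<forall>x\<in>K. sig (c * a) x = x" "x \<in> K"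
    then have "sig b (sig c (sig a x)) = sig b x" using a b c K_L by (simp add: sig_sig)
    then show "sig a x = sig b x" using a b c 2 \<open>x \<in> K\<close> K_L sig_K[OF a] sig_sig sig_in_L by metis
  qed
  also have "\<dots> \<longleftrightarrow> \<chi> (c * a) = \<one>" by (rule sig_fixes_K_iff) (use a c in simp)
  also have "\<dots> \<longleftrightarrow> \<chi> a = \<chi> b"
  proof -
    have "\<chi> (b * c) = \<one>" using chi_cong[OF c(2)] chi_1 by simp
    then have "\<chi> b \<otimes> \<chi> c = \<one>" using b c by (simp add: chi_mult)
    then have "inv (\<chi> b) = \<chi> c" using b c chi_closed by (metis inv_equality m_comm)
    then have "\<chi> (c * a) = inv (\<chi> b) \<otimes> \<chi> a" using a c by (simp add: chi_mult)
    then show ?thesis using a b chi_closed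
      by (metis inv_closed inv_equality inv_inv l_inv)
  qed
  finally show ?thesis .
qed

text \<open>For a single \<open>x\<close> the value \<open>\<tau> x\<close> is a root of the
  rational polynomial with roots \<open>sig a x\<close>, so some \<open>a\<close> works, depending
  on \<open>x\<close>. To get one \<open>a\<close> for all \<open>x\<close>, this is applied to
  infinitely many combinations of the spanning traces.\<close>

lemma embedding_is_sig:
  assumes \<tau>: "\<tau> \<in> embeddings K"
  shows "\<exists>a\<in>U. \<forall>x\<in>K. \<tau> x = sig a x"
proof -
  have \<tau>1: "\<tau> 1 = 1" and add: "\<And>x y. x \<in> K \<Longrightarrow> y \<in> K \<Longrightarrow> \<tau> (x + y) = \<tau> x + \<tau> y"
    and mul: "\<And>x y. x \<in> K \<Longrightarrow> y \<in> K \<Longrightarrow> \<tau> (x * y) = \<tau> x * \<tau> y"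
    using \<tau> by (auto simp: embeddings_def)
  have \<tau>0: "\<tau> 0 = 0" using add[OF K_0 K_0] by simp
  have nat: "\<tau> (of_nat n) = of_nat n" for n
    by (induction n) (simp_all add: \<tau>0 \<tau>1 add K_of_nat K_1)
  have int: "\<tau> (of_int k) = of_int k" for k
  proof (cases "k \<ge> 0")
    case True
    then show ?thesis using nat[of "nat k"] by simp
  next
    case False
    have "\<tau> (of_int k + of_nat (nat (- k))) = \<tau> (of_int k) + of_nat (nat (- k))"
      using nat by (simp add: add K_of_int K_of_nat)
    then show ?thesis using False \<tau>0 by simp
  qed
  have rat: "\<tau> (of_rat q) = of_rat q" for q
  proof -
    obtain u v where uv: "q = of_int u / of_int v" "v > 0"
      by (metis Fract_of_int_quotient quotient_of_denom_pos quotient_of_unique Rat_cases)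
    have "\<tau> (of_rat q) * \<tau> (of_int v) = \<tau> (of_rat q * of_int v)" by (simp add: mul K_of_rat K_of_int)
    also have "of_rat q * of_int v = (of_int u :: complex)" using uv by (simp add: of_rat_divide)
    finally have "\<tau> (of_rat q) * of_int v = (of_int u :: complex)" by (simp only: int)
    moreover have "of_rat q * of_int v = (of_int u :: complex)" using uv by (simp add: of_rat_divide)
    ultimately show ?thesis using uv(2)
      by (metis mult_right_cancel of_int_eq_0_iff less_irrefl)
  qed
  have sum: "\<tau> (sum f A) = (\<Sum>i\<in>A. \<tau> (f i))" if "\<And>i. i \<in> A \<Longrightarrow> f i \<in> K" for f and A :: "nat set"
    using that by (induction A rule: infinite_finite_induct) (simp_all add: \<tau>0 add K_sum)
  have pow: "\<tau> (x ^ k) = \<tau> x ^ k" if "x \<in> K" for x k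
    by (induction k) (simp_all add: \<tau>1 mul K_power that)
  have conj: "\<exists>a\<in>U. \<tau> x = sig a x" if x: "x \<in> K" for x
  proof -
    define P where "P = (\<Prod>a\<in>U. [:- sig a x, 1:])"
    have xL: "sig a x \<in> L" if "a \<in> U" for a using x that by (simp add: sig_in_L U_coprime K_L)
    have co: "coeff P i \<in> L"
      "\<And>b. coprime b m \<Longrightarrow> sig b (coeff P i) = coeff (\<Prod>a\<in>U. [:- sig b (sig a x), 1:]) i" for i
      using coeff_prod_linear_L[of U "\<lambda>a. sig a x" i] xL unfolding P_def by auto
    have "coeff P i \<in> \<rat>" for i
    proof (rule fixed_imp_rational[OF co(1)])
      fix b assume b: "b \<in> U"
      have "(\<Prod>a\<in>U. [:- sig b (sig a x), 1:]) = (\<Prod>a\<in>U. [:- sig (b * a mod m) x, 1:])"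
        using b x by (intro prod.cong refl) (simp add: sig_sig sig_mod U_coprime K_L)
      also have "\<dots> = P" unfolding P_def
        by (rule prod.reindex_bij_betw[OF bij_betw_mult_mod_U]) (use b U_coprime in blast)
      finally show "sig b (coeff P i) = coeff P i" using co(2) b U_coprime by simp
    qed
    then have "\<exists>q. coeff P i = of_rat q" for i by (metis Rats_cases)
    then obtain c where c: "\<And>i. coeff P i = of_rat (c i)" by metis
    have "poly P x = 0"
    proof -
      have "sig (1 mod m) x = x" using x by (simp add: sig_mod sig_1_eq K_L del: One_nat_def)
      then show ?thesis unfolding P_def poly_prod
        using mod_in_U[of 1] by (intro prod_zero) (auto intro!: bexI[of _ "1 mod m"])
    qed
    have "0 = \<tau> (poly P x)" using \<open>poly P x = 0\<close> \<tau>0 by simp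
    also have "\<dots> = (\<Sum>i\<le>degree P. of_rat (c i) * \<tau> x ^ i)"
      using x by (simp add: poly_altdef c sum mul pow rat K_mult K_of_rat K_power)
    also have "\<dots> = poly P (\<tau> x)" by (simp add: poly_altdef c)
    also have "\<dots> = (\<Prod>a\<in>U. \<tau> x - sig a x)" by (simp add: P_def poly_prod)
    finally show ?thesis by (auto simp: eq_commute[of 0])
  qed
  \<comment> \<open>\<open>U\<close> is finite, so one \<open>a\<close> serves infinitely many
    \<open>c\<close>. The difference of the two sides is then a polynomial in \<open>c\<close> with
    infinitely many zeros, and all its coefficients vanish.\<close>
  define X where "X c = (\<Sum>k<m. of_nat c ^ k * B k)" for c :: nat
  have XK: "X c \<in> K" for c unfolding X_def
    by (intro K_sum K_mult K_power K_of_nat B_K)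
  have "\<forall>c. \<exists>a. a \<in> U \<and> \<tau> (X c) = sig a (X c)" using conj XK by blast
  then obtain g where g: "\<And>c. g c \<in> U" "\<And>c. \<tau> (X c) = sig (g c) (X c)" by metis
  have "finite (range g)" using g(1) finite_subset[of "range g" U] by auto
  then obtain c0 where inf: "infinite {c. g c = g c0}"
    using pigeonhole_infinite[of "UNIV :: nat set" g] by auto
  define a where "a = g c0"
  have a: "a \<in> U" using g by (simp add: a_def)
  have "{c. g c = g c0} \<subseteq> {c. (\<Sum>k<m. of_nat c ^ k * (\<tau> (B k) - sig a (B k))) = 0}"
  proof
    fix c assume "c \<in> {c. g c = g c0}"
    then have "\<tau> (X c) = sig a (X c)" using g a_def by auto
    moreover have "\<tau> (X c) = (\<Sum>k<m. of_nat c ^ k * \<tau> (B k))"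
      unfolding X_def by (simp add: sum mul pow nat K_mult K_power K_of_nat B_K)
    moreover have "sig a (X c) = (\<Sum>k<m. of_nat c ^ k * sig a (B k))"
      unfolding X_def using a
      by (simp add: sig_sum sig_mult sig_power sig_of_nat U_coprime L_mult L_power L_of_nat B_K K_L)
    ultimately show "c \<in> {c. (\<Sum>k<m. of_nat c ^ k * (\<tau> (B k) - sig a (B k))) = 0}"
      by (simp add: algebra_simps sum_subtractf)
  qed
  then have "infinite {c. (\<Sum>k<m. of_nat c ^ k * (\<tau> (B k) - sig a (B k))) = 0}"
    using inf finite_subset by blast
  then have "\<tau> (B k) = sig a (B k)" if "k < m" for k
    using Sum_polynomial_eq_0[OF _ that, of "\<lambda>k. \<tau> (B k) - sig a (B k)"] by simp
  then have B: "\<tau> (B k) = sig a (B k)" for k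
    using m_pos by (metis B_mod mod_less_divisor)
  have "\<tau> x = sig a x" if "x \<in> K" for x
  proof -
    obtain n c where x: "x = (\<Sum>i\<le>n. of_rat (c i) * B i)" using K_expand[OF \<open>x \<in> K\<close>] by blast
    have "\<tau> x = (\<Sum>i\<le>n. of_rat (c i) * \<tau> (B i))"
      unfolding x by (simp add: sum mul rat K_mult K_of_rat B_K)
    moreover have "sig a x = (\<Sum>i\<le>n. of_rat (c i) * sig a (B i))"
      unfolding x using a by (simp add: sig_sum sig_mult sig_of_rat U_coprime L_mult L_of_rat B_K K_L)
    ultimately show ?thesis by (simp add: B)
  qed
  then show ?thesis using a by blast
qed

lemma K_galois: "galois_over_Q K"
  unfolding galois_over_Q_def
  using K_number_field embedding_is_sig sig_K U_coprime by (metis image_subsetI)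

text \<open>The extension by the identity is the normalization in \<open>auts\<close>, where an
  automorphism is a function on all complex numbers.\<close>

definition aut :: "nat \<Rightarrow> complex \<Rightarrow> complex" where
  "aut a x = (if x \<in> K then sig a x else x)"

lemma aut_in_auts:
  assumes a: "coprime a m" shows "aut a \<in> auts K"
proof -
  obtain b where b: "coprime b m" "[a * b = 1] (mod m)" using inverse_mod[OF a] by blast
  have ab: "sig a (sig b x) = x" "sig b (sig a x) = x" if "x \<in> K" for x
    using a b that sig_cong[OF b(2)] sig_1_eq[of x] K_L[OF that]
    by (simp_all add: sig_sig mult.commute)
  have inj: "inj_on (aut a) K"
    by (rule inj_onI) (metis aut_def ab(2))
  have "aut a ` K = K"
  proof
    show "aut a ` K \<subseteq> K" using a by (auto simp: aut_def sig_K)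
    show "K \<subseteq> aut a ` K"
    proof
      fix x assume "x \<in> K"
      then have "x = aut a (sig b x)" "sig b x \<in> K" using ab b by (auto simp: aut_def sig_K)
      then show "x \<in> aut a ` K" by blast
    qed
  qed
  with inj have "bij_betw (aut a) K K" by (simp add: bij_betw_def)
  moreover have "aut a \<in> embeddings K"
    unfolding embeddings_def using inj a
    by (auto simp: aut_def K_1 K_add K_mult sig_1 sig_add sig_mult K_L)
  ultimately show ?thesis by (auto simp: auts_def aut_def)
qed

lemma auts_eq: "auts K = aut ` {a. coprime a m}"
proof (intro equalityI subsetI)
  fix \<tau> assume \<tau>: "\<tau> \<in> auts K"
  then obtain a where a: "a \<in> U" "\<forall>x\<in>K. \<tau> x = sig a x"
    using embedding_is_sig unfolding auts_def by blast
  then have "\<tau> = aut a" using \<tau> by (auto simp: auts_def aut_def)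
  then show "\<tau> \<in> aut ` {a. coprime a m}" using a U_coprime by blast
qed (use aut_in_auts in blast)

lemma aut_eq_iff: "coprime a m \<Longrightarrow> coprime b m \<Longrightarrow> aut a = aut b \<longleftrightarrow> \<chi> a = \<chi> b"
  unfolding sig_eq_on_K_iff[symmetric] by (auto simp: aut_def fun_eq_iff)

lemma aut_comp:
  assumes "coprime a m" "coprime b m" shows "aut a \<circ> aut b = aut (a * b)"
  using assms by (auto simp: aut_def fun_eq_iff sig_K sig_sig K_L)

text \<open>By \<open>aut_eq_iff\<close> the value does not depend on the chosen
  \<open>a\<close>.\<close>

definition \<phi> :: "(complex \<Rightarrow> complex) \<Rightarrow> 'a" where
  "\<phi> \<tau> = \<chi> (SOME a. coprime a m \<and> \<tau> = aut a)"

lemma phi_aut: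
  assumes "coprime a m" shows "\<phi> (aut a) = \<chi> a"
proof -
  let ?b = "SOME b. coprime b m \<and> aut a = aut b"
  have "coprime ?b m \<and> aut a = aut ?b" by (rule someI[of _ a]) (use assms in simp)
  then show ?thesis using assms aut_eq_iff by (auto simp: \<phi>_def)
qed

lemma phi_iso: "\<phi> \<in> iso (galois_group K) G"
proof -
  have "\<phi> \<in> hom (galois_group K) G"
    unfolding hom_def galois_group_def
    by (auto simp: auts_eq phi_aut chi_closed aut_comp chi_mult)
  moreover have "inj_on \<phi> (auts K)"
    unfolding auts_eq by (rule inj_onI) (auto simp: phi_aut aut_eq_iff)
  moreover have "\<phi> ` auts K = carrier G"
  proof
    show "\<phi> ` auts K \<subseteq> carrier G" by (auto simp: auts_eq phi_aut chi_closed)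
    show "carrier G \<subseteq> \<phi> ` auts K"
    proof
      fix g assume "g \<in> carrier G"
      then obtain a where a: "coprime a m" "\<chi> a = g" using chi_surj by blast
      then have "g = \<phi> (aut a)" "aut a \<in> auts K" by (simp_all add: phi_aut aut_in_auts)
      then show "g \<in> \<phi> ` auts K" by blast
    qed
  qed
  ultimately show ?thesis by (simp add: iso_def bij_betw_def galois_group_def)
qed

end

section \<open>Inertia, decomposition and ramification\<close>

text \<open>The factor theorem modulo \<open>M\<close>, one zero of \<open>S\<close> at a time by
  synthetic division. As the degree is at most \<open>card S\<close>, what remains is a constant,
  the coefficient at \<open>card S\<close>.\<close>

lemma Zprime_interpolation:
  assumes M: "Zprime M" and S: "finite S" and SI: "\<And>r. r \<in> S \<Longrightarrow> algebraic_int r"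
    and inc: "\<And>r s. r \<in> S \<Longrightarrow> s \<in> S \<Longrightarrow> r \<noteq> s \<Longrightarrow> r - s \<notin> M"
    and f: "\<And>i. algebraic_int (coeff f i)" "degree f \<le> card S" "\<And>r. r \<in> S \<Longrightarrow> poly f r \<in> M"
    and x: "algebraic_int x"
  shows "poly f x - coeff f (card S) * (\<Prod>r\<in>S. x - r) \<in> M"
  using S SI inc f
proof (induction S arbitrary: f rule: finite_induct)
  case empty
  then obtain c where "f = [:c:]" by (auto elim: degree_eq_zeroE)
  then show ?case using Zprime_0[OF M] by simp
next
  case (insert r S)
  define g where "g = synthetic_div f r"
  have fg: "f = [:- r, 1:] * g + [:poly f r:]" by (simp only: g_def synthetic_div_correct')
  have ri: "algebraic_int r" using insert by simp
  have coeffs: "algebraic_int (coeff (synthetic_div h r) i)" if "\<And>i. algebraic_int (coeff h i)" for h i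
    using that
  proof (induction h arbitrary: i)
    case (pCons a h)
    have h: "algebraic_int (coeff h i)" for i using pCons.prems[of "Suc i"] by simp
    then show ?case using pCons.IH[OF h] algebraic_int_poly[OF h ri]
      by (auto simp: coeff_pCons split: nat.splits)
  qed simp
  have gi: "algebraic_int (coeff g i)" for i unfolding g_def using coeffs insert.prems by blast
  have dg: "degree g \<le> card S"
    using insert.prems(4) insert.hyps by (simp add: g_def degree_synthetic_div)
  have pf: "poly f y = (y - r) * poly g y + poly f r" for y
    using arg_cong[OF fg, of "\<lambda>q. poly q y"] by (simp add: algebra_simps)
  have pgM: "poly g s \<in> M" if s: "s \<in> S" for s
  proof -
    have "(s - r) * poly g s = poly f s - poly f r" using pf[of s] by simp
    also have "\<dots> \<in> M" using insert.prems(5) s by (intro Zprime_diff M) auto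
    finally have "(s - r) * poly g s \<in> M" .
    moreover have "s - r \<notin> M" using insert s by auto
    moreover have "algebraic_int (poly g s)" "algebraic_int (s - r)"
      using gi insert.prems(1) s ri by (auto intro!: algebraic_int_poly algebraic_int_closed)
    ultimately show ?thesis using Zprime_mult_iff[OF M] by blast
  qed
  have "poly g x - coeff g (card S) * (\<Prod>r\<in>S. x - r) \<in> M"
    using insert.prems gi dg pgM by (intro insert.IH) auto
  then have "(x - r) * (poly g x - coeff g (card S) * (\<Prod>r\<in>S. x - r)) + poly f r \<in> M"
    using insert.prems x ri by (intro Zprime_add[OF M] Zprime_mult[OF M] algebraic_int_closed) auto
  moreover have "coeff f (card (insert r S)) = coeff g (card S)"
  proof -
    have "coeff g (Suc (card S)) = 0" using dg by (simp add: coeff_eq_0)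
    then show ?thesis using insert.hyps by (subst fg) (simp add: coeff_pCons)
  qed
  moreover have "(x - r) * (poly g x - c * P) + poly f r = poly f x - c * ((x - r) * P)" for c P
    using pf[of x] by (simp add: algebra_simps)
  ultimately show ?case using insert.hyps by simp
qed

text \<open>Modulo \<open>M\<close>, \<open>x ^ p - x\<close> is the product of the
  \<open>x - n\<close> for \<open>n < p\<close>, so one of these factors lies in
  \<open>M\<close>.\<close>

lemma Zprime_congruent_integer:
  assumes M: "Zprime M" and p: "prime p" "of_nat p \<in> M"
    and x: "algebraic_int x" "x ^ p - x \<in> M"
  obtains n :: nat where "x - of_nat n \<in> M"
proof -
  define S where "S = (of_nat :: nat \<Rightarrow> complex) ` {..<p}"
  let ?f = "monom 1 p - monom 1 1 :: complex poly"
  have p2: "p \<ge> 2" using p prime_ge_2_nat by blast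
  have cardS: "card S = p" by (simp add: S_def card_image inj_on_def)
  have "poly ?f x - coeff ?f (card S) * (\<Prod>r\<in>S. x - r) \<in> M"
  proof (rule Zprime_interpolation[OF M])
    show "finite S" by (simp add: S_def)
    show "algebraic_int r" if "r \<in> S" for r using that by (auto simp: S_def algebraic_int_closed)
    show "r - s \<notin> M" if rs: "r \<in> S" "s \<in> S" "r \<noteq> s" for r s
    proof -
      obtain i j where ij: "i < p" "j < p" "r = of_nat i" "s = of_nat j" using rs by (auto simp: S_def)
      then have "int i - int j \<noteq> 0" using rs(3) by auto
      then have "\<not> int p dvd int i - int j" using ij dvd_imp_le_int[of "int i - int j" "int p"] by linarith
      then show ?thesis using Zprime_of_int_iff[OF M p, of "int i - int j"] ij by simp
    qed
    show "algebraic_int (coeff ?f i)" for i by (auto simp: algebraic_int_closed)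
    show "degree ?f \<le> card S" unfolding cardS using p2
      by (intro degree_diff_le) (auto simp: degree_monom_eq)
    show "poly ?f r \<in> M" if r: "r \<in> S" for r
    proof -
      obtain j where "r = of_nat j" using r by (auto simp: S_def)
      moreover have "of_int (int j) ^ p - of_int (int j) \<in> M"
        by (rule Zprime_zdvd[OF M p(2) zdvd_fermat[OF p(1)]])
      ultimately show ?thesis by (simp add: poly_monom)
    qed
  qed (rule x)
  moreover have "coeff ?f (card S) = 1" using p2 by (simp add: cardS)
  moreover have "poly ?f x = x ^ p - x" by (simp add: poly_monom)
  ultimately have "(x ^ p - x) - (\<Prod>r\<in>S. x - r) \<in> M" by (simp only: mult_1)
  then have "(\<Prod>r\<in>S. x - r) \<in> M" using Zprime_cong_iff[OF M] x(2) by blast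
  then have "\<exists>r\<in>S. x - r \<in> M"
    by (rule Zprime_prod_mem[OF M]) (use x(1) in \<open>auto simp: S_def algebraic_int_closed\<close>)
  then obtain r where "r \<in> S" "x - r \<in> M" by blast
  then show thesis using that by (auto simp: S_def)
qed

lemma Zprime_over_prime:
  assumes "prime p"
  obtains M where "Zprime M" "of_nat p \<in> M"
proof -
  let ?I = "{x. of_nat p zdvd x}"
  have "Zideal ?I" unfolding Zideal_def
    by (auto intro: zdvd_add zdvd_mult2 zdvd_algebraic_int[of "of_nat p"] algebraic_int_closed)
  moreover have "1 \<notin> ?I" using of_nat_zdvd_iff[of p 1] assms by auto
  ultimately obtain M where M: "Zprime M" "?I \<subseteq> M" by (rule Zprime_exists)
  have "of_nat p \<in> ?I" by simp
  then show thesis using that M by blast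
qed

section \<open>The ring of integers of a number field and powers of its primes\<close>

lemma mem_ring_of_integers: "x \<in> ring_of_integers K \<longleftrightarrow> x \<in> K \<and> algebraic_int x"
  by (simp add: ring_of_integers_def algebraic_integer_iff)

lemma OK_ring_simps [simp]:
  "carrier (OK_ring K) = ring_of_integers K" "x \<otimes>\<^bsub>OK_ring K\<^esub> y = x * y" "\<one>\<^bsub>OK_ring K\<^esub> = 1"
  "x \<oplus>\<^bsub>OK_ring K\<^esub> y = x + y" "\<zero>\<^bsub>OK_ring K\<^esub> = 0"
  by (simp_all add: OK_ring_def)

lemma OK_cring:
  assumes "is_subfield K"
  shows "cring (OK_ring K)"
proof -
  have K: "0 \<in> K" "1 \<in> K" "\<And>x y. x \<in> K \<Longrightarrow> y \<in> K \<Longrightarrow> x + y \<in> K"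
    "\<And>x y. x \<in> K \<Longrightarrow> y \<in> K \<Longrightarrow> x - y \<in> K" "\<And>x y. x \<in> K \<Longrightarrow> y \<in> K \<Longrightarrow> x * y \<in> K"
    using assms by (auto simp: is_subfield_def)
  have neg: "- x \<in> K" if "x \<in> K" for x using K(4)[OF K(1) that] by simp
  show ?thesis
  proof (rule cringI)
    show "abelian_group (OK_ring K)"
      by (rule abelian_groupI)
        (auto simp: mem_ring_of_integers K algebraic_int_add algebra_simps
          intro!: bexI[of _ "- _"] neg)
    show "comm_monoid (OK_ring K)"
      by (rule comm_monoidI) (auto simp: mem_ring_of_integers K algebraic_int_mult algebraic_int_closed)
  qed (auto simp: algebra_simps)
qed

lemma primeideal_contraction:
  assumes K: "is_subfield K" and M: "Zprime M"
  shows "primeideal (M \<inter> ring_of_integers K) (OK_ring K)"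
proof -
  interpret cring "OK_ring K" by (rule OK_cring[OF K])
  have mem: "x + y \<in> ring_of_integers K" "x * y \<in> ring_of_integers K" "- x \<in> ring_of_integers K"
    if "x \<in> ring_of_integers K" "y \<in> ring_of_integers K" for x y
    using that add.m_closed[of x y] m_closed[of x y] K
    by (auto simp: mem_ring_of_integers is_subfield_def)
  have OI: "algebraic_int x" if "x \<in> ring_of_integers K" for x
    using that by (simp add: mem_ring_of_integers)
  show ?thesis
  proof (rule primeidealI2)
    have inv: "\<ominus>\<^bsub>OK_ring K\<^esub> x = - x" if "x \<in> ring_of_integers K" for x
      using that mem minus_equality[of "- x" x] by simp
    have zero: "0 \<in> ring_of_integers K" using zero_closed by simp
    show "additive_subgroup (M \<inter> ring_of_integers K) (OK_ring K)"
    proof (rule additive_subgroup.intro, rule subgroup.intro)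
      fix x assume x: "x \<in> M \<inter> ring_of_integers K"
      have "\<ominus>\<^bsub>OK_ring K\<^esub> x \<in> M \<inter> ring_of_integers K"
        using x mem(3)[of x x] by (simp add: inv Zprime_minus[OF M])
      then show "inv\<^bsub>add_monoid (OK_ring K)\<^esub> x \<in> M \<inter> ring_of_integers K"
        by (simp only: a_inv_def)
    qed (auto simp: mem zero Zprime_0[OF M] Zprime_add[OF M])
    show "carrier (OK_ring K) \<noteq> M \<inter> ring_of_integers K"
      using Zprime_1[OF M] one_closed by (metis IntD1 OK_ring_simps(1,3))
  qed (use Zprime_mult_iff[OF M] Zprime_mult[OF M] Zprime_mult2[OF M] OI mem OK_cring[OF K] in auto)
qed

lemma primes_overD:
  assumes "P \<in> primes_over K q"
  shows "P \<subseteq> ring_of_integers K" "of_nat q \<in> P" "1 \<notin> P"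
    "x \<in> P \<Longrightarrow> y \<in> P \<Longrightarrow> x + y \<in> P"
    "x \<in> P \<Longrightarrow> c \<in> ring_of_integers K \<Longrightarrow> c * x \<in> P"
    "x \<in> ring_of_integers K \<Longrightarrow> y \<in> ring_of_integers K \<Longrightarrow> x * y \<in> P \<Longrightarrow> x \<in> P \<or> y \<in> P" "0 \<in> P"
proof -
  from assms interpret primeideal P "OK_ring K" by (simp add: primes_over_def)
  show "P \<subseteq> ring_of_integers K" using a_subset by simp
  show "of_nat q \<in> P" using assms by (simp add: primes_over_def)
  show "0 \<in> P" using additive_subgroup.zero_closed[OF is_additive_subgroup] by simp
  show "1 \<notin> P" using one_imp_carrier I_notcarr by auto
  show "x \<in> P \<Longrightarrow> y \<in> P \<Longrightarrow> x + y \<in> P" using additive_subgroup.a_closed[OF is_additive_subgroup] by simp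
  show "x \<in> P \<Longrightarrow> c \<in> ring_of_integers K \<Longrightarrow> c * x \<in> P" using I_l_closed by simp
  show "x \<in> ring_of_integers K \<Longrightarrow> y \<in> ring_of_integers K \<Longrightarrow> x * y \<in> P \<Longrightarrow> x \<in> P \<or> y \<in> P"
    using I_prime by simp
qed

lemma add_span_base: "x \<in> S \<Longrightarrow> x \<in> add_span S"
  unfolding add_span_def by (intro CollectI exI[of _ 1] exI[of _ "\<lambda>_. x"]) simp

lemma add_span_mono: "S \<subseteq> T \<Longrightarrow> add_span S \<subseteq> add_span T"
  unfolding add_span_def by blast

lemma ideal_pow_Suc_mono:
  assumes P: "P \<in> primes_over K q" and K: "is_subfield K"
  shows "ideal_pow K P (Suc k) \<subseteq> ideal_pow K P k"
proof -
  interpret cring "OK_ring K" by (rule OK_cring[OF K])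
  have O: "x + y \<in> ring_of_integers K" "x * y \<in> ring_of_integers K"
    if "x \<in> ring_of_integers K" "y \<in> ring_of_integers K" for x y
    using that add.m_closed[of x y] m_closed[of x y] by simp_all
  have O0: "0 \<in> ring_of_integers K" using zero_closed by simp
  show ?thesis
  proof (induction k)
    case 0
    have "(\<Sum>i<n. f i) \<in> ring_of_integers K"
      if "\<forall>i<n. f i \<in> {a * b |a b. a \<in> P \<and> b \<in> ring_of_integers K}" for n :: nat and f
      using that
    proof (induction n)
      case (Suc n)
      then have "(\<Sum>i<n. f i) \<in> ring_of_integers K" "f n \<in> {a * b |a b. a \<in> P \<and> b \<in> ring_of_integers K}" by auto
      then show ?case using O primes_overD(1)[OF P] by auto
    qed (simp add: O0)
    then show ?case by (auto simp: add_span_def)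
  next
    case (Suc k)
    have "{a * b |a b. a \<in> P \<and> b \<in> ideal_pow K P (Suc k)} \<subseteq> {a * b |a b. a \<in> P \<and> b \<in> ideal_pow K P k}"
      using Suc by blast
    then show ?case unfolding ideal_pow.simps(2)[of K P "Suc k"] ideal_pow.simps(2)[of K P k]
      by (rule add_span_mono)
  qed
qed

lemma ideal_pow_antimono:
  assumes "P \<in> primes_over K q" "is_subfield K" "j \<le> k"
  shows "ideal_pow K P k \<subseteq> ideal_pow K P j"
  using assms(3) by (induction k rule: dec_induct) (use ideal_pow_Suc_mono[OF assms(1,2)] in blast)+

text \<open>Elements of \<open>P\<^sup>k\<close> become divisible by \<open>w\<^sup>k\<close> after multiplication by a number congruent to 1
  modulo \<open>P\<close>: the factor \<open>1 - a\<^bsup>Q-1\<^esup>\<close> kills \<open>a \<in> P\<close> modulo \<open>w\<close>.\<close>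

lemma ideal_pow_multiplier:
  assumes P: "P \<in> primes_over K q" and K: "is_subfield K"
    and w: "\<And>a. a \<in> ring_of_integers K \<Longrightarrow> w zdvd a ^ Q - a" and Q: "Q \<ge> 2"
    and z: "z \<in> ideal_pow K P k"
  shows "\<exists>c\<in>ring_of_integers K. c - 1 \<in> P \<and> w ^ k zdvd c * z"
  using z
proof (induction k arbitrary: z)
  interpret cring "OK_ring K" by (rule OK_cring[OF K])
  {
    case 0
    then have "algebraic_int z" by (simp add: mem_ring_of_integers)
    moreover have "0 \<in> P" by (rule primes_overD(7)[OF P])
    ultimately show ?case using one_closed by (intro bexI[of _ 1]) (auto simp: zdvd_def)
  next
    case (Suc k)
    have OI: "algebraic_int x" if "x \<in> ring_of_integers K" for x
      using that by (simp add: mem_ring_of_integers)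
    have OP: "x \<in> ring_of_integers K" if "x \<in> P" for x using that primes_overD(1)[OF P] by blast
    have O1: "1 \<in> ring_of_integers K" and O_mult: "\<And>x y. x \<in> ring_of_integers K \<Longrightarrow> y \<in> ring_of_integers K \<Longrightarrow> x * y \<in> ring_of_integers K"
      using one_closed m_closed by simp_all
    have O_pow: "x ^ j \<in> ring_of_integers K" if "x \<in> ring_of_integers K" for x j
      using that by (induction j) (auto intro: O1 O_mult)
    have O_neg: "- x \<in> ring_of_integers K" if "x \<in> ring_of_integers K" for x
      using that K by (auto simp: mem_ring_of_integers is_subfield_def)
    have P_neg: "- x \<in> P" if "x \<in> P" for x
      using primes_overD(5)[OF P that O_neg[OF O1]] by simp
    have O_add: "\<And>x y. x \<in> ring_of_integers K \<Longrightarrow> y \<in> ring_of_integers K \<Longrightarrow> x + y \<in> ring_of_integers K"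
      using add.m_closed by simp
    obtain n f where f: "z = (\<Sum>i<n. f i)" "\<forall>i<(n::nat). f i \<in> {a * b |a b. a \<in> P \<and> b \<in> ideal_pow K P k}"
      using Suc.prems unfolding ideal_pow.simps add_span_def by blast
    have "\<exists>c\<in>ring_of_integers K. c - 1 \<in> P \<and> w ^ Suc k zdvd c * y"
      if y: "y \<in> {a * b |a b. a \<in> P \<and> b \<in> ideal_pow K P k}" for y
    proof -
      obtain a b where ab: "y = a * b" "a \<in> P" "b \<in> ideal_pow K P k" using y by blast
      obtain c where c: "c \<in> ring_of_integers K" "c - 1 \<in> P" "w ^ k zdvd c * b"
        using Suc.IH[OF ab(3)] by blast
      let ?e = "1 - a ^ (Q - 1)"
      have aP: "a ^ (Q - 1) \<in> P"
      proof -
        have "a ^ (Q - 1) = a ^ (Q - 2) * a" using Q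
          by (metis Suc_1 Suc_diff_Suc Suc_le_lessD diff_Suc_1' power_Suc2 One_nat_def)
        then show ?thesis using primes_overD(5)[OF P ab(2) O_pow[OF OP[OF ab(2)]]] by simp
      qed
      have e: "?e \<in> ring_of_integers K"
        using O_add[OF O1 O_neg[OF OP[OF aP]]] by simp
      have "c * ?e - 1 = - (a ^ (Q - 1)) * c + (c - 1)" by (simp add: algebra_simps)
      also have "\<dots> \<in> P"
        using primes_overD(4)[OF P primes_overD(5)[OF P P_neg[OF aP] c(1)] c(2)] by (simp add: mult.commute)
      finally have 1: "c * ?e - 1 \<in> P" .
      have "?e * a = - (a ^ Q - a)" using Q by (cases Q) (auto simp: algebra_simps)
      then have "w zdvd ?e * a" using zdvd_minus[OF w[OF OP[OF ab(2)]]] by simp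
      from zdvd_mono[OF this c(3)] have "w ^ Suc k zdvd (c * ?e) * y"
        by (simp add: ab(1) mult_ac)
      then show ?thesis using 1 O_mult[OF c(1) e] by blast
    qed
    then have "\<forall>i. \<exists>c. i < n \<longrightarrow> c \<in> ring_of_integers K \<and> c - 1 \<in> P \<and> w ^ Suc k zdvd c * f i"
      using f(2) by blast
    then obtain c where c: "\<And>i. i < n \<Longrightarrow> c i \<in> ring_of_integers K"
      "\<And>i. i < n \<Longrightarrow> c i - 1 \<in> P" "\<And>i. i < n \<Longrightarrow> w ^ Suc k zdvd c i * f i" by metis
    \<comment> \<open>A sum is handled by the product of the multipliers of its terms, which is
      still congruent to 1 modulo \<open>P\<close>.\<close>
    have "j \<le> n \<Longrightarrow> \<exists>d\<in>ring_of_integers K. d - 1 \<in> P \<and> w ^ Suc k zdvd d * (\<Sum>i<j. f i)" for j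
    proof (induction j)
      case 0
      have "0 \<in> P" by (rule primes_overD(7)[OF P])
      then show ?case using O1 by (intro bexI[of _ 1]) auto
    next
      case (Suc j)
      then obtain d where d: "d \<in> ring_of_integers K" "d - 1 \<in> P" "w ^ Suc k zdvd d * (\<Sum>i<j. f i)" by auto
      have j: "j < n" using Suc by simp
      have "d * c j - 1 = d * (c j - 1) + (d - 1)" by (simp add: algebra_simps)
      also have "\<dots> \<in> P" by (intro primes_overD(4,5)[OF P] c(2) d j)
      finally have "d * c j - 1 \<in> P" .
      moreover have "w ^ Suc k zdvd c j * (d * (\<Sum>i<j. f i)) + d * (c j * f j)"
        by (rule zdvd_add[OF zdvd_mult2[OF d(3) OI[OF c(1)[OF j]]] zdvd_mult2[OF c(3)[OF j] OI[OF d(1)]]])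
      then have "w ^ Suc k zdvd (d * c j) * (\<Sum>i<Suc j. f i)" by (simp add: algebra_simps)
      ultimately show ?case using O_mult[OF d(1) c(1)[OF j]] by blast
    qed
    then show ?case using f(1) by blast
  }
qed

section \<open>Primes outside the conductor\<close>

context abelian_cyclotomic
begin

lemma OK_D: "x \<in> ring_of_integers K \<Longrightarrow> x \<in> L" "x \<in> ring_of_integers K \<Longrightarrow> algebraic_int x"
  "x \<in> ring_of_integers K \<Longrightarrow> x \<in> K"
  by (simp_all add: mem_ring_of_integers K_L)

text \<open>The quotient in \<open>zdvd\<close> may be any algebraic integer, but here it is also a
  quotient of two elements of \<open>K\<close>.\<close>

lemma OK_divide:
  assumes "x \<in> K" "of_nat q zdvd x" "q > 0"
  obtains y where "y \<in> ring_of_integers K" "x = y * of_nat q"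
proof -
  obtain y where y: "algebraic_int y" "x = of_nat q * y" using assms(2) by (auto simp: zdvd_def)
  then have "y = x * of_rat (1 / of_nat q)" using assms(3) by (simp add: of_rat_divide)
  then have "y \<in> K" using assms(1) by (simp add: K_mult K_of_rat)
  then show thesis using that y by (simp add: mem_ring_of_integers mult.commute)
qed

text \<open>Here \<open>a ^ Q\<close> and \<open>a\<close> are congruent modulo \<open>q\<close>
  itself. If \<open>q\<close> were in the square of \<open>P\<close>, a multiplier \<open>c\<close>
  would satisfy \<open>q ^ 2 zdvd c * q\<close>; so \<open>q\<close> divides \<open>c\<close>, and
  \<open>c\<close> lies in \<open>P\<close> although it is 1 modulo \<open>P\<close>.\<close>

lemma unramified_outside:
  assumes q: "prime q" "\<not> q dvd m" and P: "P \<in> primes_over K q" and k: "k \<ge> 2"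
  shows "of_nat q \<notin> ideal_pow K P k"
proof
  assume "of_nat q \<in> ideal_pow K P k"
  then have q2: "of_nat q \<in> ideal_pow K P 2"
    using ideal_pow_antimono[OF P K_subfield k] by blast
  let ?Q = "q ^ totient m"
  have "coprime q m" using q by (simp add: prime_imp_coprime)
  then have Qm: "[?Q = 1] (mod m)" by (rule euler_theorem)
  have "{a \<in> U. [a = 1] (mod m)} = {1 mod m}"
    using mod_in_U[of 1] by (auto simp: U_def cong_def)
  then have card: "card {a \<in> U. [a = 1] (mod m)} = 1" by simp
  have fixed: "sig a x = x" if "x \<in> L" "[a = 1] (mod m)" for a x
    using that sig_cong sig_1_eq by metis
  have frob: "of_nat q zdvd a ^ ?Q - a" if "a \<in> ring_of_integers K" for a
    using that OK_D q Qm fixed card not_prime_1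
    by (intro frobenius_power_fixed[where d = m]) auto
  have "totient m \<ge> 1" using m_pos by (simp add: Suc_le_eq)
  then have "?Q \<ge> 2" using prime_ge_2_nat[OF q(1)]
    by (metis le_trans less_le_trans not_less self_le_power zero_less_one one_le_numeral less_eq_Suc_le One_nat_def)
  then obtain c where c: "c \<in> ring_of_integers K" "c - 1 \<in> P" "of_nat q ^ 2 zdvd c * of_nat q"
    using ideal_pow_multiplier[OF P K_subfield frob _ q2] by blast
  have q0: "(of_nat q :: complex) \<noteq> 0" using q by auto
  obtain e where "algebraic_int e" "c * of_nat q = of_nat q ^ 2 * e" using c(3) by (auto simp: zdvd_def)
  then have "of_nat q zdvd c" using q0 by (intro zdvdI[of e]) (auto simp: power2_eq_square)
  then obtain y where "y \<in> ring_of_integers K" "c = y * of_nat q"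
    using OK_divide[of c q] OK_D c(1) q prime_gt_0_nat by blast
  then have cP: "c \<in> P" using primes_overD(2,5)[OF P] by simp
  have "-1 \<in> ring_of_integers K"
    using K_of_int[of "-1"] by (simp add: mem_ring_of_integers algebraic_int_closed)
  then have "- (c - 1) \<in> P" using primes_overD(5)[OF P c(2)] by fastforce
  then show False using primes_overD(3,4)[OF P] cP by fastforce
qed

end

section \<open>Primes dividing the conductor\<close>

locale abelian_cyclotomic_at = abelian_cyclotomic m G \<chi> + cyclotomic_at m p m'
  for m :: nat and G :: "('a, 'b) monoid_scheme" (structure) and \<chi> and p m'
begin

text \<open>In general \<pi> is not in \<open>K\<close>, but \<open>p\<close> divides
  \<open>\<pi> ^ (p - 1)\<close> and hence \<open>x ^ (p - 1)\<close>. This covers every prime of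
  \<open>K\<close> over \<open>p\<close> without choosing a prime \<open>M\<close> above it.\<close>

lemma pi_zdvd_OK:
  assumes "x \<in> K" "algebraic_int x" "\<pi> zdvd x" and P: "P \<in> primes_over K p"
  shows "x \<in> P"
proof -
  have xO: "x ^ k \<in> ring_of_integers K" for k
    using assms by (simp add: mem_ring_of_integers K_power algebraic_int_closed)
  have "of_nat p zdvd \<pi> ^ (p - 1)" by (rule p_zdvd_pi_power) simp
  moreover have "\<pi> ^ (p - 1) zdvd x ^ (p - 1)" using assms by (intro zdvd_power)
  ultimately have "of_nat p zdvd x ^ (p - 1)" by (rule zdvd_trans)
  then obtain y where "y \<in> ring_of_integers K" "x ^ (p - 1) = y * of_nat p"
    using OK_divide[of "x ^ (p - 1)" p] OK_D xO p_gt by blast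
  then have "x ^ (p - 1) \<in> P" using primes_overD(2,5)[OF P] by simp
  then have "x ^ k \<in> P \<Longrightarrow> x \<in> P" for k
  proof (induction k)
    case (Suc k)
    then show ?case using primes_overD(6)[OF P, of x "x ^ k"] xO[of k] xO[of 1] by auto
  qed (use primes_overD(3)[OF P] in simp)
  then show ?thesis using \<open>x ^ (p - 1) \<in> P\<close> by blast
qed

text \<open>The multiplier argument with \<pi> in place of \<open>p\<close>:
  \<open>\<pi> ^ p\<close> divides \<open>c * p\<close>, and \<open>p\<close> is
  \<open>\<pi> ^ (p - 1)\<close> up to a unit, so \<pi> divides \<open>c\<close>. A positive
  exponent below \<open>p\<close> is prime to \<open>p\<close>, which is all that tameness
  asks.\<close>

lemma tame_at:
  assumes P: "P \<in> primes_over K p" and k: "k \<ge> p"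
  shows "of_nat p \<notin> ideal_pow K P k"
proof
  assume "of_nat p \<in> ideal_pow K P k"
  then have pk: "of_nat p \<in> ideal_pow K P p"
    using ideal_pow_antimono[OF P K_subfield k] by blast
  have Q2: "Q \<ge> 2" using Q_ge p_gt by simp
  obtain c where c: "c \<in> ring_of_integers K" "c - 1 \<in> P" "\<pi> ^ p zdvd c * of_nat p"
    using ideal_pow_multiplier[OF P K_subfield frobenius_mod_pi Q2 pk] OK_D by blast
  then obtain e where e: "algebraic_int e" "c * of_nat p = \<pi> ^ p * e" by (auto simp: zdvd_def)
  have "\<pi> ^ (p - 1) * c = (c * of_nat p) * V" by (simp only: pi_power_eq mult_ac)
  also have "\<dots> = \<pi> ^ (p - 1) * (\<pi> * (e * V))"
    using p_gt by (simp add: e power_eq_if mult_ac)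
  finally have "c = \<pi> * (e * V)" using pi_nz by simp
  then have "\<pi> zdvd c" by (rule zdvdI[rotated]) (intro algebraic_int_mult e V_int)
  then have cP: "c \<in> P" using pi_zdvd_OK c OK_D P by blast
  have "-1 \<in> ring_of_integers K"
    using K_of_int[of "-1"] by (simp add: mem_ring_of_integers algebraic_int_closed)
  then have "- (c - 1) \<in> P" using primes_overD(5)[OF P c(2)] by fastforce
  then show False using primes_overD(3,4)[OF P] cP by fastforce
qed

text \<open>The intersection of \<open>H\<close> and \<open>I\<close>, that is, the inertia group at
  \<open>p\<close> of the cyclotomic field over \<open>K\<close>.\<close>

definition HI :: "nat set" where "HI = {h \<in> H. [h = 1] (mod m')}"

context
  fixes M assumes M: "Zprime M" and pM: "of_nat p \<in> M"
begin

definition PM :: "complex set" where "PM = M \<inter> ring_of_integers K"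

lemma PM_over: "PM \<in> primes_over K p"
  using primeideal_contraction[OF K_subfield M] pM
  by (simp add: primes_over_def PM_def mem_ring_of_integers K_of_nat algebraic_int_closed)

lemma pi_M: "\<pi> \<in> M"
proof -
  have "\<pi> ^ (p - 1) \<in> M" unfolding pi_power_eq by (rule Zprime_mult2[OF M pM V_int])
  then show ?thesis using Zprime_power[OF M pi_int] by blast
qed

lemma of_nat_M_iff: "of_nat n \<in> M \<longleftrightarrow> p dvd n"
  using Zprime_of_nat_iff[OF M p pM] .

lemma zm_int: "algebraic_int (zeta m')" "algebraic_int (inverse (zeta m'))" "zeta m' \<in> L"
  using zeta_algebraic_int inverse_zeta_algebraic_int m'_pos dvd_m L_zeta_divisor by auto

lemma HI_I: "HI \<subseteq> I" and card_HI: "\<not> p dvd card HI"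
proof -
  show "HI \<subseteq> I" by (auto simp: HI_def I_def H_U)
  moreover have "1 mod m \<in> HI" using one_mod_in_H one_mod_in_I by (simp add: HI_def I_def)
  ultimately show "\<not> p dvd card HI" using card_subset_I by blast
qed

text \<open>If all twisted sums lay in \<open>M\<close>, Fourier inversion would put
  \<open>m'\<close> times the partial sum into \<open>M\<close>, and \<open>m'\<close> is prime to
  \<open>p\<close>. A computation over the inertia group thus yields a trace that is nonzero modulo
  \<open>M\<close>.\<close>

lemma fourier_not_in_M:
  assumes g: "\<And>h. h \<in> H \<Longrightarrow> algebraic_int (g h)" and e: "(\<Sum>h | h \<in> H \<and> [e h = 1] (mod m'). g h) \<notin> M"
  shows "\<exists>k. (\<Sum>h\<in>H. g h * zeta m' ^ (e h * k)) \<notin> M"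
proof (rule ccontr)
  assume "\<not> ?thesis"
  then have "inverse (zeta m') ^ k * (\<Sum>h\<in>H. g h * zeta m' ^ (e h * k)) \<in> M" for k
    using zm_int by (intro Zprime_mult[OF M] algebraic_int_closed) auto
  then have "(\<Sum>k<m'. inverse (zeta m') ^ k * (\<Sum>h\<in>H. g h * zeta m' ^ (e h * k))) \<in> M"
    by (intro Zprime_sum[OF M])
  then have "of_nat m' * (\<Sum>h | h \<in> H \<and> [e h = 1] (mod m'). g h) \<in> M"
    unfolding fourier_extract[OF m'_pos finite_H] .
  moreover have "algebraic_int (\<Sum>h | h \<in> H \<and> [e h = 1] (mod m'). g h)"
    using g by (intro algebraic_int_sum) auto
  ultimately show False using e p_m' Zprime_mult_iff[OF M] of_nat_M_iff algebraic_int_closed(1) by blast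
qed

lemma inertia_contains:
  assumes a: "a \<in> I" shows "aut a \<in> inertia_group K PM"
proof -
  have cop: "coprime a m" using a by (rule I_coprime)
  have triv: "sig a x - x \<in> PM" if "x \<in> ring_of_integers K" for x
  proof -
    have "\<pi> zdvd sig a x - x" using inertia_acts_trivially[OF a] OK_D that by blast
    then have "sig a x - x \<in> M" using Zprime_zdvd[OF M pi_M] by blast
    then show ?thesis using that cop
      by (simp add: PM_def mem_ring_of_integers K_diff sig_K algebraic_int_closed sig_algebraic_int K_L)
  qed
  have PMO: "x \<in> ring_of_integers K" "x \<in> M" "x \<in> K" if "x \<in> PM" for x
    using that by (auto simp: PM_def mem_ring_of_integers)
  have "aut a ` PM = PM"
  proof
    show "aut a ` PM \<subseteq> PM"
    proof
      fix y assume "y \<in> aut a ` PM"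
      then obtain x where x: "x \<in> PM" "y = sig a x" using PMO by (auto simp: aut_def)
      then have "(sig a x - x) + x \<in> PM"
        using primes_overD(4)[OF PM_over] triv PMO by blast
      then show "y \<in> PM" using x by simp
    qed
    show "PM \<subseteq> aut a ` PM"
    proof
      fix x assume x: "x \<in> PM"
      obtain b where b: "coprime b m" "[a * b = 1] (mod m)" using inverse_mod[OF cop] by blast
      have y: "sig b x \<in> ring_of_integers K"
        using x b PMO by (simp add: mem_ring_of_integers sig_K sig_algebraic_int K_L)
      have sy: "sig a (sig b x) = x"
        using b cop sig_cong[OF b(2)] sig_1_eq PMO x K_L by (simp add: sig_sig)
      then have "x - sig b x \<in> M" using triv[OF y] by (simp add: PM_def)
      then have "sig b x \<in> M" using Zprime_cong_iff[OF M, of x "sig b x"] PMO(2)[OF x] by simp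
      then have "sig b x \<in> PM" using y by (simp add: PM_def)
      moreover have "aut a (sig b x) = x" using sy PMO(3)[OF calculation] by (simp add: aut_def)
      ultimately show "x \<in> aut a ` PM" by (metis imageI)
    qed
  qed
  moreover have "aut a x - x \<in> PM" if "x \<in> ring_of_integers K" for x
    using triv[OF that] that by (simp add: aut_def mem_ring_of_integers)
  ultimately show ?thesis using aut_in_auts[OF cop] by (simp add: inertia_group_def)
qed

text \<open>The hypothesis says that the Frobenius at \<open>p\<close> of the conductor \<open>m'\<close> part acts trivially, so the
  sums \<open>Tr (\<zeta>\<^sup>k)\<close> of \<open>m'\<close>-th roots of unity are congruent to integers modulo \<open>M\<close>.\<close>

lemma decomposition_contained:
  assumes split: "b \<in> H" "[b = p] (mod m')"
    and a: "coprime a m" and dec: "aut a ` PM = PM"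
  shows "\<chi> a \<in> \<chi> ` I"
proof -
  define x where "x k = Tr (zeta m' ^ k)" for k
  have x_eq: "x k = (\<Sum>h\<in>H. zeta m' ^ (h * k))" for k
    unfolding x_def using Tr_zeta_power[OF dvd_m(2) L_1, of k] by (simp add: sig_1 H_coprime)
  have xO: "x k \<in> K" "algebraic_int (x k)" for k
    unfolding x_def using zm_int by (auto intro!: Tr_K Tr_int L_power algebraic_int_closed)
  have diff: "sig a (x k) - x k \<in> M" for k
  proof -
    \<comment> \<open>The \<open>p\<close>-th power multiplies exponents by \<open>p\<close>, that
      is, by \<open>b\<close> modulo \<open>m'\<close>, and multiplication by \<open>b\<close>
      permutes \<open>H\<close>. So the \<open>p\<close>-th power fixes \<open>x k\<close> modulo
      \<open>p\<close>.\<close>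
    have "of_nat p zdvd (\<Sum>h\<in>H. zeta m' ^ (h * k)) ^ p - (\<Sum>h\<in>H. (zeta m' ^ (h * k)) ^ p)"
      using zm_int by (intro zdvd_frobenius_sum p algebraic_int_closed)
    also have "(\<Sum>h\<in>H. (zeta m' ^ (h * k)) ^ p) = (\<Sum>h\<in>H. zeta m' ^ ((b * h mod m) * k))"
    proof (rule sum.cong[OF refl])
      fix h
      have "[b * h mod m = b * h] (mod m')" using dvd_m(2) by (simp add: cong_def mod_mod_cancel)
      then have "[b * h mod m = p * h] (mod m')"
        using cong_trans cong_scalar_right[OF split(2)] by blast
      then have "[h * k * p = (b * h mod m) * k] (mod m')"
        using cong_scalar_right[of "b * h mod m" "p * h" m' k] by (simp add: cong_sym mult_ac)
      then show "(zeta m' ^ (h * k)) ^ p = zeta m' ^ ((b * h mod m) * k)"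
        unfolding power_mult[symmetric] using zeta_power_eq_iff[OF m'_pos] by blast
    qed
    also have "\<dots> = (\<Sum>h\<in>H. zeta m' ^ (h * k))"
      using sum.reindex_bij_betw[OF bij_betw_mult_mod[of b H], of "\<lambda>h. zeta m' ^ (h * k)"]
        H_coprime[OF split(1)] H_mult_invariant[OF split(1)] H_U by blast
    finally have "of_nat p zdvd x k ^ p - x k" by (simp only: x_eq)
    then have "x k ^ p - x k \<in> M" using Zprime_zdvd[OF M pM] by blast
    then obtain n where n: "x k - of_nat n \<in> M"
      using Zprime_congruent_integer[OF M p pM xO(2)] by blast
    then have "x k - of_nat n \<in> PM"
      using xO by (simp add: PM_def mem_ring_of_integers K_diff K_of_nat algebraic_int_closed)
    \<comment> \<open>\<open>aut a\<close> preserves \<open>PM\<close> and fixes \<open>n\<close>,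
      so \<open>x k\<close> and its image are both congruent to \<open>n\<close>.\<close>
    then have "aut a (x k - of_nat n) \<in> PM" using dec by blast
    moreover have "aut a (x k - of_nat n) = sig a (x k) - of_nat n"
      using xO a by (simp add: aut_def K_diff K_of_nat sig_diff K_L L_of_nat sig_of_nat)
    ultimately have "sig a (x k) - of_nat n \<in> M" by (simp add: PM_def)
    from Zprime_diff[OF M this n] show ?thesis by simp
  qed
  have sx: "sig a (x k) = (\<Sum>h\<in>H. zeta m' ^ (a * h * k))" for k
    unfolding x_eq using a dvd_m zm_int
    by (simp add: sig_sum sig_power L_power sig_zeta_divisor power_mult[symmetric] mult_ac)
  have "\<exists>h\<in>H. [a * h = 1] (mod m')"
  proof (rule ccontr)
    assume none: "\<not> ?thesis"
    \<comment> \<open>Inverting both families of sums counts the \<open>h\<close> with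
      \<open>a * h\<close> congruent to 1 and those with \<open>h\<close> congruent to 1. If the
      first set were empty, \<open>p\<close> would divide \<open>m' * card HI\<close>.\<close>
    have "(\<Sum>k<m'. inverse (zeta m') ^ k * (sig a (x k) - x k)) \<in> M"
      using zm_int diff by (intro Zprime_sum[OF M] Zprime_mult[OF M] algebraic_int_closed) auto
    also have "(\<Sum>k<m'. inverse (zeta m') ^ k * (sig a (x k) - x k))
       = (\<Sum>k<m'. inverse (zeta m') ^ k * (\<Sum>h\<in>H. 1 * zeta m' ^ (a * h * k)))
       - (\<Sum>k<m'. inverse (zeta m') ^ k * (\<Sum>h\<in>H. 1 * zeta m' ^ (h * k)))"
      unfolding sx unfolding x_eq by (simp add: right_diff_distrib sum_subtractf)
    also have "\<dots> = of_nat m' * (\<Sum>h | h \<in> H \<and> [a * h = 1] (mod m'). 1)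
       - of_nat m' * (\<Sum>h | h \<in> H \<and> [h = 1] (mod m'). 1)"
      unfolding fourier_extract[OF m'_pos finite_H] ..
    also have "{h. h \<in> H \<and> [a * h = 1] (mod m')} = {}" using none by blast
    finally have "of_nat m' * (of_nat (card HI) :: complex) \<in> M"
      using Zprime_minus[OF M] by (fastforce simp: HI_def)
    then have "of_nat (m' * card HI) \<in> M" by simp
    then show False using of_nat_M_iff card_HI p_m' p by (metis prime_dvd_mult_iff)
  qed
  then obtain h where h: "h \<in> H" "[a * h = 1] (mod m')" by blast
  have "coprime (a * h) m" using a H_coprime[OF h(1)] by simp
  then have "a * h mod m \<in> I"
    using h(2) dvd_m(2) by (simp add: I_def mod_in_U cong_def mod_mod_cancel)
  moreover have "\<chi> (a * h mod m) = \<chi> a"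
    using a h(1) chi_closed[OF a] by (simp add: chi_mod chi_mult H_coprime) (simp add: H_def)
  ultimately show ?thesis by (metis imageI)
qed

text \<open>Three inclusions close up: \<open>\<chi>\<close> I\<open>lies in the image of inertia,
  this in the image of decomposition, and this in\<close>\<chi> \<open>I\<close> again.\<close>

lemma inertia_decomposition:
  assumes split: "b \<in> H" "[b = p] (mod m')"
  shows "\<phi> ` inertia_group K PM = \<chi> ` I" "\<phi> ` decomposition_group K PM = \<chi> ` I"
proof -
  have 1: "\<chi> ` I \<subseteq> \<phi> ` inertia_group K PM"
  proof
    fix g assume "g \<in> \<chi> ` I"
    then obtain a where "a \<in> I" "g = \<phi> (aut a)" using phi_aut I_coprime by auto
    then show "g \<in> \<phi> ` inertia_group K PM" using inertia_contains by blast
  qed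
  have 2: "\<phi> ` inertia_group K PM \<subseteq> \<phi> ` decomposition_group K PM"
    by (auto simp: inertia_group_def decomposition_group_def)
  have 3: "\<phi> ` decomposition_group K PM \<subseteq> \<chi> ` I"
  proof
    fix g assume "g \<in> \<phi> ` decomposition_group K PM"
    then obtain a where a: "coprime a m" "g = \<phi> (aut a)" "aut a ` PM = PM"
      by (auto simp: decomposition_group_def auts_eq)
    then show "g \<in> \<chi> ` I" using decomposition_contained[OF split] phi_aut by simp
  qed
  show "\<phi> ` inertia_group K PM = \<chi> ` I" "\<phi> ` decomposition_group K PM = \<chi> ` I"
    using 1 2 3 by auto
qed

text \<open>A product of two elements of \<open>PM\<close> that is \<open>p\<close> times a unit at \<open>PM\<close>: traces of
  \<open>\<pi>\<^sup>f\<zeta>\<^sup>k\<close> have \<open>\<pi>\<close>-adic valuation exactly \<open>f\<close> for some \<open>k\<close>, because \<open>\<sigma>\<^sub>h \<pi> / \<pi> \<equiv> h\<close> and \<open>h\<^sup>f \<equiv> 1\<close>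
  for \<open>h\<close> in \<open>HI\<close>.\<close>

lemma ramified_at:
  assumes f: "f \<ge> 1" "f < p - 1" and hf: "\<And>h. h \<in> HI \<Longrightarrow> [h ^ f = 1] (mod p)"
  shows "of_nat p \<in> ideal_pow K PM 2"
proof -
  let ?z = "zeta m'"
  \<comment> \<open>For \<open>h\<close> in \<open>H\<close> this is the quotient of
    \<open>sig h \<pi>\<close> by \<pi>; it is congruent to \<open>h\<close> modulo
    \<open>M\<close>.\<close>
  define u where "u h = (\<Sum>i<h. zp ^ i)" for h
  have pow: "1 - zp ^ h = \<pi> * u h" for h unfolding u_def by (rule one_minus_zp_power)
  have ui: "algebraic_int (u h)" "u h \<in> L" for h
    unfolding u_def using zp_int zp_L by (auto intro!: algebraic_int_sum algebraic_int_closed L_sum L_power)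
  have uM: "u h - of_nat h \<in> M" for h
  proof -
    have "\<pi> zdvd - (\<Sum>i<h. 1 - zp ^ i)" by (intro zdvd_minus zdvd_sum pi_zdvd)
    moreover have "u h - of_nat h = - (\<Sum>i<h. 1 - zp ^ i)" by (simp add: u_def sum_subtractf)
    ultimately show ?thesis using Zprime_zdvd[OF M pi_M] by metis
  qed
  have pow_cong: "x ^ j - y ^ j \<in> M" if "x - y \<in> M" "algebraic_int x" "algebraic_int y" for x y j
    using zdvd_power_diff[of "x - y" x y j] that Zprime_zdvd[OF M, of "x - y"] zdvd_refl by blast
  have TrM: "Tr (\<pi> ^ j * x) = (\<Sum>h\<in>H. \<pi> ^ j * (u h ^ j * sig h x))" if "x \<in> L" for x j
  proof -
    have "sig h \<pi> = \<pi> * u h" if "h \<in> H" for h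
      using that dvd_m by (simp add: \<pi>_def sig_diff sig_1 sig_zeta_divisor L_1 zp_L H_coprime
        pow[unfolded \<pi>_def])
    then show ?thesis unfolding Tr_def using that
      by (intro sum.cong refl)
        (simp add: H_coprime sig_mult sig_power L_power pi_L power_mult_distrib)
  qed
  have sz: "sig h (?z ^ k) = ?z ^ (h * k)" if "h \<in> H" for h k
    using that zm_int dvd_m by (simp add: sig_power H_coprime sig_zeta_divisor power_mult)
  have zL: "?z ^ k \<in> L" "algebraic_int (?z ^ k)" for k
    using zm_int by (auto intro: L_power algebraic_int_closed)
  define w where "w k = (\<Sum>h\<in>H. u h ^ f * ?z ^ (h * k))" for k
  have "(\<Sum>h | h \<in> H \<and> [h = 1] (mod m'). u h ^ f) - of_nat (card HI) \<in> M"
  proof -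
    have "u h ^ f - 1 \<in> M" if "h \<in> HI" for h
    proof -
      have "u h ^ f - of_nat h ^ f \<in> M" using uM ui by (intro pow_cong algebraic_int_closed)
      moreover have "of_int (int h ^ f - 1) \<in> M"
      proof -
        have "[int h ^ f = 1] (mod int p)" using hf[OF that] by (metis cong_int_iff of_nat_1 of_nat_power)
        then show ?thesis unfolding Zprime_of_int_iff[OF M p pM] by (simp only: cong_iff_dvd_diff)
      qed
      ultimately have "(u h ^ f - of_nat h ^ f) + (of_nat h ^ f - 1) \<in> M"
        by (intro Zprime_add[OF M]) auto
      then show ?thesis by simp
    qed
    then have "(\<Sum>h\<in>HI. u h ^ f - 1) \<in> M" by (intro Zprime_sum[OF M])
    then show ?thesis by (simp add: HI_def sum_subtractf)
  qed
  then have "(\<Sum>h | h \<in> H \<and> [h = 1] (mod m'). u h ^ f) \<notin> M"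
    using Zprime_cong_iff[OF M] card_HI of_nat_M_iff by blast
  then obtain k where k: "w k \<notin> M"
    using fourier_not_in_M[of "\<lambda>h. u h ^ f" "\<lambda>h. h"] ui unfolding w_def
    by (auto intro: algebraic_int_closed)
  have wi: "algebraic_int (w k)" "w k \<in> L" unfolding w_def
    using ui zL by (auto intro!: algebraic_int_sum algebraic_int_mult algebraic_int_closed L_sum L_mult L_power zm_int)
  define y where "y = Tr (\<pi> ^ f * ?z ^ k)"
  have y_eq: "y = \<pi> ^ f * w k"
    unfolding y_def TrM[OF zL(1)] w_def by (simp add: sz sum_distrib_left)
  have VL: "V \<in> L" unfolding V_def using zp_L by (intro L_prod L_sum L_power)
  have VM: "V \<notin> M" using V_W Zprime_mult2[OF M _ W_int, of V] Zprime_1[OF M] by auto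
  \<comment> \<open>As \<open>\<pi> ^ (p - 1) = p * V\<close>, multiplying \<open>y\<close> by
    \<open>\<pi> ^ (p - 1 - f)\<close> gives exactly \<open>p * c\<close>. Twisting by
    \<open>zeta m' ^ l\<close> and taking traces yields \<open>p * d = y * t\<close> in
    \<open>K\<close>, and \<open>l\<close> is chosen to keep \<open>d\<close> out of
    \<open>M\<close>.\<close>
  define c where "c = w k * V"
  have c: "c \<in> L" "algebraic_int c" "c \<notin> M"
    using wi VL V_int k VM Zprime_mult_iff[OF M wi(1) V_int]
    by (simp_all add: c_def L_mult algebraic_int_mult)
  have "(\<Sum>h | h \<in> H \<and> [h = 1] (mod m'). sig h c) - of_nat (card HI) * c \<in> M"
  proof -
    have "sig h c - c \<in> M" if "h \<in> HI" for h
      using inertia_acts_trivially[of h c] c that HI_I Zprime_zdvd[OF M pi_M] by blast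
    then have "(\<Sum>h\<in>HI. sig h c - c) \<in> M" by (intro Zprime_sum[OF M])
    then show ?thesis by (simp add: HI_def sum_subtractf)
  qed
  then have "(\<Sum>h | h \<in> H \<and> [h = 1] (mod m'). sig h c) \<notin> M"
    using Zprime_cong_iff[OF M] card_HI of_nat_M_iff Zprime_mult_iff[OF M _ c(2)] c(3)
      algebraic_int_closed(1) by blast
  then obtain l where l: "(\<Sum>h\<in>H. sig h c * ?z ^ (h * l)) \<notin> M"
    using fourier_not_in_M[of "\<lambda>h. sig h c" "\<lambda>h. h"] c sig_algebraic_int H_coprime by blast
  define d where "d = Tr (c * ?z ^ l)"
  have dM: "d \<notin> M" unfolding d_def using Tr_zeta_power[OF dvd_m(2) c(1)] l by simp
  have d: "d \<in> K" "algebraic_int d"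
    unfolding d_def using c zL by (auto intro!: Tr_K Tr_int L_mult algebraic_int_mult)
  define t where "t = Tr (\<pi> ^ (p - 1 - f) * ?z ^ l)"
  have yK: "y \<in> K" "algebraic_int y" and tK: "t \<in> K" "algebraic_int t"
    unfolding y_def t_def using zL pi_L pi_int
    by (auto intro!: Tr_K Tr_int L_mult L_power[OF pi_L] algebraic_int_mult algebraic_int_closed(4)[OF pi_int])
  have pd: "of_nat p * d = y * t"
  proof -
    have "y * t = Tr (y * (\<pi> ^ (p - 1 - f) * ?z ^ l))"
      unfolding t_def by (intro Tr_mult_K[symmetric] L_mult L_power pi_L zm_int(3) yK)
    also have "y * (\<pi> ^ (p - 1 - f) * ?z ^ l) = (\<pi> ^ f * \<pi> ^ (p - 1 - f)) * (w k * ?z ^ l)"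
      by (simp add: y_eq)
    also have "\<pi> ^ f * \<pi> ^ (p - 1 - f) = of_nat p * V"
      using f by (simp add: power_add[symmetric] pi_power_eq[symmetric])
    also have "of_nat p * V * (w k * ?z ^ l) = of_nat p * (c * ?z ^ l)" by (simp add: c_def)
    also have "Tr \<dots> = of_nat p * d"
      unfolding d_def using c zL by (intro Tr_mult_K L_mult K_of_nat)
    finally show ?thesis ..
  qed
  have PM_I: "x \<in> PM" if "x \<in> K" "x \<in> M" for x
    using that Zprime_algebraic_int[OF M] by (simp add: PM_def mem_ring_of_integers)
  \<comment> \<open>Both exponents \<open>f\<close> and \<open>p - 1 - f\<close> are positive, which
    puts \<open>y\<close> and \<open>t\<close> into \<open>M\<close>.\<close>
  have pow_M: "\<pi> ^ j * x \<in> M" if j: "j \<ge> 1" and x: "algebraic_int x" for j x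
  proof -
    have "\<pi> ^ j * x = (\<pi> ^ (j - 1) * x) * \<pi>" using j by (simp add: power_eq_if)
    also have "\<dots> \<in> M" by (intro Zprime_mult[OF M pi_M] algebraic_int_mult algebraic_int_closed pi_int x)
    finally show ?thesis .
  qed
  have yP: "y \<in> PM" using yK wi f by (intro PM_I) (auto simp: y_eq intro: pow_M)
  have "t \<in> M"
    unfolding t_def TrM[OF zL(1)]
    using f ui zL by (intro Zprime_sum[OF M] pow_M algebraic_int_mult algebraic_int_closed sig_algebraic_int L_power zm_int)
      (auto intro: H_coprime)
  then have tP: "t \<in> PM" using tK PM_I by blast
  have Q2: "Q \<ge> 2" using Q_ge p_gt by simp
  \<comment> \<open>\<open>e\<close> inverts \<open>d\<close> modulo \<open>M\<close>, because
    \<open>d ^ Q\<close> is congruent to \<open>d\<close> and \<open>d\<close> is not in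
    \<open>M\<close>.\<close>
  define e where "e = d ^ (Q - 2)"
  have ed: "d ^ Q = d * (e * d)"
  proof -
    have "Q = Suc (Suc (Q - 2))" using Q2 by simp
    then have "d ^ Q = d ^ Suc (Suc (Q - 2))" by simp
    then show ?thesis by (simp add: e_def mult_ac)
  qed
  have e: "e \<in> K" "algebraic_int e" using d by (auto simp: e_def K_power algebraic_int_closed)
  have "d ^ Q - d \<in> M" using frobenius_mod_pi[of d] d K_L Zprime_zdvd[OF M pi_M] by blast
  then have "d * (e * d - 1) \<in> M" by (simp add: ed algebra_simps)
  then have "e * d - 1 \<in> M"
    using Zprime_mult_iff[OF M, of d "e * d - 1"] d e dM by (auto intro: algebraic_int_closed algebraic_int_mult)
  then have "1 - e * d \<in> M" using Zprime_minus[OF M] by fastforce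
  then have edP: "1 - e * d \<in> PM" using d e by (intro PM_I K_diff K_mult K_1)
  have "PM \<subseteq> ideal_pow K PM 1"
  proof
    fix x assume x: "x \<in> PM"
    have "1 \<in> ring_of_integers K" by (simp add: mem_ring_of_integers K_1 algebraic_int_closed)
    then have "x * 1 \<in> ideal_pow K PM 1"
      unfolding One_nat_def ideal_pow.simps using x by (intro add_span_base) blast
    then show "x \<in> ideal_pow K PM 1" by simp
  qed
  note PM1 = subsetD[OF this]
  have ey: "e * y \<in> PM"
    using primes_overD(5)[OF PM_over yP] e by (simp add: mem_ring_of_integers)
  \<comment> \<open>Each term is a product of two elements of \<open>PM\<close>, the second one
    because \<open>1 - e * d\<close> vanishes modulo \<open>M\<close>.\<close>
  have "of_nat p = (e * y) * t + of_nat p * (1 - e * d)"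
    using pd by (simp add: algebra_simps)
  also have "\<dots> \<in> ideal_pow K PM 2"
  proof -
    define F where "F i = (if i = 0 then (e * y) * t else of_nat p * (1 - e * d))" for i :: nat
    have "F i \<in> {a * b |a b. a \<in> PM \<and> b \<in> ideal_pow K PM 1}" for i
      unfolding F_def using ey PM1[OF tP] primes_overD(2)[OF PM_over] PM1[OF edP] by auto
    moreover have "(e * y) * t + of_nat p * (1 - e * d) = (\<Sum>i<2. F i)"
      by (simp add: F_def numeral_2_eq_2)
    ultimately show ?thesis
      unfolding numeral_2_eq_2 ideal_pow.simps(2)[of K PM "Suc 0"] add_span_def
      by (intro CollectI exI[of _ "Suc (Suc 0)"] exI[of _ F]) simp
  qed
  finally show ?thesis .
qed

end

end

section \<open>Primes splitting in Kummer extensions\<close>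

text \<open>An integral equation for \<open>x\<close> shows that \<open>x\<close> divides the
  constant coefficient; if this is 0, a factor \<open>x\<close> is cancelled and the degree
  drops.\<close>

lemma zdvd_of_int_exists:
  assumes "algebraic_int x" "x \<noteq> 0"
  obtains D :: nat where "D > 0" "x zdvd of_nat D"
proof -
  have "\<exists>D::int. D \<noteq> 0 \<and> x zdvd of_int D"
    if "x ^ n + (\<Sum>i<n. of_int (c i) * x ^ i) = 0" for n and c :: "nat \<Rightarrow> int"
    using that
  proof (induction n arbitrary: c)
    case (Suc n)
    let ?y = "x ^ n + (\<Sum>i<n. of_int (c (Suc i)) * x ^ i)"
    have eq: "of_int (c 0) + x * ?y = 0"
      using Suc.prems by (simp add: sum.lessThan_Suc_shift sum_distrib_left algebra_simps del: sum.lessThan_Suc)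
    show ?case
    proof (cases "c 0 = 0")
      case True
      then show ?thesis using eq assms(2) by (intro Suc.IH[of "\<lambda>i. c (Suc i)"]) simp
    next
      case False
      have "of_int (- c 0) = x * ?y" using eq by (simp add: add_eq_0_iff2)
      moreover have "algebraic_int ?y" using assms(1) by (intro algebraic_int_intros)
      ultimately show ?thesis using False by (intro exI[of _ "- c 0"]) (auto intro: zdvdI)
    qed
  qed simp
  then obtain D :: int where D: "D \<noteq> 0" "x zdvd of_int D"
    using assms(1) unfolding algebraic_integer_iff[symmetric] algebraic_integer_def by blast
  then have "x zdvd of_nat (nat \<bar>D\<bar>)"
    using zdvd_minus[of x "of_int D"] by (simp add: abs_if)
  then show thesis using that[of "nat \<bar>D\<bar>"] D(1) by simp
qed

lemma ev_power: "ev (f ^ k) x = ev f x ^ k"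
  by (induction k) (simp_all add: ev_mult one_pCons)

lemma zdvd_prod_mset: "(\<And>r. r \<in># R \<Longrightarrow> f r zdvd c) \<Longrightarrow> (\<Prod>r\<in>#R. f r) zdvd c ^ size R"
  by (induction R) (auto intro: zdvd_mono)

text \<open>A monic integer equation for \<open>c / (n - \<theta>)\<close>, multiplied by
  \<open>(n - \<theta>) ^ N\<close>, becomes a rational polynomial equation for \<theta>, which also
  holds for the conjugate \<open>r\<close>. Read backwards, \<open>c / (n - r)\<close> satisfies the
  same monic equation.\<close>

lemma zdvd_conjugate:
  assumes div: "of_int n - \<theta> zdvd of_int c" and c: "c \<noteq> 0"
    and conj: "\<And>f. ev f \<theta> = 0 \<Longrightarrow> ev f r = 0"
  shows "of_int n - r zdvd of_int c"
proof -
  obtain z where z: "algebraic_int z" "of_int c = (of_int n - \<theta>) * z" using div by (auto simp: zdvd_def)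
  obtain N g where g: "z ^ N + (\<Sum>i<N. of_int (g i) * z ^ i) = 0" "N > 0"
    using z(1) unfolding algebraic_integer_iff[symmetric] algebraic_integer_def by blast
  define F :: "rat poly" where
    "F = [:of_int c ^ N:] + (\<Sum>i<N. [:of_int (g i) * of_int c ^ i:] * [:of_int n, -1:] ^ (N - i))"
  have evF: "ev F y = of_int c ^ N + (\<Sum>i<N. of_int (g i) * of_int c ^ i * (of_int n - y) ^ (N - i))" for y
    by (simp add: F_def ev_add ev_sum ev_mult ev_power of_rat_mult of_rat_power of_rat_minus del: mult_pCons_left)
  have scale: "(of_int n - y) ^ N * (w ^ N + (\<Sum>i<N. of_int (g i) * w ^ i)) = ev F y"
    if "of_int c = (of_int n - y) * w" for y w
  proof -
    have summand: "(of_int n - y) ^ N * (of_int (g i) * w ^ i)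
        = of_int (g i) * of_int c ^ i * (of_int n - y) ^ (N - i)" if "i < N" for i
    proof -
      have "(of_int n - y) ^ N = (of_int n - y) ^ i * (of_int n - y) ^ (N - i)"
        using that by (simp add: power_add[symmetric])
      then show ?thesis by (simp add: \<open>of_int c = (of_int n - y) * w\<close> power_mult_distrib)
    qed
    have "(\<Sum>i<N. (of_int n - y) ^ N * (of_int (g i) * w ^ i))
        = (\<Sum>i<N. of_int (g i) * of_int c ^ i * (of_int n - y) ^ (N - i))"
      by (rule sum.cong[OF refl]) (simp only: summand lessThan_iff)
    moreover have "(of_int n - y) ^ N * w ^ N = of_int c ^ N" by (simp add: that power_mult_distrib)
    ultimately show ?thesis unfolding evF distrib_left sum_distrib_left by (simp only:)
  qed
  have "ev F \<theta> = 0" using scale[OF z(2)] g(1) by simp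
  then have Fr: "ev F r = 0" by (rule conj)
  have nr: "of_int n - r \<noteq> 0"
  proof
    assume "of_int n - r = 0"
    then have "ev F r = of_int c ^ N" unfolding evF by (auto intro!: sum.neutral)
    then show False using Fr c by simp
  qed
  define w where "w = of_int c / (of_int n - r)"
  have cw: "of_int c = (of_int n - r) * w" using nr by (simp add: w_def)
  have "w ^ N + (\<Sum>i<N. of_int (g i) * w ^ i) = 0"
    using scale[OF cw] Fr nr by simp
  then have "algebraic_int w"
    using g(2) unfolding algebraic_integer_iff[symmetric] algebraic_integer_def by blast
  then show ?thesis using cw by (rule zdvdI)
qed

text \<open>If \<open>n - \<theta>\<close> divides \<open>c\<close>, so do its conjugates, and their
  product, the value at \<open>n\<close> of the minimal polynomial of \<theta>, divides a fixed
  power of \<open>c\<close>. Infinitely many \<open>n\<close> would give one value infinitely often,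
  but that polynomial is not constant.\<close>

lemma finite_zdvd_shift:
  assumes \<theta>: "algebraic_int \<theta>" and c: "c \<noteq> 0"
  shows "finite {n :: int. of_int n - \<theta> zdvd of_int c}"
proof (rule ccontr)
  assume inf: "infinite {n :: int. of_int n - \<theta> zdvd of_int c}"
  obtain F :: "int poly" where F: "poly (map_poly of_int F) \<theta> = 0" "lead_coeff F = 1"
    using \<theta> algebraic_int_altdef_ipoly by blast
  have evF: "ev (map_poly of_int F) x = poly (map_poly of_int F) x" for x
    by (simp add: ev_def map_poly_map_poly o_def)
  have "map_poly of_int F \<noteq> (0 :: rat poly)"
    using F(2) by (metis coeff_0 coeff_map_poly of_int_0 of_int_1 zero_neq_one)
  then obtain \<mu> where \<mu>: "lead_coeff \<mu> = 1" "ev \<mu> \<theta> = 0" "\<And>f. ev f \<theta> = 0 \<Longrightarrow> \<mu> dvd f"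
    using minimal_poly_exists[of "map_poly of_int F" \<theta>] evF F(1) by auto
  let ?M = "map_poly of_rat \<mu> :: complex poly"
  have conj: "ev f r = 0" if "ev \<mu> r = 0" "ev f \<theta> = 0" for f r
    using \<mu>(3)[OF that(2)] that(1) by (auto elim!: dvdE simp: ev_mult)
  have lM: "lead_coeff ?M = 1" using \<mu>(1) by (simp add: degree_map_poly coeff_map_poly)
  then have M0: "?M \<noteq> 0" by auto
  have ri: "algebraic_int r" if "ev \<mu> r = 0" for r
  proof -
    have "poly (map_poly of_int F) r = 0" using conj[OF that, of "map_poly of_int F"] F(1) by (simp add: evF)
    then show ?thesis using F(2) algebraic_int_altdef_ipoly by blast
  qed
  have "algebraic_int (coeff ?M i)" for i
    using lM ri by (intro algebraic_int_coeff_if_roots) (auto simp: ev_def)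
  then have "\<forall>i. \<exists>k. coeff \<mu> i = of_int k"
    using algebraic_int_rat_Ints by (simp add: coeff_map_poly)
  then obtain b where b: "\<And>i. coeff \<mu> i = of_int (b i)" by metis
  define v where "v n = (\<Sum>i\<le>degree \<mu>. b i * n ^ i)" for n :: int
  have v: "ev \<mu> (of_int n) = of_int (v n)" for n
    by (simp add: ev_altdef b v_def)
  have "v n dvd c ^ size (proots ?M)" if "of_int n - \<theta> zdvd of_int c" for n
  proof -
    have "of_int n - r zdvd of_int c" if "r \<in># proots ?M" for r
    proof (rule zdvd_conjugate[OF \<open>of_int n - \<theta> zdvd of_int c\<close> c])
      have "ev \<mu> r = 0" using that M0 by (simp add: ev_def)
      then show "ev f r = 0" if "ev f \<theta> = 0" for f using conj that by blast
    qed
    then have "(\<Prod>r\<in>#proots ?M. of_int n - r) zdvd of_int c ^ size (proots ?M)"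
      by (rule zdvd_prod_mset)
    also have "(\<Prod>r\<in>#proots ?M. of_int n - r) = poly (\<Prod>r\<in>#proots ?M. [:- r, 1:]) (of_int n)"
      by (induction "proots ?M") (simp_all add: poly_prod_mset image_mset.compositionality o_def)
    also have "(\<Prod>r\<in>#proots ?M. [:- r, 1:]) = ?M"
      using complex_poly_decompose_multiset[of ?M] lM by simp
    finally have "of_int (v n) zdvd of_int (c ^ size (proots ?M))"
      using v[of n] by (simp add: ev_def)
    then show ?thesis by (simp only: of_int_zdvd_iff)
  qed
  then have "v ` {n. of_int n - \<theta> zdvd of_int c} \<subseteq> {d. d dvd c ^ size (proots ?M)}" by blast
  moreover have "finite {d. d dvd c ^ size (proots ?M)}"
    using c by (intro finite_divisors_int) simp
  ultimately have "finite (v ` {n. of_int n - \<theta> zdvd of_int c})" by (rule finite_subset)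
  then obtain n0 where "infinite {n \<in> {n. of_int n - \<theta> zdvd of_int c}. v n = v n0}"
    using pigeonhole_infinite[OF inf] by blast
  then have inf2: "infinite {n. v n = v n0}" by (rule infinite_super[rotated]) blast
  let ?N = "?M - [:of_int (v n0):]"
  have "(of_int :: int \<Rightarrow> complex) ` {n. v n = v n0} \<subseteq> {x. poly ?N x = 0}"
    using v by (auto simp: ev_def)
  moreover have "infinite ((of_int :: int \<Rightarrow> complex) ` {n. v n = v n0})"
    using inf2 by (subst finite_image_iff) (auto simp: inj_on_def)
  ultimately have "?N = 0" using poly_roots_finite finite_subset by blast
  then have "degree ?M = 0" by (metis degree_pCons_0 eq_iff_diff_eq_0)
  then have "degree \<mu> = 0" by (simp add: degree_map_poly)
  then show False using \<mu>(1,2) by (auto elim!: degree_eq_zeroE)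
qed

text \<open>A form of Euclid's argument. If no large prime worked, \<open>n - \<theta>\<close> would
  be coprime to every large prime. Along a suitable progression \<open>poly F n\<close> is
  \<open>c\<close> times a number with large prime factors only, so its divisor
  \<open>n - \<theta>\<close> would divide \<open>c\<close> for infinitely many
  \<open>n\<close>.\<close>

lemma exists_prime_root:
  assumes \<theta>: "algebraic_int \<theta>"
  obtains p M n where "prime p" "p > (B :: nat)" "Zprime M" "of_nat p \<in> M" "of_int n - \<theta> \<in> M"
proof (rule ccontr)
  assume "\<not> thesis"
  then have none: "\<not> (prime p \<and> p > B \<and> Zprime M \<and> of_nat p \<in> M \<and> of_int n - \<theta> \<in> M)" for p M n
    using that by blast
  have comax: "\<exists>a b. algebraic_int a \<and> algebraic_int b \<and> 1 = of_nat p * a + (of_int n - \<theta>) * b"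
    if p: "prime p" "p > B" for p n
  proof (rule ccontr)
    assume neg: "\<not> ?thesis"
    let ?I = "{i + c * (of_int n - \<theta>) | i c. i \<in> {x. of_nat p zdvd x} \<and> algebraic_int c}"
    have xi: "algebraic_int (of_int n - \<theta>)" using \<theta> by (intro algebraic_int_closed)
    have "Zideal {x. of_nat p zdvd x}" unfolding Zideal_def
      by (auto intro: zdvd_add zdvd_mult2 zdvd_algebraic_int[of "of_nat p"] algebraic_int_closed)
    then have "Zideal ?I" using xi by (rule Zideal_add_multiples)
    moreover have "1 \<notin> ?I"
    proof
      assume "1 \<in> ?I"
      then obtain i b where "of_nat p zdvd i" "algebraic_int b" "1 = i + b * (of_int n - \<theta>)" by blast
      then show False using neg unfolding zdvd_def by (metis mult.commute)
    qed
    ultimately obtain M where M: "Zprime M" "?I \<subseteq> M" by (rule Zprime_exists)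
    have "of_nat p + 0 * (of_int n - \<theta>) \<in> ?I"
      by (intro CollectI exI[of _ "of_nat p"] exI[of _ 0]) simp
    moreover have "0 + 1 * (of_int n - \<theta>) \<in> ?I"
      by (intro CollectI exI[of _ 0] exI[of _ 1]) (simp add: algebraic_int_closed)
    ultimately have "of_nat p \<in> M" "of_int n - \<theta> \<in> M" using M(2) by auto
    then show False using none p M(1) by blast
  qed
  have cancel: "of_int n - \<theta> zdvd of_int c"
    if "of_int n - \<theta> zdvd of_int c * of_nat u" "u > 0" "\<And>p. prime p \<Longrightarrow> p dvd u \<Longrightarrow> p > B" for n c and u :: nat
    using that
  proof (induction u rule: less_induct)
    case (less u)
    show ?case
    proof (cases "u = 1")
      case False
      then obtain p where p: "prime p" "p dvd u" using prime_factor_nat by blast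
      then obtain u' where u': "u = p * u'" by blast
      obtain a b where ab: "algebraic_int a" "algebraic_int b" "1 = of_nat p * a + (of_int n - \<theta>) * b"
        using comax less.prems(3) p by blast
      let ?w = "of_int c * of_nat u' :: complex"
      have "?w = (of_nat p * a + (of_int n - \<theta>) * b) * ?w" using ab(3) by simp
      also have "\<dots> = (of_int c * of_nat u) * a + (of_int n - \<theta>) * (b * ?w)"
        by (simp add: u' algebra_simps)
      also have "of_int n - \<theta> zdvd \<dots>"
      proof (rule zdvd_add[OF zdvd_mult[OF less.prems(1) ab(1)] zdvd_mult[OF zdvd_refl]])
        show "algebraic_int (b * ?w)" using ab(2) by (intro algebraic_int_intros)
      qed
      finally have "of_int n - \<theta> zdvd ?w" .
      moreover have "u' < u" "u' > 0" using u' less.prems(2) prime_gt_1_nat[OF p(1)] by auto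
      ultimately show ?thesis using less.IH less.prems(3) u' by (metis dvd_mult)
    qed (use less in simp)
  qed
  obtain F :: "int poly" where F: "poly (map_poly of_int F) \<theta> = 0" "lead_coeff F = 1"
    using \<theta> algebraic_int_altdef_ipoly by blast
  have "F \<noteq> 0" using F(2) by auto
  then have "finite {x. poly F x = 0}" by (rule poly_roots_finite)
  then obtain n0 where n0: "poly F n0 \<noteq> 0"
    using infinite_UNIV_int ex_new_if_finite by blast
  \<comment> \<open>As \<open>n0\<close> is not a root, \<open>c\<close> is nonzero. Moving from
    \<open>n0\<close> by multiples of \<open>c * Q\<close> keeps the value of \<open>F\<close>
    divisible by \<open>c\<close>, with quotient 1 modulo \<open>Q\<close>; every prime up to
    \<open>B\<close> divides \<open>Q\<close>, so that quotient has only prime factors above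
    \<open>B\<close>.\<close>
  define c where "c = poly F n0"
  define Q where "Q = (fact (B + 2) :: int)"
  have Q2: "Q \<ge> 2" using fact_ge_self[of "B + 2"] unfolding Q_def
    by (metis (mono_tags, opaque_lifting) add_leD2 le_trans of_nat_fact of_nat_le_iff of_nat_numeral)
  have "of_int (n0 + c * Q * t) - \<theta> zdvd of_int c" for t
  proof -
    let ?n = "n0 + c * Q * t"
    have "?n - n0 dvd ?n ^ i - n0 ^ i" for i by (metis dvd_triv_left power_diff_sumr2)
    then have "?n - n0 dvd (\<Sum>i\<le>degree F. coeff F i * (?n ^ i - n0 ^ i))" by (intro dvd_sum dvd_mult)
    then have "?n - n0 dvd poly F ?n - poly F n0"
      by (simp add: poly_altdef sum_subtractf right_diff_distrib)
    then obtain k where "poly F ?n - c = c * Q * t * k" by (auto simp: c_def)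
    then have Fn: "poly F ?n = c * (1 + Q * (t * k))" by (simp add: algebra_simps)
    define u where "u = 1 + Q * (t * k)"
    have "of_int ?n - \<theta> zdvd (\<Sum>i\<le>degree F. of_int (coeff F i) * (of_int ?n ^ i - \<theta> ^ i))"
      using \<theta> by (intro zdvd_sum zdvd_mult2 zdvd_power_diff zdvd_refl algebraic_int_closed)
    also have "\<dots> = of_int (poly F ?n) - poly (map_poly of_int F) \<theta>"
      by (simp add: poly_altdef degree_map_poly coeff_map_poly right_diff_distrib sum_subtractf)
    finally have d: "of_int ?n - \<theta> zdvd of_int c * of_int u" using F(1) Fn by (simp add: u_def)
    have u0: "u \<noteq> 0"
    proof
      assume "u = 0"
      then have "Q dvd 1" by (metis dvd_add_left_iff dvd_triv_left dvd_0_right u_def)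
      then show False using Q2 by (simp add: zdvd1_eq)
    qed
    have "of_int ?n - \<theta> zdvd of_int c * of_nat (nat \<bar>u\<bar>)"
      using d zdvd_minus[OF d] by (auto simp: abs_if)
    then show ?thesis
    proof (rule cancel)
      show "nat \<bar>u\<bar> > 0" using u0 by simp
      fix p assume p: "prime p" "p dvd nat \<bar>u\<bar>"
      show "p > B"
      proof (rule ccontr)
        assume "\<not> p > B"
        then have "p dvd fact (B + 2)" using p(1) by (intro dvd_fact) (auto simp: Suc_le_eq prime_gt_0_nat)
        then have "int p dvd Q" unfolding Q_def by (metis of_nat_dvd_iff of_nat_fact)
        moreover have "int p dvd u" using p(2) by (simp add: dvd_nat_abs_iff)
        ultimately have "int p dvd 1" unfolding u_def by (metis dvd_add_left_iff dvd_mult2)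
        then show False using p(1) by (simp add: zdvd1_eq)
      qed
    qed
  qed
  then have "range (\<lambda>t. n0 + c * Q * t) \<subseteq> {n. of_int n - \<theta> zdvd of_int c}" by blast
  moreover have "infinite (range (\<lambda>t. n0 + c * Q * t))"
    using n0 Q2 by (subst finite_image_iff) (auto simp: c_def inj_on_def infinite_UNIV_int)
  ultimately show False using finite_zdvd_shift[OF \<theta>, of c] n0 finite_subset by (auto simp: c_def)
qed

lemma power_diff_eq_prod:
  assumes "N > 0" "z \<noteq> (0 :: complex)"
  shows "y ^ N - z ^ N = (\<Prod>a<N. y - zeta N ^ a * z)"
proof -
  have "poly (monom 1 N - 1) (y / z) = poly (\<Prod>j<N. [:- (zeta N ^ j), 1:]) (y / z)"
    by (simp only: power_minus_one_eq_prod[OF assms(1)])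
  then have "(y / z) ^ N - 1 = (\<Prod>j<N. y / z - zeta N ^ j)" by (simp add: poly_monom poly_prod)
  then have "z ^ N * ((y / z) ^ N - 1) = (\<Prod>j<N. z * (y / z - zeta N ^ j))"
    by (simp add: prod.distrib)
  moreover have "z ^ N * ((y / z) ^ N - 1) = y ^ N - z ^ N"
    using assms(2) by (simp add: power_divide right_diff_distrib)
  moreover have "z * (y / z - zeta N ^ j) = y - zeta N ^ j * z" for j
    using assms(2) by (simp add: right_diff_distrib)
  ultimately show ?thesis by simp
qed

text \<open>For a generic integer combination \<open>\<theta>\<close> of the radicals \<open>\<alpha>\<^sub>i\<close>, no other choice of the roots gives the
  same combination. If \<open>\<theta>\<close> is congruent to an integer modulo a prime \<open>M\<close> over a large \<open>p\<close>, comparing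
  \<open>\<theta>\<close> with \<open>\<theta>\<^sup>p\<close> shows that the Frobenius fixes every \<open>\<alpha>\<^sub>i\<close> modulo \<open>M\<close>.\<close>

lemma exists_prime_splitting_radicals:
  fixes \<alpha> :: "nat \<Rightarrow> complex" and e :: "nat \<Rightarrow> int"
  assumes N: "N > 0" and \<alpha>: "\<And>i. i < k \<Longrightarrow> \<alpha> i ^ N = of_int (e i)" and e: "\<And>i. i < k \<Longrightarrow> e i \<noteq> 0"
  obtains p M where "prime p" "p > (B :: nat)" "Zprime M" "of_nat p \<in> M"
    "\<And>i. i < k \<Longrightarrow> \<alpha> i ^ p - \<alpha> i \<in> M"
proof -
  let ?w = "zeta N"
  have wi: "algebraic_int ?w" using N by (rule zeta_algebraic_int)
  have \<alpha>i: "algebraic_int (\<alpha> i)" if "i < k" for i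
    using \<alpha>[OF that] N by (intro algebraic_int_power_root[of "\<alpha> i" N]) (simp_all add: algebraic_int_closed)
  have \<alpha>0: "\<alpha> i \<noteq> 0" if "i < k" for i
    using \<alpha>[OF that] e[OF that] N by (auto simp: power_0_left)
  \<comment> \<open>Exponents of the nontrivial ways to replace each radical by another root;
    \<open>\<delta> c a\<close> is the resulting change of the combination.\<close>
  define A where "A = {a \<in> PiE {..<k} (\<lambda>_. {..<N}). \<exists>i<k. a i \<noteq> 0}"
  have "A \<subseteq> PiE {..<k} (\<lambda>_. {..<N})" by (auto simp: A_def)
  moreover have "finite (PiE {..<k} (\<lambda>_. {..<N}))" by (intro finite_PiE) simp_all
  ultimately have finA: "finite A" by (rule finite_subset)
  define \<delta> where "\<delta> c a = (\<Sum>i<k. of_nat c ^ i * (?w ^ a i * \<alpha> i - \<alpha> i))" for c :: nat and a :: "nat \<Rightarrow> nat"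
  have "finite {c. \<delta> c a = 0}" if a: "a \<in> A" for a
  proof (rule ccontr)
    assume "infinite {c. \<delta> c a = 0}"
    then have zero: "?w ^ a i * \<alpha> i - \<alpha> i = 0" if "i < k" for i
      using Sum_polynomial_eq_0[OF _ that, of "\<lambda>i. ?w ^ a i * \<alpha> i - \<alpha> i"] by (simp add: \<delta>_def)
    obtain i where i: "i < k" "a i \<noteq> 0" "a i < N" using a by (auto simp: A_def PiE_iff)
    then have "?w ^ a i = 1" using zero[OF i(1)] \<alpha>0[OF i(1)] by simp
    then show False using i N zeta_power_eq_1_iff[of N "a i"] by (auto dest: dvd_imp_le)
  qed
  then have "finite (\<Union>a\<in>A. {c. \<delta> c a = 0})" using finA by blast
  then obtain c where c: "c \<notin> (\<Union>a\<in>A. {c. \<delta> c a = 0})"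
    using infinite_UNIV_nat ex_new_if_finite by blast
  have \<delta>i: "algebraic_int (\<delta> c a)" for a
    unfolding \<delta>_def using \<alpha>i wi by (intro algebraic_int_intros) auto
  have "\<forall>a. \<exists>D::nat. a \<in> A \<longrightarrow> D > 0 \<and> \<delta> c a zdvd of_nat D"
    using c \<delta>i zdvd_of_int_exists by (metis (mono_tags, lifting) UN_I mem_Collect_eq)
  then obtain D :: "(nat \<Rightarrow> nat) \<Rightarrow> nat" where D: "\<And>a. a \<in> A \<Longrightarrow> D a > 0 \<and> \<delta> c a zdvd of_nat (D a)" by metis
  define \<theta> where "\<theta> = (\<Sum>i<k. of_nat c ^ i * \<alpha> i)"
  have "algebraic_int \<theta>" unfolding \<theta>_def using \<alpha>i by (intro algebraic_int_intros) auto
  \<comment> \<open>\<open>p\<close> exceeds every \<open>D a\<close>, so it divides none of them,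
    and no \<open>\<delta> c a\<close> with \<open>a\<close> in \<open>A\<close> lies in
    \<open>M\<close>.\<close>
  then obtain p M n where p: "prime p" "p > B + (\<Sum>a\<in>A. D a)" "Zprime M" "of_nat p \<in> M" "of_int n - \<theta> \<in> M"
    by (rule exists_prime_root)
  note M = p(3) and pM = p(4)
  have DM: "\<delta> c a \<notin> M" if a: "a \<in> A" for a
  proof
    assume "\<delta> c a \<in> M"
    then have "of_nat (D a) \<in> M" using D[OF a] Zprime_zdvd[OF M] by blast
    then have "p dvd D a" using Zprime_of_nat_iff[OF M p(1) pM] by blast
    then have "p \<le> D a" using D[OF a] by (auto dest: dvd_imp_le)
    moreover have "D a \<le> (\<Sum>a\<in>A. D a)" using finA a by (intro member_le_sum) auto
    ultimately show False using p(2) by linarith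
  qed
  have frob: "(\<Sum>i<k. of_nat c ^ i * \<alpha> i ^ p) - \<theta> \<in> M"
  proof -
    have ci: "(of_nat c ^ i :: complex) = of_int (int c ^ i)" for i by simp
    have "of_nat p zdvd (\<Sum>i<k. of_int (int c ^ i) * \<alpha> i) ^ (p ^ 1)
        - (\<Sum>i<k. of_int (int c ^ i) * \<alpha> i ^ (p ^ 1))"
      by (rule zdvd_frobenius_iterated[OF p(1)]) (use \<alpha>i in simp)
    then have "of_nat p zdvd \<theta> ^ p - (\<Sum>i<k. of_nat c ^ i * \<alpha> i ^ p)"
      unfolding power_one_right \<theta>_def ci[symmetric] .
    then have 1: "\<theta> ^ p - (\<Sum>i<k. of_nat c ^ i * \<alpha> i ^ p) \<in> M"
      by (rule Zprime_zdvd[OF M pM])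
    have 2: "of_int n ^ p - of_int n \<in> M" using Zprime_zdvd[OF M pM zdvd_fermat[OF p(1)]] .
    have "of_int n - \<theta> zdvd of_int n ^ p - \<theta> ^ p"
      using \<open>algebraic_int \<theta>\<close> by (intro zdvd_power_diff zdvd_refl algebraic_int_closed)
    then have 3: "of_int n ^ p - \<theta> ^ p \<in> M" using Zprime_zdvd[OF M p(5)] by blast
    have "(of_int n - \<theta>) + ((of_int n ^ p - of_int n) - ((of_int n ^ p - \<theta> ^ p)
        + (\<theta> ^ p - (\<Sum>i<k. of_nat c ^ i * \<alpha> i ^ p)))) \<in> M"
      by (intro Zprime_add[OF M] Zprime_diff[OF M] 1 2 3 p(5))
    then show ?thesis by simp
  qed
  \<comment> \<open>By Fermat's theorem \<open>e i ^ p\<close> is congruent to \<open>e i\<close>,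
    so the \<open>p\<close>-th power of \<open>\<alpha> i\<close> is again an \<open>N\<close>-th
    root of \<open>e i\<close> modulo \<open>M\<close>.\<close>
  have "\<exists>a<N. \<alpha> i ^ p - ?w ^ a * \<alpha> i \<in> M" if i: "i < k" for i
  proof -
    have "(\<alpha> i ^ p) ^ N - \<alpha> i ^ N = of_int (e i) ^ p - of_int (e i)"
      by (metis \<alpha>[OF i] mult.commute power_mult)
    also have "\<dots> \<in> M" using Zprime_zdvd[OF M pM zdvd_fermat[OF p(1)]] .
    finally have "(\<Prod>a<N. \<alpha> i ^ p - ?w ^ a * \<alpha> i) \<in> M"
      using power_diff_eq_prod[OF N \<alpha>0[OF i]] by simp
    then have "\<exists>a\<in>{..<N}. \<alpha> i ^ p - ?w ^ a * \<alpha> i \<in> M"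
      by (rule Zprime_prod_mem[OF M]) (intro algebraic_int_intros \<alpha>i i wi)
    then show ?thesis by blast
  qed
  then have "\<forall>i. \<exists>a. i < k \<longrightarrow> a < N \<and> \<alpha> i ^ p - ?w ^ a * \<alpha> i \<in> M" by blast
  then obtain a where a: "\<And>i. i < k \<Longrightarrow> a i < N" "\<And>i. i < k \<Longrightarrow> \<alpha> i ^ p - ?w ^ a i * \<alpha> i \<in> M" by metis
  \<comment> \<open>\<open>A\<close> consists of extensional functions, hence the
    restriction.\<close>
  define b where "b = restrict a {..<k}"
  have "(\<Sum>i<k. of_nat c ^ i * (\<alpha> i ^ p - ?w ^ a i * \<alpha> i)) \<in> M"
  proof (rule Zprime_sum[OF M])
    fix i assume "i \<in> {..<k}"
    then show "of_nat c ^ i * (\<alpha> i ^ p - ?w ^ a i * \<alpha> i) \<in> M"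
      using a(2) by (intro Zprime_mult[OF M] algebraic_int_closed) auto
  qed
  from Zprime_diff[OF M frob this] have "\<delta> c b \<in> M"
    by (simp add: \<delta>_def \<theta>_def b_def right_diff_distrib sum_subtractf)
  then have "b \<notin> A" using DM by blast
  moreover have "b \<in> PiE {..<k} (\<lambda>_. {..<N})" using a(1) by (auto simp: b_def)
  ultimately have "a i = 0" if "i < k" for i using that by (auto simp: A_def b_def)
  then have "\<alpha> i ^ p - \<alpha> i \<in> M" if "i < k" for i using a(2)[OF that] that by simp
  then show thesis using that[of p M] p by simp
qed

text \<open>The radicals are \<open>zeta K\<close> and the real \<open>N\<close>-th roots of the
  members of \<open>S\<close>. When the \<open>p\<close>-th power fixes them modulo
  \<open>M\<close>, the first gives \<open>p\<close> congruent to 1 modulo \<open>K\<close>, and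
  each of the others is congruent to an integer that is the required root modulo
  \<open>p\<close>.\<close>

lemma exists_prime_power_residues:
  assumes N: "N > 0" and S: "finite S" "\<And>q. q \<in> S \<Longrightarrow> prime (q :: nat)"
  obtains p where "prime p" "p > (B :: nat)" "[p = 1] (mod N * \<Prod>S)" "\<And>q. q \<in> S \<Longrightarrow> \<exists>x. [x ^ N = q] (mod p)"
proof -
  define K where "K = N * \<Prod>S"
  have K0: "K > 0" using N S prime_gt_0_nat by (auto simp: K_def prod_pos)
  obtain q where q: "bij_betw q {..<card S} S" using S(1) ex_bij_betw_nat_finite atLeast0LessThan by metis
  define \<alpha> where "\<alpha> i = (if i = 0 then zeta K else of_real (root N (real (q (i - 1)))))" for i
  \<comment> \<open>All radicals must satisfy equations with the common exponent \<open>K\<close>,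
    so the equation of an \<open>N\<close>-th root is raised to the power
    \<open>\<Prod>S\<close>.\<close>
  define e where "e i = (if i = 0 then 1 else int (q (i - 1)) ^ (\<Prod>S))" for i
  have rootN: "(of_real (root N (real j)) :: complex) ^ N = of_nat j" for j
    using N by (simp flip: of_real_power add: real_root_pow_pos2)
  have \<alpha>e: "\<alpha> i ^ K = of_int (e i)" for i
    using zeta_power_self[OF K0] by (simp add: \<alpha>_def e_def K_def power_mult rootN)
  have qS: "q j \<in> S" if "j < card S" for j using q that by (auto simp: bij_betw_def)
  have e0: "e i \<noteq> 0" if "i < Suc (card S)" for i
    using that qS[of "i - 1"] S(2)[of "q (i - 1)"] prime_gt_0_nat by (auto simp: e_def)
  \<comment> \<open>\<open>p > K\<close> makes \<open>p\<close> prime to \<open>K\<close>, so that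
    distinct \<open>K\<close>-th roots of unity stay distinct modulo \<open>M\<close>.\<close>
  obtain p M where p: "prime p" "p > B + K" "Zprime M" "of_nat p \<in> M"
    "\<And>i. i < Suc (card S) \<Longrightarrow> \<alpha> i ^ p - \<alpha> i \<in> M"
    using exists_prime_splitting_radicals[where \<alpha> = \<alpha> and e = e and k = "Suc (card S)" and B = "B + K", OF K0 \<alpha>e e0] by blast
  note M = p(3) and pM = p(4)
  have pK: "\<not> p dvd K" using p(2) K0 by (auto dest: dvd_imp_le)
  have "[p = 1] (mod K)"
  proof -
    let ?z = "zeta K"
    have zi: "algebraic_int ?z" using K0 by (rule zeta_algebraic_int)
    have p1: "p \<ge> 1" using p(1) prime_ge_1_nat by blast
    have zM: "?z \<notin> M"
    proof
      assume "?z \<in> M"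
      then have "?z ^ (K - 1) * ?z \<in> M" using zi by (intro Zprime_mult[OF M] algebraic_int_closed)
      moreover have "?z ^ (K - 1) * ?z = 1" using zeta_power_self[OF K0] K0 by (metis power_minus_mult)
      ultimately show False using Zprime_1[OF M] by simp
    qed
    have "?z * (?z ^ (p - 1) - 1) = \<alpha> 0 ^ p - \<alpha> 0"
      using p1 by (simp add: \<alpha>_def right_diff_distrib power_eq_if)
    then have "?z * (?z ^ (p - 1) - 1) \<in> M" using p(5)[of 0] by simp
    then have 1: "?z ^ (p - 1) - 1 \<in> M"
      using zM Zprime_mult_iff[OF M zi, of "?z ^ (p - 1) - 1"] zi by (auto intro: algebraic_int_closed)
    define j where "j = (p - 1) mod K"
    have jK: "j < K" using K0 by (simp add: j_def)
    have zj: "?z ^ (p - 1) = ?z ^ j" unfolding j_def using K0 by (simp add: zeta_power_mod)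
    have "j = 0"
    proof (rule ccontr)
      assume "j \<noteq> 0"
      then have j: "j \<in> {1..<K}" "K > 1" using jK by auto
      have "(\<Prod>i\<in>{1..<K}. 1 - ?z ^ i) = (1 - ?z ^ j) * (\<Prod>i\<in>{1..<K} - {j}. 1 - ?z ^ i)"
        using j by (intro prod.remove) auto
      then have eq: "of_nat K = (1 - ?z ^ j) * (\<Prod>i\<in>{1..<K} - {j}. 1 - ?z ^ i)"
        using prod_one_minus_zeta[OF j(2)] by simp
      have "1 - ?z ^ j \<in> M" using Zprime_minus[OF M 1] zj by simp
      then have "of_nat K \<in> M" unfolding eq
        using zi by (intro Zprime_mult2[OF M] algebraic_int_intros)
      then show False using Zprime_of_nat_iff[OF M p(1) pM] pK by blast
    qed
    then have "K dvd p - 1" by (simp add: j_def dvd_eq_mod_eq_0)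
    then show ?thesis using p1 by (metis cong_sym cong_altdef_nat)
  qed
  moreover have "\<exists>x. [x ^ N = r] (mod p)" if r: "r \<in> S" for r
  proof -
    obtain j where j: "j < card S" "r = q j" using q r by (auto simp: bij_betw_def)
    let ?a = "of_real (root N (real r)) :: complex"
    have "?a ^ p - ?a \<in> M" using p(5)[of "Suc j"] j by (simp add: \<alpha>_def)
    have "algebraic_int (?a ^ N)" unfolding rootN by (rule algebraic_int_closed(1))
    then have ai: "algebraic_int ?a" using N by (rule algebraic_int_power_root)
    obtain n :: nat where n: "?a - of_nat n \<in> M"
      using Zprime_congruent_integer[OF M p(1) pM ai \<open>?a ^ p - ?a \<in> M\<close>] by blast
    have "?a - of_nat n zdvd ?a ^ N - of_nat n ^ N"
      using ai by (intro zdvd_power_diff zdvd_refl algebraic_int_closed)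
    then have "?a ^ N - of_nat n ^ N \<in> M" using Zprime_zdvd[OF M n] by blast
    then have "of_int (int r - int n ^ N) \<in> M" by (simp add: rootN)
    then have "int p dvd int r - int n ^ N" using Zprime_of_int_iff[OF M p(1) pM] by blast
    then have "[int r = int (n ^ N)] (mod int p)" by (simp add: cong_iff_dvd_diff)
    then have "[n ^ N = r] (mod p)" by (metis cong_int_iff cong_sym)
    then show ?thesis by blast
  qed
  ultimately show thesis using that p(1,2) by (simp add: K_def)
qed

lemma exists_primes_mutual_power_residues:
  assumes N: "N > 0"
  shows "\<exists>p :: nat \<Rightarrow> nat. inj_on p {..<s} \<and> (\<forall>i<s. prime (p i) \<and> [p i = 1] (mod N)) \<and>
    (\<forall>i<s. \<forall>j<s. i \<noteq> j \<longrightarrow> (\<exists>x. [x ^ N = p i] (mod p j)))"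
proof (induction s)
  case (Suc s)
  then obtain p where p: "inj_on p {..<s}" "\<And>i. i < s \<Longrightarrow> prime (p i) \<and> [p i = 1] (mod N)"
    "\<And>i j. i < s \<Longrightarrow> j < s \<Longrightarrow> i \<noteq> j \<Longrightarrow> \<exists>x. [x ^ N = p i] (mod p j)" by blast
  let ?S = "p ` {..<s}"
  have S: "finite ?S" "\<And>q. q \<in> ?S \<Longrightarrow> prime q" using p(2) by auto
  \<comment> \<open>\<open>insert 0\<close> gives \<open>Max\<close> a value when there are no
    earlier primes; the bound makes \<open>r\<close> a new prime.\<close>
  obtain r where r: "prime r" "r > Max (insert 0 ?S)" "[r = 1] (mod N * \<Prod>?S)"
    "\<And>q. q \<in> ?S \<Longrightarrow> \<exists>x. [x ^ N = q] (mod r)"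
    using exists_prime_power_residues[OF N S] by blast
  define p' where "p' = p(s := r)"
  have p's: "p' s = r" and p'i: "\<And>i. i < s \<Longrightarrow> p' i = p i" by (auto simp: p'_def)
  have rS: "r \<notin> ?S"
  proof
    assume "r \<in> ?S"
    then have "r \<le> Max (insert 0 ?S)" using S(1) by (intro Max_ge) auto
    then show False using r(2) by simp
  qed
  have "inj_on p' {..<Suc s}"
    unfolding lessThan_Suc inj_on_insert using p(1) rS p's p'i by (auto simp: inj_on_def)
  moreover have "prime (p' i) \<and> [p' i = 1] (mod N)" if "i < Suc s" for i
    using that p(2) r(1) cong_dvd_modulus_nat[OF r(3), of N] by (cases "i = s") (auto simp: p'_def)
  moreover have "\<exists>x. [x ^ N = p' i] (mod p' j)" if ij: "i < Suc s" "j < Suc s" "i \<noteq> j" for i j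
  proof -
    consider "i < s" "j < s" | "i = s" "j < s" | "i < s" "j = s" using ij by linarith
    then show ?thesis
    proof cases
      case 2
      then have "p j dvd N * \<Prod>?S" using S(1) by (intro dvd_mult dvd_prodI) auto
      then have "[r = 1] (mod p j)" using r(3) cong_dvd_modulus_nat by blast
      then have "[1 ^ N = r] (mod p j)" by (simp add: cong_sym)
      then show ?thesis using 2 p's p'i by metis
    qed (use p(3) r(4) ij p's p'i in auto)
  qed
  ultimately show ?case by blast
qed simp

section \<open>Realization\<close>

lemma prime_primitive_root:
  assumes p: "prime (p :: nat)"
  obtains g where "coprime g p" "\<And>a. coprime a p \<Longrightarrow> \<exists>k. [g ^ k = a] (mod p)"
    "\<And>k l. [g ^ k = g ^ l] (mod p) \<longleftrightarrow> [k = l] (mod p - 1)"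
proof -
  have p1: "p > 1" using p prime_gt_1_nat by blast
  obtain g where g: "residue_primroot p g" using prime_primitive_root_exists[of p] p p1 by auto
  have cg: "coprime p g" and og: "ord p g = p - 1"
    using g p by (auto simp: residue_primroot_def totient_prime)
  have "\<exists>k. [g ^ k = a] (mod p)" if a: "coprime a p" for a
  proof -
    have "\<not> p dvd a"
    proof
      assume "p dvd a"
      then have "p dvd 1" using a by (metis coprime_common_divisor dvd_refl)
      then show False using p1 by simp
    qed
    then have "a mod p \<in> totatives p" using p p1 by (auto simp: totatives_prime dvd_eq_mod_eq_0)
    then obtain k where "a mod p = g ^ k mod p"
      using residue_primroot_is_generator[OF p1 g] by (auto simp: bij_betw_def)
    then show ?thesis by (auto simp: cong_def)
  qed
  then show thesis using that[of g] cg order_divides_expdiff[of p g] og by (simp add: coprime_commute)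
qed

lemma (in group) nat_pow_cong:
  assumes t: "t \<in> carrier G" "t [^] (N::nat) = \<one>" and kl: "[k = l] (mod N)"
  shows "t [^] k = t [^] l"
proof -
  have "t [^] k = t [^] (k mod N)" for k
  proof -
    have "t [^] k = t [^] (N * (k div N) + k mod N)" by simp
    also have "\<dots> = t [^] (N * (k div N)) \<otimes> t [^] (k mod N)" using t by (simp only: nat_pow_mult)
    also have "t [^] (N * (k div N)) = \<one>" using t by (simp add: nat_pow_pow[symmetric])
    finally show ?thesis using t by simp
  qed
  then show ?thesis using kl by (metis cong_def)
qed

text \<open>Triviality on \<open>N\<close>-th powers is what makes decomposition equal to inertia,
  and the exponent \<open>f\<close> on the kernel is the one that \<open>ramified_at\<close>
  needs.\<close>

definition (in comm_group) prime_character :: "nat \<Rightarrow> nat \<Rightarrow> 'a \<Rightarrow> (nat \<Rightarrow> 'a) \<Rightarrow> bool" where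
  "prime_character N p t \<psi> \<longleftrightarrow> (\<forall>a. coprime a p \<longrightarrow> \<psi> a \<in> carrier G) \<and>
    (\<forall>a b. coprime a p \<longrightarrow> coprime b p \<longrightarrow> \<psi> (a * b) = \<psi> a \<otimes> \<psi> b) \<and>
    (\<forall>a b. [a = b] (mod p) \<longrightarrow> \<psi> a = \<psi> b) \<and>
    \<psi> ` {a. coprime a p} = generate G {t} \<and>
    (\<forall>a x. coprime a p \<longrightarrow> [x ^ N = a] (mod p) \<longrightarrow> \<psi> a = \<one>) \<and>
    (t \<noteq> \<one> \<longrightarrow> (\<exists>f\<ge>1. f < p - 1 \<and> (\<forall>h. coprime h p \<longrightarrow> \<psi> h = \<one> \<longrightarrow> [h ^ f = 1] (mod p))))"

text \<open>The character sends a primitive root to \<open>t\<close>.\<close>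

lemma (in comm_group) prime_character_exists:
  assumes fin: "finite (carrier G)" and p: "prime p" and N: "[p = 1] (mod N)" "N > 0"
    and t: "t \<in> carrier G" "t [^] N = \<one>"
  shows "\<exists>\<psi>. prime_character N p t \<psi>"
proof -
  have p1: "p > 1" using p prime_gt_1_nat by blast
  obtain g where cg: "coprime g p" and log: "\<And>a. coprime a p \<Longrightarrow> \<exists>k. [g ^ k = a] (mod p)"
    and exp_iff: "\<And>k l. [g ^ k = g ^ l] (mod p) \<longleftrightarrow> [k = l] (mod p - 1)"
    using prime_primitive_root[OF p] by blast
  have Np: "N dvd p - 1"
    using N(1) p1 by (metis cong_sym cong_altdef_nat less_imp_le)
  \<comment> \<open>The predicate depends only on the class of \<open>a\<close> modulo
    \<open>p\<close>, so the chosen logarithm does too, even when \<open>p\<close> divides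
    \<open>a\<close>.\<close>
  define ind where "ind a = (SOME k. [g ^ k = a] (mod p))" for a
  have ind: "[g ^ ind a = a] (mod p)" if "coprime a p" for a
    unfolding ind_def using log[OF that] by (rule someI_ex)
  have ind_cong: "ind a = ind b" if "[a = b] (mod p)" for a b
    unfolding ind_def using that by (metis cong_sym cong_trans)
  have exp_N: "t [^] k = t [^] l" if "[g ^ k = g ^ l] (mod p)" for k l
    using that cong_dvd_modulus_nat[OF _ Np] nat_pow_cong[OF t] exp_iff by blast
  define \<psi> where "\<psi> a = t [^] ind a" for a
  have psi_g: "\<psi> a = t [^] k" if "coprime a p" "[g ^ k = a] (mod p)" for a k
    unfolding \<psi>_def using ind[OF that(1)] that(2) by (intro exp_N) (metis cong_sym cong_trans)
  have cgk: "coprime (g ^ k) p" for k using cg by simp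
  have "prime_character N p t \<psi>"
    unfolding prime_character_def
  proof (intro conjI allI impI)
    show "\<psi> a \<in> carrier G" for a using t by (simp add: \<psi>_def)
    show "\<psi> a = \<psi> b" if "[a = b] (mod p)" for a b using ind_cong[OF that] by (simp add: \<psi>_def)
    show "\<psi> (a * b) = \<psi> a \<otimes> \<psi> b" if ab: "coprime a p" "coprime b p" for a b
    proof -
      have "[g ^ (ind a + ind b) = a * b] (mod p)"
        unfolding power_add using ind ab by (intro cong_mult)
      then have "\<psi> (a * b) = t [^] (ind a + ind b)" using ab by (intro psi_g) simp_all
      then show ?thesis using t by (simp add: \<psi>_def nat_pow_mult)
    qed
    show "\<psi> ` {a. coprime a p} = generate G {t}"
      unfolding generate_pow_on_finite_carrier[OF fin t(1)]
    proof
      show "\<psi> ` {a. coprime a p} \<subseteq> {t [^] k |k. k \<in> (UNIV :: nat set)}" by (auto simp: \<psi>_def)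
      show "{t [^] k |k. k \<in> (UNIV :: nat set)} \<subseteq> \<psi> ` {a. coprime a p}"
      proof
        fix y assume "y \<in> {t [^] k |k. k \<in> (UNIV :: nat set)}"
        then obtain k :: nat where "y = t [^] k" by blast
        then have "y = \<psi> (g ^ k)" using psi_g[OF cgk cong_refl] by simp
        then show "y \<in> \<psi> ` {a. coprime a p}" using cgk by blast
      qed
    qed
    show "\<psi> a = \<one>" if ax: "coprime a p" "[x ^ N = a] (mod p)" for a x
    proof -
      have "coprime (x ^ N) p" using ax by (metis cong_imp_coprime cong_sym)
      then have "coprime x p" using N(2) by simp
      then have "[(g ^ ind x) ^ N = x ^ N] (mod p)" using ind by (intro cong_pow)
      then have "[g ^ (ind x * N) = a] (mod p)"
        using ax(2) by (metis cong_trans power_mult)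
      then have "\<psi> a = t [^] (ind x * N)" using ax by (intro psi_g)
      also have "\<dots> = \<one>" using t by (metis mult.commute nat_pow_pow nat_pow_one)
      finally show ?thesis .
    qed
    show "\<exists>f\<ge>1. f < p - 1 \<and> (\<forall>h. coprime h p \<longrightarrow> \<psi> h = \<one> \<longrightarrow> [h ^ f = 1] (mod p))" if t1: "t \<noteq> \<one>"
    proof -
      \<comment> \<open>Logarithms of kernel elements are multiples of \<open>n\<close>, so these
        elements have order dividing \<open>f = (p - 1) div n\<close>; \<open>f\<close> is smaller
        than \<open>p - 1\<close> because \<open>n\<close> is not 1.\<close>
      define n where "n = group.ord G t"
      have n1: "n \<noteq> 1" using t1 t(1) ord_eq_1[OF t(1)] by (simp only: n_def not_False_eq_True)
      have "n dvd N" using t pow_eq_id by (simp add: n_def)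
      then have np: "n dvd p - 1" using Np dvd_trans by blast
      define f where "f = (p - 1) div n"
      have f: "p - 1 = n * f" using np by (simp add: f_def)
      have "f \<noteq> 0" "n \<noteq> 0" using f p1 by (auto intro: Nat.gr0I)
      then have "f < p - 1" "f \<ge> 1" using f n1 by auto
      moreover have "[h ^ f = 1] (mod p)" if h: "coprime h p" "\<psi> h = \<one>" for h
      proof -
        have "n dvd ind h" using h(2) t(1) pow_eq_id by (simp add: \<psi>_def n_def)
        then obtain j where j: "ind h = n * j" by blast
        have "[(g ^ ind h) ^ f = h ^ f] (mod p)" using ind[OF h(1)] by (rule cong_pow)
        moreover have "(g ^ ind h) ^ f = (g ^ (p - 1)) ^ j"
          unfolding f j by (simp add: power_mult[symmetric] mult_ac)
        moreover have "[g ^ (p - 1) = g ^ 0] (mod p)" unfolding exp_iff by (simp add: cong_def)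
        then have "[(g ^ (p - 1)) ^ j = (g ^ 0) ^ j] (mod p)" by (rule cong_pow)
        ultimately show ?thesis by (metis cong_sym cong_trans power_one power_0)
      qed
      ultimately show ?thesis by blast
    qed
  qed
  then show ?thesis by blast
qed

section \<open>Generators of a ramification configuration\<close>

lemma (in comm_group) conj_closure_eq:
  assumes "S \<subseteq> carrier G" shows "conj_closure G S = S"
proof -
  have eq: "x \<otimes> s \<otimes> inv x = s" if "x \<in> carrier G" "s \<in> S" for x s
  proof -
    have s: "s \<in> carrier G" using assms that by blast
    have "x \<otimes> s \<otimes> inv x = s \<otimes> x \<otimes> inv x" using that s by (simp only: m_comm)
    also have "\<dots> = s \<otimes> (x \<otimes> inv x)" using that s by (intro m_assoc) simp_all
    finally have "x \<otimes> s \<otimes> inv x = s \<otimes> (x \<otimes> inv x)" .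
    then show ?thesis using that s by simp
  qed
  show ?thesis
  proof
    show "conj_closure G S \<subseteq> S" unfolding conj_closure_def using eq by auto
    show "S \<subseteq> conj_closure G S"
    proof
      fix s assume "s \<in> S"
      then have "s = \<one> \<otimes> s \<otimes> inv \<one>" using eq[OF one_closed] by simp
      then show "s \<in> conj_closure G S" unfolding conj_closure_def using \<open>s \<in> S\<close> by blast
    qed
  qed
qed

text \<open>By minimality of the rank no generator of a ramification configuration is trivial.\<close>

lemma (in comm_group) config_generators:
  assumes "tame_ram_config G s T"
  obtains t where "\<And>i. i < s \<Longrightarrow> t i \<in> carrier G" "\<And>i. i < s \<Longrightarrow> T i = generate G {t i}"
    "generate G (\<Union>i<s. T i) = carrier G" "\<And>i. i < s \<Longrightarrow> t i \<noteq> \<one>"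
proof -
  have s: "s = grp_rank G" and T: "\<forall>i<s. cyclic_subgroup G (T i)"
    and gen: "generate G (conj_closure G (\<Union>i<s. T i)) = carrier G"
    using assms by (auto simp: tame_ram_config_def)
  have "\<forall>i. \<exists>g. i < s \<longrightarrow> g \<in> carrier G \<and> T i = generate G {g}"
    using T unfolding cyclic_subgroup_def by blast
  then obtain t where t: "\<And>i. i < s \<Longrightarrow> t i \<in> carrier G" "\<And>i. i < s \<Longrightarrow> T i = generate G {t i}" by metis
  have TG: "(\<Union>i<s. T i) \<subseteq> carrier G"
  proof (rule UN_least)
    fix i assume "i \<in> {..<s}"
    then show "T i \<subseteq> carrier G" using t generate_incl[of "{t i}"] by simp
  qed
  have gen': "generate G (\<Union>i<s. T i) = carrier G" using gen conj_closure_eq[OF TG] by simp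
  have "t i \<noteq> \<one>" if i: "i < s" for i
  proof
    assume ti: "t i = \<one>"
    \<comment> \<open>The last generator takes the place of the trivial one, so the first
      \<open>s - 1\<close> entries of \<open>g\<close> already generate \<open>G\<close>, against
      minimality.\<close>
    define g where "g j = (if j = i then t (s - 1) else t j)" for j
    have gG: "g j \<in> carrier G" if "j < s" for j using t(1) that by (auto simp: g_def)
    let ?S = "g ` {..<s - 1}"
    have SG: "?S \<subseteq> carrier G" using gG by auto
    have sub: "subgroup (generate G ?S) G" by (rule generate_is_subgroup[OF SG])
    have tj: "t j \<in> generate G ?S" if "j < s" for j
    proof -
      from that have "j = i \<or> j \<noteq> i \<and> j < s - 1 \<or> j \<noteq> i \<and> j = s - 1" by linarith
      then consider "j = i" | "j \<noteq> i" "j < s - 1" | "j \<noteq> i" "j = s - 1" by blast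
      then show ?thesis
      proof cases
        case 1
        then show ?thesis using ti subgroup.one_closed[OF sub] by simp
      next
        case 2
        then have "t j = g j" by (simp add: g_def)
        then show ?thesis using 2 by (intro generate.incl) auto
      next
        case 3
        then have "t j = g i" "i < s - 1" using i by (auto simp: g_def)
        then show ?thesis by (intro generate.incl) auto
      qed
    qed
    have "(\<Union>i<s. T i) \<subseteq> generate G ?S"
    proof (rule UN_least)
      fix j assume "j \<in> {..<s}"
      then show "T j \<subseteq> generate G ?S"
        using tj t(2) generate_subgroup_incl[OF _ sub, of "{t j}"] by simp
    qed
    then have "carrier G \<subseteq> generate G ?S" using generate_subgroup_incl[OF _ sub] gen' by blast
    then have "generate G (conj_closure G ?S) = carrier G"
      using conj_closure_eq[OF SG] generate_incl[OF SG] by auto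
    then have "grp_rank G \<le> s - 1"
      unfolding grp_rank_def by (intro Least_le exI[of _ g]) (use gG in auto)
    then show False using s i by simp
  qed
  then show thesis using that t gen' by blast
qed

section \<open>Assembling the global character and the field\<close>

lemma (in comm_group) subgroup_character_image:
  assumes m: "m > 0"
    and closed: "\<And>a. coprime a m \<Longrightarrow> \<chi> a \<in> carrier G"
    and mult: "\<And>a b. coprime a m \<Longrightarrow> coprime b m \<Longrightarrow> \<chi> (a * b) = \<chi> a \<otimes> \<chi> b"
    and cong: "\<And>a b :: nat. [a = b] (mod m) \<Longrightarrow> \<chi> a = \<chi> b"
  shows "subgroup (\<chi> ` {a. coprime a m}) G"
proof (rule subgroupI)
  show "\<chi> ` {a. coprime a m} \<subseteq> carrier G" using closed by blast
  show "\<chi> ` {a. coprime a m} \<noteq> {}" by (auto intro: exI[of _ 1])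
next
  fix y assume "y \<in> \<chi> ` {a. coprime a m}"
  then obtain a where a: "coprime a m" "y = \<chi> a" by blast
  then obtain b where b: "[a * b = 1] (mod m)" using cong_solve_coprime_nat by auto
  then have cb: "coprime b m"
    using coprime_iff_invertible_nat by (metis One_nat_def mult.commute)
  have "\<chi> 1 \<otimes> \<chi> 1 = \<chi> 1" using mult[of 1 1] by simp
  then have one: "\<chi> 1 = \<one>" using closed[of 1] by (metis coprime_1_left l_cancel_one')
  have "\<chi> b \<otimes> \<chi> a = \<one>" using mult[OF cb a(1)] cong[OF b] one by (simp add: mult.commute)
  then have "inv y = \<chi> b" using closed cb a by (metis inv_equality)
  then show "inv y \<in> \<chi> ` {a. coprime a m}" using cb by blast
next
  fix y z assume "y \<in> \<chi> ` {a. coprime a m}" "z \<in> \<chi> ` {a. coprime a m}"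
  then obtain a b where "coprime a m" "y = \<chi> a" "coprime b m" "z = \<chi> b" by blast
  then show "y \<otimes> z \<in> \<chi> ` {a. coprime a m}"
    using mult[of a b] by (intro image_eqI[of _ _ "a * b"]) simp_all
qed

lemma (in comm_group) realization:
  assumes fin: "finite (carrier G)" and config: "tame_ram_config G s T" and Z: "\<And>i. i < s \<Longrightarrow> Z i = T i"
  shows "realizable_decomp G s T Z"
proof -
  obtain t where t: "\<And>i. i < s \<Longrightarrow> t i \<in> carrier G" "\<And>i. i < s \<Longrightarrow> T i = generate G {t i}"
    "generate G (\<Union>i<s. T i) = carrier G" "\<And>i. i < s \<Longrightarrow> t i \<noteq> \<one>"
    using config_generators[OF config] by blast
  \<comment> \<open>The order of \<open>G\<close> kills each \<open>t i\<close>, so it serves as one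
    exponent for all the power residue conditions.\<close>
  define N where "N = Coset.order G"
  have N0: "N > 0" using fin by (simp add: N_def order_gt_0_iff_finite)
  have tN: "t i [^] N = \<one>" if "i < s" for i using t(1)[OF that] by (simp add: N_def pow_order_eq_1)
  obtain p :: "nat \<Rightarrow> nat" where p: "inj_on p {..<s}" "\<And>i. i < s \<Longrightarrow> prime (p i)"
    "\<And>i. i < s \<Longrightarrow> [p i = 1] (mod N)"
    "\<And>i j. i < s \<Longrightarrow> j < s \<Longrightarrow> i \<noteq> j \<Longrightarrow> \<exists>x. [x ^ N = p i] (mod p j)"
    using exists_primes_mutual_power_residues[OF N0, of s] by blast
  have "\<forall>i. \<exists>\<psi>. i < s \<longrightarrow> prime_character N (p i) (t i) \<psi>"
    using prime_character_exists[OF fin p(2,3) N0 t(1) tN] by blast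
  then obtain \<psi> where psi: "\<And>i. i < s \<Longrightarrow> prime_character N (p i) (t i) (\<psi> i)" by metis
  note psi = psi[unfolded prime_character_def]
  have psi_T: "\<psi> i ` {a. coprime a (p i)} = T i" if "i < s" for i
    unfolding t(2)[OF that] using psi[OF that] by (elim conjE)
  have psi_cong: "\<psi> i a = \<psi> i b" if "i < s" "[a = b] (mod p i)" for i a b
    using psi[OF that(1)] that(2) by (elim conjE) (drule spec, drule spec, erule mp)
  have psi_exp: "\<exists>f\<ge>1. f < p i - 1 \<and> (\<forall>h. coprime h (p i) \<longrightarrow> \<psi> i h = \<one> \<longrightarrow> [h ^ f = 1] (mod p i))"
    if "i < s" for i
    using psi[OF that] t(4)[OF that] by (elim conjE) (erule mp)
  have psi_power: "\<psi> i a = \<one>" if "i < s" "coprime a (p i)" "[x ^ N = a] (mod p i)" for i a x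
    using psi[OF that(1)] that(2,3) by (elim conjE) (drule spec, drule spec, drule mp, assumption, erule mp)
  define m where "m = (\<Prod>i<s. p i)"
  have m0: "m > 0" using p(2) prime_gt_0_nat by (auto simp: m_def intro!: prod_pos)
  have cop: "coprime a m \<longleftrightarrow> (\<forall>i<s. coprime a (p i))" for a
  proof
    assume a: "coprime a m"
    show "\<forall>i<s. coprime a (p i)"
    proof (intro allI impI)
      fix i assume "i < s"
      then have "p i dvd m" unfolding m_def by (intro dvd_prodI) auto
      then show "coprime a (p i)" using a coprime_divisors[of a a "p i" m] by simp
    qed
  next
    assume "\<forall>i<s. coprime a (p i)"
    then show "coprime a m" unfolding m_def by (intro prod_coprime_right) simp
  qed
  have pij: "coprime (p i) (p j)" if "i < s" "j < s" "i \<noteq> j" for i j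
    using that p(1,2) by (intro primes_coprime) (auto simp: inj_on_def)
  \<comment> \<open>The local characters are only known to take values in \<open>G\<close> on
    coprime residues. Restricting the family makes congruent arguments give equal functions, so
    \<chi> is well defined modulo \<open>m\<close> on all residues.\<close>
  define \<chi> where "\<chi> a = finprod G (\<lambda>i\<in>{..<s}. \<psi> i a) {..<s}" for a
  have psi_closed: "(\<lambda>i. \<psi> i a) \<in> {..<s} \<rightarrow> carrier G" if "coprime a m" for a
    using psi that cop by auto
  have chi_eq: "\<chi> a = finprod G (\<lambda>i. \<psi> i a) {..<s}" if "coprime a m" for a
    unfolding \<chi>_def using psi_closed[OF that] by (intro finprod_cong') auto
  have chi_single: "\<chi> a = \<psi> i a"
    if i: "i < s" and a: "coprime a m" and other: "\<And>j. j < s \<Longrightarrow> j \<noteq> i \<Longrightarrow> \<psi> j a = \<one>" for a i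
  proof -
    have "\<chi> a = finprod G (\<lambda>j. if i = j then \<psi> j a else \<one>) {..<s}"
      unfolding chi_eq[OF a] using other psi_closed[OF a] i by (intro finprod_cong') auto
    also have "\<dots> = \<psi> i a"
      using i psi_closed[OF a] by (intro finprod_singleton) auto
    finally show ?thesis .
  qed
  have psi_1: "\<psi> j a = \<one>" if "j < s" "[a = 1] (mod p j)" for j a
  proof -
    have "coprime a (p j)" using that(2) by (metis cong_imp_coprime cong_sym coprime_1_left)
    moreover have "[1 ^ N = a] (mod p j)" using that(2) by (simp add: cong_sym)
    ultimately show ?thesis using psi_power[OF that(1)] by blast
  qed
  have crt: "\<exists>a. coprime a m \<and> [a = b] (mod p i) \<and> (\<forall>j<s. j \<noteq> i \<longrightarrow> [a = c] (mod p j))"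
    if i: "i < s" and b: "coprime b (p i)" and c: "\<And>j. j < s \<Longrightarrow> j \<noteq> i \<Longrightarrow> coprime c (p j)" for i b c
  proof -
    obtain a where a: "\<forall>j\<in>{..<s}. [a = (if j = i then b else c)] (mod p j)"
      using chinese_remainder_nat[of "{..<s}" p "\<lambda>j. if j = i then b else c"] pij by auto
    have "coprime a (p j)" if j: "j < s" for j
    proof -
      have "coprime (if j = i then b else c) (p j)" using b c j by simp
      then show ?thesis using a j cong_imp_coprime cong_sym lessThan_iff by metis
    qed
    moreover have "[a = b] (mod p i)" using a[rule_format, of i] i by simp
    moreover have "[a = c] (mod p j)" if "j < s" "j \<noteq> i" for j using a[rule_format, of j] that by simp
    ultimately show ?thesis using cop by blast
  qed
  have closed: "\<chi> a \<in> carrier G" if "coprime a m" for a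
    unfolding chi_eq[OF that] using psi_closed[OF that] by (rule finprod_closed)
  have mult: "\<chi> (a * b) = \<chi> a \<otimes> \<chi> b" if ab: "coprime a m" "coprime b m" for a b
  proof -
    have "\<chi> (a * b) = finprod G (\<lambda>i. \<psi> i a \<otimes> \<psi> i b) {..<s}"
    proof -
      have "coprime (a * b) m" using ab by simp
      then show ?thesis unfolding chi_eq[OF \<open>coprime (a * b) m\<close>]
        using psi ab cop by (intro finprod_cong') auto
    qed
    then show ?thesis unfolding chi_eq[OF ab(1)] chi_eq[OF ab(2)]
      using finprod_multf[OF psi_closed[OF ab(1)] psi_closed[OF ab(2)]] by simp
  qed
  have cong: "\<chi> a = \<chi> b" if ab: "[a = b] (mod m)" for a b
  proof -
    have "\<psi> i a = \<psi> i b" if "i < s" for i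
    proof -
      have "p i dvd m" unfolding m_def using that by (intro dvd_prodI) auto
      then show ?thesis using psi_cong[OF that] cong_dvd_modulus_nat[OF ab] by blast
    qed
    then have "(\<lambda>i\<in>{..<s}. \<psi> i a) = (\<lambda>i\<in>{..<s}. \<psi> i b)" by (auto simp: restrict_def)
    then show ?thesis by (simp only: \<chi>_def)
  qed
  \<comment> \<open>The inertia group at \<open>p i\<close> consists of the residues that are 1 at
    all other primes; by the Chinese remainder theorem their images already fill
    \<open>T i\<close>.\<close>
  have T_char: "T i \<subseteq> \<chi> ` {a. coprime a m \<and> (\<forall>j<s. j \<noteq> i \<longrightarrow> [a = 1] (mod p j))}" if i: "i < s" for i
  proof
    fix y assume "y \<in> T i"
    then obtain b where b: "coprime b (p i)" "y = \<psi> i b" using psi_T[OF i] by blast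
    obtain a where a: "coprime a m" "[a = b] (mod p i)" "\<And>j. j < s \<Longrightarrow> j \<noteq> i \<Longrightarrow> [a = 1] (mod p j)"
      using crt[OF i b(1), of 1] by auto
    have "\<chi> a = \<psi> i a" using a psi_1 i by (intro chi_single) auto
    also have "\<dots> = y" using psi_cong[OF i a(2)] b(2) by simp
    finally show "y \<in> \<chi> ` {a. coprime a m \<and> (\<forall>j<s. j \<noteq> i \<longrightarrow> [a = 1] (mod p j))}" using a(1,3) by blast
  qed
  interpret character: abelian_cyclotomic m G \<chi>
  proof unfold_locales
    show "\<exists>a. coprime a m \<and> \<chi> a = g" if g: "g \<in> carrier G" for g
    proof -
      have sub: "subgroup (\<chi> ` {a. coprime a m}) G"
        by (rule subgroup_character_image[OF m0 closed mult cong])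
      have "(\<Union>i<s. T i) \<subseteq> \<chi> ` {a. coprime a m}" using T_char by blast
      then have "carrier G \<subseteq> \<chi> ` {a. coprime a m}"
        using generate_subgroup_incl[OF _ sub] t(3) by blast
      then show ?thesis using g by blast
    qed
  qed (fact m0 closed mult cong)+
  let ?K = character.K
  have local: "(\<exists>P\<in>primes_over ?K (p i). character.\<phi> ` inertia_group ?K P = T i \<and>
      character.\<phi> ` decomposition_group ?K P = T i \<and> of_nat (p i) \<in> ideal_pow ?K P 2) \<and>
      (\<forall>P\<in>primes_over ?K (p i). \<forall>k\<ge>p i. of_nat (p i) \<notin> ideal_pow ?K P k)" if i: "i < s" for i
  proof -
    define m' where "m' = (\<Prod>j\<in>{..<s} - {i}. p j)"
    have m_eq: "m = p i * m'" unfolding m_def m'_def using i by (intro prod.remove) auto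
    have pm': "coprime (p i) m'" unfolding m'_def using pij i by (intro prod_coprime_right) auto
    have "\<not> p i dvd m'"
    proof
      assume "p i dvd m'"
      then have "p i dvd 1" using pm' by (metis coprime_common_divisor dvd_refl)
      then show False using p(2)[OF i] by auto
    qed
    then interpret at: abelian_cyclotomic_at m G \<chi> "p i" m'
      by unfold_locales (use p(2)[OF i] m_eq in auto)
    have cong_m': "[a = 1] (mod m') \<longleftrightarrow> (\<forall>j<s. j \<noteq> i \<longrightarrow> [a = 1] (mod p j))" for a
    proof
      assume "[a = 1] (mod m')"
      moreover have "p j dvd m'" if "j < s" "j \<noteq> i" for j
        unfolding m'_def using that by (intro dvd_prodI) auto
      ultimately show "\<forall>j<s. j \<noteq> i \<longrightarrow> [a = 1] (mod p j)" using cong_dvd_modulus_nat by blast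
    next
      assume "\<forall>j<s. j \<noteq> i \<longrightarrow> [a = 1] (mod p j)"
      then show "[a = 1] (mod m')" unfolding m'_def
        using pij by (intro coprime_cong_prod_nat) auto
    qed
    have psi_I: "\<chi> a = \<psi> i a" if "coprime a m" "[a = 1] (mod m')" for a
      using that psi_1 cong_m' i by (intro chi_single) auto
    have IT: "\<chi> ` at.I = T i"
    proof
      show "\<chi> ` at.I \<subseteq> T i"
      proof
        fix y assume "y \<in> \<chi> ` at.I"
        then obtain a where a: "coprime a m" "[a = 1] (mod m')" "y = \<chi> a"
          by (auto simp: at.I_def character.U_def)
        then have "y = \<psi> i a" using psi_I by simp
        moreover have "coprime a (p i)" using a(1) cop i by blast
          ultimately show "y \<in> T i" using psi_T[OF i] by blast
      qed
      show "T i \<subseteq> \<chi> ` at.I"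
      proof
        fix y assume "y \<in> T i"
        then obtain a where a: "coprime a m" "[a = 1] (mod m')" "y = \<chi> a"
          using T_char[OF i] cong_m' by blast
        then have "a mod m \<in> at.I" using at.dvd_m(2)
          by (simp add: at.I_def character.mod_in_U cong_def mod_mod_cancel)
        moreover have "y = \<chi> (a mod m)" using a(3) character.chi_mod by simp
        ultimately show "y \<in> \<chi> ` at.I" by blast
      qed
    qed
    obtain M where M: "Zprime M" "of_nat (p i) \<in> M" using Zprime_over_prime[OF p(2)[OF i]] by blast
    let ?P = "at.PM M"
    \<comment> \<open>\<open>b\<close> represents the Frobenius at \<open>p i\<close> of the rest of
      the conductor, extended by 1 at \<open>p i\<close>. Each local character is trivial on it: at
      \<open>p i\<close> since \<open>b\<close> is 1 there, elsewhere since \<open>p i\<close> is an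
      \<open>N\<close>-th power.\<close>
    obtain b where b: "coprime b m" "[b = 1] (mod p i)" "\<And>j. j < s \<Longrightarrow> j \<noteq> i \<Longrightarrow> [b = p i] (mod p j)"
      using crt[OF i, of 1 "p i"] pij[OF i] by auto
    have "\<psi> j b = \<one>" if j: "j < s" for j
    proof (cases "j = i")
      case True
      then show ?thesis using psi_1[OF i b(2)] by simp
    next
      case False
      then obtain x where "[x ^ N = p i] (mod p j)" using p(4)[OF i j] by auto
      then have "[x ^ N = b] (mod p j)" using b(3)[OF j False] by (metis cong_sym cong_trans)
      moreover have "coprime b (p j)" using b(1) cop j by blast
      ultimately show ?thesis using psi_power[OF j] by blast
    qed
    then have "\<chi> b = \<one>" using psi_1[OF i b(2)] b(1) i chi_single by metis
    then have bH: "b mod m \<in> character.H" using b(1) by (simp add: character.H_def character.mod_in_U character.chi_mod)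
    have "[b = p i] (mod m')" unfolding m'_def
      using b(3) pij by (intro coprime_cong_prod_nat) auto
    then have bm': "[b mod m = p i] (mod m')"
      using at.dvd_m(2) by (simp add: cong_def mod_mod_cancel)
    obtain f where f: "f \<ge> 1" "f < p i - 1"
      "\<And>h. coprime h (p i) \<Longrightarrow> \<psi> i h = \<one> \<Longrightarrow> [h ^ f = 1] (mod p i)" using psi_exp[OF i] by blast
    \<comment> \<open>For \<open>h\<close> congruent to 1 modulo \<open>m'\<close>,
      \<open>\<chi> h\<close> is the single local factor \<open>\<psi> i h\<close>, so
      \<open>HI\<close> lies in the kernel of \<open>\<psi> i\<close>.\<close>
    have "[h ^ f = 1] (mod p i)" if "h \<in> at.HI" for h
    proof -
      have h: "coprime h m" "\<chi> h = \<one>" "[h = 1] (mod m')"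
        using that by (auto simp: at.HI_def character.H_def character.U_def)
      then have "\<psi> i h = \<one>" using psi_I by simp
      then show ?thesis using f(3) h(1) cop i by blast
    qed
    then have "of_nat (p i) \<in> ideal_pow ?K ?P 2" by (rule at.ramified_at[OF M f(1,2)])
    moreover have "character.\<phi> ` inertia_group ?K ?P = T i" "character.\<phi> ` decomposition_group ?K ?P = T i"
      using at.inertia_decomposition[OF M bH bm'] IT by simp_all
    moreover have "?P \<in> primes_over ?K (p i)" by (rule at.PM_over[OF M])
    moreover have "\<forall>P\<in>primes_over ?K (p i). \<forall>k\<ge>p i. of_nat (p i) \<notin> ideal_pow ?K P k"
      using at.tame_at by blast
    ultimately show ?thesis by blast
  qed
  have dvd_iff: "q dvd m \<longleftrightarrow> q \<in> p ` {..<s}" if q: "prime q" for q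
  proof
    assume "q dvd m"
    then obtain i where i: "i < s" "q dvd p i"
      unfolding m_def using q by (auto simp: prime_dvd_prod_iff)
    then have "q = p i" using p(2) q primes_dvd_imp_eq by blast
    then show "q \<in> p ` {..<s}" using i by blast
  qed (auto simp: m_def intro!: dvd_prodI)
  \<comment> \<open>Every \<open>q\<close> divides 0, so the exponent 0 has to be excluded before an
    exponent below \<open>q\<close> can be called prime to \<open>q\<close>.\<close>
  have ram_pos: "n \<noteq> 0" if "P \<in> primes_over ?K q" "ram_index_is ?K P q n" for P q n
  proof
    assume "n = 0"
    then have "of_nat q \<notin> add_span {a * b |a b. a \<in> P \<and> b \<in> ring_of_integers ?K}"
      using that(2) by (simp add: ram_index_is_def)
    moreover have "1 \<in> ring_of_integers ?K"
      using character.K_1 by (simp add: mem_ring_of_integers algebraic_int_closed)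
    then have "of_nat q * 1 \<in> add_span {a * b |a b. a \<in> P \<and> b \<in> ring_of_integers ?K}"
      using primes_overD(2)[OF that(1)] by (intro add_span_base) blast
    ultimately show False by simp
  qed
  have tame: "tamely_ramified ?K"
    unfolding tamely_ramified_def
  proof (intro allI impI)
    fix q P n assume asm: "prime q \<and> P \<in> primes_over ?K q \<and> ram_index_is ?K P q n"
    then have n0: "n \<noteq> 0" using ram_pos by blast
    have "n < q"
    proof (cases "q dvd m")
      case True
      then obtain i where "i < s" "q = p i" using dvd_iff asm by blast
      then have "\<not> n \<ge> q" using local[of i] asm by (auto simp: ram_index_is_def)
      then show ?thesis by simp
    next
      case False
      then have "\<not> n \<ge> 2" using character.unramified_outside asm by (auto simp: ram_index_is_def)
      then show ?thesis using asm prime_ge_2_nat[of q] by linarith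
    qed
    then show "\<not> q dvd n" using n0 by (auto dest: dvd_imp_le)
  qed
  have ram: "{q. prime q \<and> ramified_in ?K q} = p ` {..<s}"
  proof (intro equalityI subsetI)
    fix q assume "q \<in> {q. prime q \<and> ramified_in ?K q}"
    then have q: "prime q" "ramified_in ?K q" by auto
    then have "q dvd m" using character.unramified_outside[OF q(1)] by (auto simp: ramified_in_def)
    then show "q \<in> p ` {..<s}" using dvd_iff q(1) by blast
  next
    fix q assume "q \<in> p ` {..<s}"
    then obtain i where "i < s" "q = p i" by blast
    then show "q \<in> {q. prime q \<and> ramified_in ?K q}"
      using local[of i] p(2) by (auto simp: ramified_in_def)
  qed
  have "\<forall>i. \<exists>P. i < s \<longrightarrow> P \<in> primes_over ?K (p i) \<and> character.\<phi> ` inertia_group ?K P = T i \<and>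
      character.\<phi> ` decomposition_group ?K P = T i" using local by blast
  then obtain Pr where "\<And>i. i < s \<Longrightarrow> Pr i \<in> primes_over ?K (p i) \<and>
      character.\<phi> ` inertia_group ?K (Pr i) = T i \<and> character.\<phi> ` decomposition_group ?K (Pr i) = T i"
    by metis
  then have "\<forall>i<s. Pr i \<in> primes_over ?K (p i) \<and>
      character.\<phi> ` inertia_group ?K (Pr i) = T i \<and> character.\<phi> ` decomposition_group ?K (Pr i) = Z i"
    using Z by simp
  with character.K_galois tame character.phi_iso p(1) ram show ?thesis
    unfolding realizable_decomp_def by (intro exI conjI)
qed

lemma realizable_decomp_imp_ram: "realizable_decomp G s T Z \<Longrightarrow> realizable_ram G s T"
  unfolding realizable_decomp_def realizable_ram_def
proof (elim exE conjE)
  fix K \<phi> p Pr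
  assume K: "galois_over_Q K" "tamely_ramified K" "\<phi> \<in> iso (galois_group K) G"
    "inj_on p {..<s}" "{q. prime q \<and> ramified_in K q} = p ` {..<s}"
    and Pr: "\<forall>i<s. Pr i \<in> primes_over K (p i) \<and> \<phi> ` inertia_group K (Pr i) = T i \<and>
      \<phi> ` decomposition_group K (Pr i) = Z i"
  have "\<forall>i<s. Pr i \<in> primes_over K (p i) \<and> \<phi> ` inertia_group K (Pr i) = T i" using Pr by simp
  with K show "\<exists>K \<phi> p Pr. galois_over_Q K \<and> tamely_ramified K \<and> \<phi> \<in> iso (galois_group K) G \<and>
      inj_on p {..<s} \<and> {q. prime q \<and> ramified_in K q} = p ` {..<s} \<and>
      (\<forall>i<s. Pr i \<in> primes_over K (p i) \<and> \<phi> ` inertia_group K (Pr i) = T i)"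
    by (intro exI conjI)
qed

theorem theorem3p4:
  fixes G :: "('a, 'b) monoid_scheme"
  assumes "comm_group G" and "finite (carrier G)"
  shows "(\<forall>s T Z. tame_split_decomp_config G s T Z \<longrightarrow> realizable_decomp G s T Z) \<and>
         (\<forall>s T. tame_ram_config G s T \<longrightarrow> realizable_ram G s T)"
proof -
  interpret comm_group G by fact
  show ?thesis
  proof (intro conjI allI impI)
    fix s T Z assume "tame_split_decomp_config G s T Z"
    then have T: "tame_ram_config G s T" and Z: "\<And>i. i < s \<Longrightarrow> Z i = T i"
      by (auto simp: tame_split_decomp_config_def)
    show "realizable_decomp G s T Z"
      by (rule realization[OF assms(2) T Z])
  next
    fix s T assume "tame_ram_config G s T"
    then have "realizable_decomp G s T T" by (rule realization[OF assms(2)]) simp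
    then show "realizable_ram G s T" by (rule realizable_decomp_imp_ram)
  qed
qed

end
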